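(* Let $(M_i)_{i\in I}$ be a family of von Neumann algebras. Then the direct sum von Neumann algebra $\bigoplus_{i\in I}M_i$ has the Haagerup approximation property if and only if $M_i$ has the Haagerup approximation property for all $i\in I$.
   Context: $\bigoplus_{i\in I}M_i$ is the von Neumann algebra direct sum (bounded families). Standard form: a quadruple $(M,H,J,P)$ where $M$ is a von Neumann algebra acting on a Hilbert space $H$, $J$ is a conjugate-linear isometry of $H$ with $J^2=1_H$, and $P\subset H$ is a closed convex cone which is self-dual, i.e. $P=\{\xi\in H\mid \langle\xi,\eta\rangle\ge 0 \text{ for all }\eta\in P\}$, such that (i) $JMJ=M'$; (ii) $J\xi=\xi$ for $\xi\in P$; (iii) $xJxJP\subset P$ for $x\in M$; (iv) $JcJ=c^*$ for $c\in M\cap M'$. Every von Neumann algebra is isomorphic to one in standard form, and standard forms are unique up to unitary equivalence. Completely positive operators: for $n\ge1$ let $P^{(n)}$ be the set of matrices $[\xi_{i,j}]\in \mathbb{M}_n(H)=H\otimes\mathbb{M}_n(\mathbb{C})$ with $\sum_{i,j=1}^n x_iJx_jJ\xi_{i,j}\in P$ for all $x_1,\dots,x_n\in M$. A bounded linear operator $T$ on $H$ is completely positive (c.p.) if $[T\xi_{i,j}]\in P^{(n)}$ for all $[\xi_{i,j}]\in P^{(n)}$ and all $n\ge 1$; it is c.c.p. if moreover $\|T\|\le1$. Haagerup approximation property (HAP): a von Neumann algebra (regarded as a W$^*$-algebra) $M$ has the HAP if there exist a standard form $(M,H,J,P)$ of $M$ and a net of c.c.p. compact operators $T_n$ on $H$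 with $T_n\to 1_H$ in the strong operator topology. *)

theory Defs
  imports "HOL-Analysis.Analysis"
begin

section \<open>Complex Hilbert spaces with explicit carrier\<close>

text \<open>
  Families of Hilbert spaces of different dimensions, and existential quantification over Hilbert
  spaces, require Hilbert spaces that are values rather than types.
\<close>

record 'h hilb =
  hcarrier :: "'h set"
  hzero :: "'h"
  hadd :: "'h \<Rightarrow> 'h \<Rightarrow> 'h"
  hscale :: "complex \<Rightarrow> 'h \<Rightarrow> 'h"
  hinner :: "'h \<Rightarrow> 'h \<Rightarrow> complex"

definition hnorm :: "'h hilb \<Rightarrow> 'h \<Rightarrow> real" where
  "hnorm H x = sqrt (Re (hinner H x x))"

text \<open>The value off the carrier is fixed because the locale \<open>Metric_space\<close> asks for
  nonnegativity and symmetry of the distance on the whole type.\<close>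

definition hdist :: "'h hilb \<Rightarrow> 'h \<Rightarrow> 'h \<Rightarrow> real" where
  "hdist H x y = (if x \<in> hcarrier H \<and> y \<in> hcarrier H
                  then hnorm H (hadd H x (hscale H (-1) y)) else 0)"

abbreviation htopology :: "'h hilb \<Rightarrow> 'h topology" where
  "htopology H \<equiv> Metric_space.mtopology (hcarrier H) (hdist H)"

text \<open>The inner product is linear in the first variable. The zero space is a Hilbert space.\<close>

locale hilbert_space =
  fixes H :: "'h hilb"
  assumes zero_closed: "hzero H \<in> hcarrier H"
    and add_closed: "\<lbrakk>x \<in> hcarrier H; y \<in> hcarrier H\<rbrakk> \<Longrightarrow> hadd H x y \<in> hcarrier H"
    and scale_closed: "x \<in> hcarrier H \<Longrightarrow> hscale H a x \<in> hcarrier H"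
    and add_assoc: "\<lbrakk>x \<in> hcarrier H; y \<in> hcarrier H; z \<in> hcarrier H\<rbrakk> \<Longrightarrow>
          hadd H (hadd H x y) z = hadd H x (hadd H y z)"
    and add_commute: "\<lbrakk>x \<in> hcarrier H; y \<in> hcarrier H\<rbrakk> \<Longrightarrow> hadd H x y = hadd H y x"
    and add_zero: "x \<in> hcarrier H \<Longrightarrow> hadd H x (hzero H) = x"
    and add_minus: "x \<in> hcarrier H \<Longrightarrow> hadd H x (hscale H (-1) x) = hzero H"
    and scale_add_right: "\<lbrakk>x \<in> hcarrier H; y \<in> hcarrier H\<rbrakk> \<Longrightarrow>
          hscale H a (hadd H x y) = hadd H (hscale H a x) (hscale H a y)"
    and scale_add_left: "x \<in> hcarrier H \<Longrightarrow>
          hscale H (a + b) x = hadd H (hscale H a x) (hscale H b x)"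
    and scale_scale: "x \<in> hcarrier H \<Longrightarrow> hscale H a (hscale H b x) = hscale H (a * b) x"
    and scale_one: "x \<in> hcarrier H \<Longrightarrow> hscale H 1 x = x"
    and inner_add_left: "\<lbrakk>x \<in> hcarrier H; y \<in> hcarrier H; z \<in> hcarrier H\<rbrakk> \<Longrightarrow>
          hinner H (hadd H x y) z = hinner H x z + hinner H y z"
    and inner_scale_left: "\<lbrakk>x \<in> hcarrier H; y \<in> hcarrier H\<rbrakk> \<Longrightarrow>
          hinner H (hscale H a x) y = a * hinner H x y"
    and inner_commute: "\<lbrakk>x \<in> hcarrier H; y \<in> hcarrier H\<rbrakk> \<Longrightarrow>
          hinner H x y = cnj (hinner H y x)"
    and inner_nonneg: "x \<in> hcarrier H \<Longrightarrow> hinner H x x \<in> \<real>\<^sub>\<ge>\<^sub>0"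
    and inner_eq_zero: "\<lbrakk>x \<in> hcarrier H; hinner H x x = 0\<rbrakk> \<Longrightarrow> x = hzero H"
    and complete: "Metric_space.mcomplete (hcarrier H) (hdist H)"

section \<open>Bounded operators\<close>

text \<open>Operators are functions that are \<open>undefined\<close> off the carrier, so that equality of
  operators is equality in HOL; accordingly, the product of operators is \<open>compose\<close>.\<close>

definition bounded_op :: "'h hilb \<Rightarrow> ('h \<Rightarrow> 'h) set" where
  "bounded_op H = {T \<in> hcarrier H \<rightarrow>\<^sub>E hcarrier H.
     (\<forall>x\<in>hcarrier H. \<forall>y\<in>hcarrier H. T (hadd H x y) = hadd H (T x) (T y)) \<and>
     (\<forall>a. \<forall>x\<in>hcarrier H. T (hscale H a x) = hscale H a (T x)) \<and>
     (\<exists>B. \<forall>x\<in>hcarrier H. hnorm H (T x) \<le> B * hnorm H x)}"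

definition op_mult :: "'h hilb \<Rightarrow> ('h \<Rightarrow> 'h) \<Rightarrow> ('h \<Rightarrow> 'h) \<Rightarrow> 'h \<Rightarrow> 'h" where
  "op_mult H S T = compose (hcarrier H) S T"

definition op_add :: "'h hilb \<Rightarrow> ('h \<Rightarrow> 'h) \<Rightarrow> ('h \<Rightarrow> 'h) \<Rightarrow> 'h \<Rightarrow> 'h" where
  "op_add H S T = (\<lambda>x\<in>hcarrier H. hadd H (S x) (T x))"

definition op_scale :: "'h hilb \<Rightarrow> complex \<Rightarrow> ('h \<Rightarrow> 'h) \<Rightarrow> 'h \<Rightarrow> 'h" where
  "op_scale H a T = (\<lambda>x\<in>hcarrier H. hscale H a (T x))"

text \<open>\<open>is_adjoint H T S\<close>: the adjoint of \<open>T\<close> is \<open>S\<close>.\<close>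

definition is_adjoint :: "'h hilb \<Rightarrow> ('h \<Rightarrow> 'h) \<Rightarrow> ('h \<Rightarrow> 'h) \<Rightarrow> bool" where
  "is_adjoint H T S \<longleftrightarrow> T \<in> bounded_op H \<and> S \<in> bounded_op H \<and>
     (\<forall>x\<in>hcarrier H. \<forall>y\<in>hcarrier H. hinner H (T x) y = hinner H x (S y))"

definition compact_op :: "'h hilb \<Rightarrow> ('h \<Rightarrow> 'h) \<Rightarrow> bool" where
  "compact_op H T \<longleftrightarrow> T \<in> bounded_op H \<and>
     compactin (htopology H)
       (htopology H closure_of (T ` {x \<in> hcarrier H. hnorm H x \<le> 1}))"

section \<open>Von Neumann algebras\<close>

definition commutant :: "'h hilb \<Rightarrow> ('h \<Rightarrow> 'h) set \<Rightarrow> ('h \<Rightarrow> 'h) set" where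
  "commutant H M = {S \<in> bounded_op H. \<forall>T\<in>M. op_mult H S T = op_mult H T S}"

text \<open>The condition \<open>M'' = M\<close> already makes \<open>M\<close> a unital subalgebra of \<open>B(H)\<close>.\<close>

definition von_neumann_algebra :: "'h hilb \<Rightarrow> ('h \<Rightarrow> 'h) set \<Rightarrow> bool" where
  "von_neumann_algebra H M \<longleftrightarrow> hilbert_space H \<and> M \<subseteq> bounded_op H \<and>
     (\<forall>T\<in>M. \<exists>S\<in>M. is_adjoint H T S) \<and>
     commutant H (commutant H M) = M"

text \<open>Isomorphism of von Neumann algebras, regarded as \<open>W\<^sup>*\<close>-algebras: a \<open>*\<close>-isomorphism
  (which is automatically isometric and normal), not necessarily spatial.\<close>

definition star_isomorphism ::
    "'h hilb \<Rightarrow> ('h \<Rightarrow> 'h) set \<Rightarrow> 'k hilb \<Rightarrow> ('k \<Rightarrow> 'k) set \<Rightarrow> (('h \<Rightarrow> 'h) \<Rightarrow> 'k \<Rightarrow> 'k) \<Rightarrow> bool" where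
  "star_isomorphism H M K N \<phi> \<longleftrightarrow> bij_betw \<phi> M N \<and>
     (\<forall>x\<in>M. \<forall>y\<in>M. \<phi> (op_add H x y) = op_add K (\<phi> x) (\<phi> y)) \<and>
     (\<forall>a. \<forall>x\<in>M. \<phi> (op_scale H a x) = op_scale K a (\<phi> x)) \<and>
     (\<forall>x\<in>M. \<forall>y\<in>M. \<phi> (op_mult H x y) = op_mult K (\<phi> x) (\<phi> y)) \<and>
     (\<forall>x\<in>M. \<forall>y\<in>M. is_adjoint H x y \<longrightarrow> is_adjoint K (\<phi> x) (\<phi> y))"

section \<open>Direct sums\<close>

definition hilbert_sum :: "'i set \<Rightarrow> ('i \<Rightarrow> 'h hilb) \<Rightarrow> ('i \<Rightarrow> 'h) hilb" where
  "hilbert_sum I H =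
    \<lparr> hcarrier = {f \<in> (\<Pi>\<^sub>E i\<in>I. hcarrier (H i)). (\<lambda>i. (hnorm (H i) (f i))\<^sup>2) summable_on I},
      hzero = (\<lambda>i\<in>I. hzero (H i)),
      hadd = (\<lambda>f g. \<lambda>i\<in>I. hadd (H i) (f i) (g i)),
      hscale = (\<lambda>a f. \<lambda>i\<in>I. hscale (H i) a (f i)),
      hinner = (\<lambda>f g. \<Sum>\<^sub>\<infinity>i\<in>I. hinner (H i) (f i) (g i)) \<rparr>"

text \<open>The bounded families \<open>x\<close> in the product of the \<open>M i\<close>, acting diagonally on the Hilbert
  space direct sum.\<close>

definition vN_sum :: "'i set \<Rightarrow> ('i \<Rightarrow> 'h hilb) \<Rightarrow> ('i \<Rightarrow> ('h \<Rightarrow> 'h) set) \<Rightarrow>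
    (('i \<Rightarrow> 'h) \<Rightarrow> ('i \<Rightarrow> 'h)) set" where
  "vN_sum I H M =
    (\<lambda>x. \<lambda>f\<in>hcarrier (hilbert_sum I H). \<lambda>i\<in>I. x i (f i)) `
      {x \<in> (\<Pi>\<^sub>E i\<in>I. M i).
         \<exists>B. \<forall>i\<in>I. \<forall>v\<in>hcarrier (H i). hnorm (H i) (x i v) \<le> B * hnorm (H i) v}"

section \<open>Standard forms and completely positive operators\<close>

definition conj_linear_involution :: "'h hilb \<Rightarrow> ('h \<Rightarrow> 'h) \<Rightarrow> bool" where
  "conj_linear_involution H J \<longleftrightarrow> J \<in> hcarrier H \<rightarrow>\<^sub>E hcarrier H \<and>
     (\<forall>x\<in>hcarrier H. \<forall>y\<in>hcarrier H. J (hadd H x y) = hadd H (J x) (J y)) \<and>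
     (\<forall>a. \<forall>x\<in>hcarrier H. J (hscale H a x) = hscale H (cnj a) (J x)) \<and>
     (\<forall>x\<in>hcarrier H. hnorm H (J x) = hnorm H x) \<and>
     (\<forall>x\<in>hcarrier H. J (J x) = x)"

definition self_dual_cone :: "'h hilb \<Rightarrow> 'h set \<Rightarrow> bool" where
  "self_dual_cone H P \<longleftrightarrow> P \<subseteq> hcarrier H \<and> closedin (htopology H) P \<and>
     (\<forall>\<xi>\<in>P. \<forall>\<eta>\<in>P. hadd H \<xi> \<eta> \<in> P) \<and>
     (\<forall>r\<ge>0. \<forall>\<xi>\<in>P. hscale H (complex_of_real r) \<xi> \<in> P) \<and>
     P = {\<xi> \<in> hcarrier H. \<forall>\<eta>\<in>P. hinner H \<xi> \<eta> \<in> \<real>\<^sub>\<ge>\<^sub>0}"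

definition J_conj :: "'h hilb \<Rightarrow> ('h \<Rightarrow> 'h) \<Rightarrow> ('h \<Rightarrow> 'h) \<Rightarrow> 'h \<Rightarrow> 'h" where
  "J_conj H J x = op_mult H J (op_mult H x J)"

definition standard_form :: "'h hilb \<Rightarrow> ('h \<Rightarrow> 'h) set \<Rightarrow> ('h \<Rightarrow> 'h) \<Rightarrow> 'h set \<Rightarrow> bool" where
  "standard_form H M J P \<longleftrightarrow> von_neumann_algebra H M \<and>
     conj_linear_involution H J \<and> self_dual_cone H P \<and>
     J_conj H J ` M = commutant H M \<and>
     (\<forall>\<xi>\<in>P. J \<xi> = \<xi>) \<and>
     (\<forall>x\<in>M. \<forall>\<xi>\<in>P. x (J (x (J \<xi>))) \<in> P) \<and>
     (\<forall>c\<in>M \<inter> commutant H M. is_adjoint H c (J_conj H J c))"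

primrec hsum :: "'h hilb \<Rightarrow> (nat \<Rightarrow> 'h) \<Rightarrow> nat \<Rightarrow> 'h" where
  "hsum H f 0 = hzero H"
| "hsum H f (Suc n) = hadd H (hsum H f n) (f n)"

text \<open>The cone \<open>P\<^sup>(\<^sup>n\<^sup>)\<close>. A matrix \<open>\<xi>\<close> is indexed by \<open>i, j < n\<close>; its other entries are
  irrelevant.\<close>

definition matrix_cone ::
    "'h hilb \<Rightarrow> ('h \<Rightarrow> 'h) set \<Rightarrow> ('h \<Rightarrow> 'h) \<Rightarrow> 'h set \<Rightarrow> nat \<Rightarrow> (nat \<Rightarrow> nat \<Rightarrow> 'h) set" where
  "matrix_cone H M J P n = {\<xi>. (\<forall>i<n. \<forall>j<n. \<xi> i j \<in> hcarrier H) \<and>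
     (\<forall>x. (\<forall>i<n. x i \<in> M) \<longrightarrow>
        hsum H (\<lambda>i. hsum H (\<lambda>j. x i (J (x j (J (\<xi> i j))))) n) n \<in> P)}"

definition completely_positive ::
    "'h hilb \<Rightarrow> ('h \<Rightarrow> 'h) set \<Rightarrow> ('h \<Rightarrow> 'h) \<Rightarrow> 'h set \<Rightarrow> ('h \<Rightarrow> 'h) \<Rightarrow> bool" where
  "completely_positive H M J P T \<longleftrightarrow> T \<in> bounded_op H \<and>
     (\<forall>n\<ge>1. \<forall>\<xi>\<in>matrix_cone H M J P n. (\<lambda>i j. T (\<xi> i j)) \<in> matrix_cone H M J P n)"

definition ccp ::
    "'h hilb \<Rightarrow> ('h \<Rightarrow> 'h) set \<Rightarrow> ('h \<Rightarrow> 'h) \<Rightarrow> 'h set \<Rightarrow> ('h \<Rightarrow> 'h) \<Rightarrow> bool" where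
  "ccp H M J P T \<longleftrightarrow> completely_positive H M J P T \<and>
     (\<forall>x\<in>hcarrier H. hnorm H (T x) \<le> hnorm H x)"

section \<open>The Haagerup approximation property\<close>

text \<open>
  HOL cannot quantify existentially over types, so the Hilbert space of the standard form is
  taken with carrier in a fixed type that depends only on the type of \<open>M\<close>.  This is no
  restriction: every standard form \<open>(N, K, J, P)\<close> of \<open>M\<close>, on any type, has a copy there.  Let
  \<open>\<phi>\<close> be the isomorphism of \<open>M\<close> onto \<open>N\<close>, choose a maximal family of nonzero vectors \<open>\<xi>\<^sub>\<alpha>\<close> in \<open>K\<close>
  with pairwise orthogonal subspaces \<open>N \<xi>\<^sub>\<alpha>\<close>, and let \<open>p\<^sub>\<alpha> \<in> N'\<close> be the projection onto the
  closure of \<open>N \<xi>\<^sub>\<alpha>\<close>.  Then \<open>J p\<^sub>\<alpha> J \<in> N\<close>, so the vectors \<open>\<phi>(x) \<xi>\<^sub>\<alpha>\<close>, which span a dense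
  subspace, are indexed by pairs \<open>(x, \<phi>\<^sup>-\<^sup>1 (J p\<^sub>\<alpha> J))\<close> of elements of \<open>M\<close>, and the inner
  products with them determine a vector of \<open>K\<close>.
\<close>

type_synonym 'h sf_univ = "('h \<Rightarrow> 'h) \<times> ('h \<Rightarrow> 'h) \<Rightarrow> complex"

text \<open>Nets are rendered as proper filters on the set of operators: a net yields the filter
  generated by the images of its tails, and every proper filter arises in this way from a net.
  Convergence is pointwise in norm, i.e. in the strong operator topology.\<close>

definition haagerup_approximation_property :: "'h hilb \<Rightarrow> ('h \<Rightarrow> 'h) set \<Rightarrow> bool" where
  "haagerup_approximation_property H M \<longleftrightarrow>
    (\<exists>(K :: 'h sf_univ hilb) N J P \<phi>.
       standard_form K N J P \<and> star_isomorphism H M K N \<phi> \<and>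
       (\<exists>\<F> :: ('h sf_univ \<Rightarrow> 'h sf_univ) filter. \<F> \<noteq> bot \<and>
          (\<forall>\<^sub>F T in \<F>. ccp K N J P T \<and> compact_op K T) \<and>
          (\<forall>\<xi>\<in>hcarrier K. limitin (htopology K) (\<lambda>T. T \<xi>) \<xi> \<F>)))"

end

theory Submission
  imports Defs
begin

text \<open>
  Both directions cut down a standard form \<open>(N, K, J, P)\<close> by a central projection \<open>q\<close>: since
  \<open>q = JqJ\<close>, one has \<open>q P \<subseteq> P\<close>, the compression \<open>(q N, q K, J, q P)\<close> is again a standard form, and
  \<open>T \<mapsto> q T\<close> carries c.c.p. compact approximants of the identity to such approximants. A maximal
  family of vectors \<open>\<xi>\<close> with pairwise orthogonal \<open>N \<xi>\<close> embeds \<open>q K\<close> into the type fixed by the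
  definition of the approximation property.

  For a summand, \<open>q\<close> is the image of the unit of \<open>M\<^sub>i\<close>. For the sum, \<open>q = 1\<close> on the direct sum of the
  standard forms, which is a standard form because \<open>(\<Oplus> N\<^sub>i)' = \<Oplus> N\<^sub>i'\<close>; it is approximated by direct
  sums of approximants of finitely many summands. The given isomorphisms \<open>M\<^sub>i \<rightarrow> N\<^sub>i\<close> combine to one of the
  direct sums because star isomorphisms are isometric.
\<close>

section \<open>Hilbert spaces\<close>

text \<open>The approximation property of an algebra fixes the type of its Hilbert space, and this
  type is different for the sum and for the summands. Standard forms obtained from the hypothesis
  therefore sit in the wrong type, and each transfer has to end with an injection of vectors into
  complex functions on pairs of elements of the target algebra. A vector is coded by its pairings
  with \<open>x \<xi>\<close>; here \<open>\<xi>\<close> itself is coded by the element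
  \<open>J p J\<close> of the algebra, where \<open>p\<close> in the commutant projects onto the
  closure of \<open>N \<xi>\<close>. A central \<open>q\<close> commutes with the algebra, with its
  commutant and with \<open>J\<close>. It can be moved past every factor of the double sums defining
  the matrix cones, and both commutants can be computed after compression by extending operators by
  zero. Direct sums consist of uniformly bounded families, whereas the isomorphisms of the summands
  are purely algebraic and chosen independently. Norms enter algebra through invertibility:
  \<open>m - x* x\<close> is invertible in the algebra as soon as \<open>m\<close> exceeds the
  square of a bound for \<open>x\<close>.\<close>

text \<open>Completeness is split off from \<open>hilbert_space\<close> because it can be checked on sequences only
  once \<open>hdist\<close> is known to be a metric.\<close>

locale pre_hilbert =
  fixes H :: "'h hilb"
  assumes zero_in [simp]: "hzero H \<in> hcarrier H"
    and add_in [simp]: "\<lbrakk>x \<in> hcarrier H; y \<in> hcarrier H\<rbrakk> \<Longrightarrow> hadd H x y \<in> hcarrier H"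
    and scale_in [simp]: "x \<in> hcarrier H \<Longrightarrow> hscale H a x \<in> hcarrier H"
    and add_ac: "\<lbrakk>x \<in> hcarrier H; y \<in> hcarrier H; z \<in> hcarrier H\<rbrakk> \<Longrightarrow>
          hadd H (hadd H x y) z = hadd H x (hadd H y z)"
    and add_com: "\<lbrakk>x \<in> hcarrier H; y \<in> hcarrier H\<rbrakk> \<Longrightarrow> hadd H x y = hadd H y x"
    and add_0: "x \<in> hcarrier H \<Longrightarrow> hadd H x (hzero H) = x"
    and add_neg: "x \<in> hcarrier H \<Longrightarrow> hadd H x (hscale H (-1) x) = hzero H"
    and scale_distrib: "\<lbrakk>x \<in> hcarrier H; y \<in> hcarrier H\<rbrakk> \<Longrightarrow>
          hscale H a (hadd H x y) = hadd H (hscale H a x) (hscale H a y)"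
    and scale_add: "x \<in> hcarrier H \<Longrightarrow>
          hscale H (a + b) x = hadd H (hscale H a x) (hscale H b x)"
    and scale_mult: "x \<in> hcarrier H \<Longrightarrow> hscale H a (hscale H b x) = hscale H (a * b) x"
    and scale_1: "x \<in> hcarrier H \<Longrightarrow> hscale H 1 x = x"
    and inner_addL [simp]: "\<lbrakk>x \<in> hcarrier H; y \<in> hcarrier H; z \<in> hcarrier H\<rbrakk> \<Longrightarrow>
          hinner H (hadd H x y) z = hinner H x z + hinner H y z"
    and inner_scaleL [simp]: "\<lbrakk>x \<in> hcarrier H; y \<in> hcarrier H\<rbrakk> \<Longrightarrow>
          hinner H (hscale H a x) y = a * hinner H x y"
    and inner_cnj: "\<lbrakk>x \<in> hcarrier H; y \<in> hcarrier H\<rbrakk> \<Longrightarrow>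
          hinner H x y = cnj (hinner H y x)"
    and inner_self_nonneg: "x \<in> hcarrier H \<Longrightarrow> hinner H x x \<in> \<real>\<^sub>\<ge>\<^sub>0"
    and inner_self_0: "\<lbrakk>x \<in> hcarrier H; hinner H x x = 0\<rbrakk> \<Longrightarrow> x = hzero H"

sublocale hilbert_space \<subseteq> pre_hilbert
  by unfold_locales
    (fact zero_closed add_closed scale_closed add_assoc add_commute add_zero add_minus
      scale_add_right scale_add_left scale_scale scale_one inner_add_left inner_scale_left
      inner_commute inner_nonneg inner_eq_zero)+

abbreviation hsub :: "'h hilb \<Rightarrow> 'h \<Rightarrow> 'h \<Rightarrow> 'h" where
  "hsub H x y \<equiv> hadd H x (hscale H (-1) y)"

context pre_hilbert
begin

lemma inner_addR [simp]:
  "\<lbrakk>x \<in> hcarrier H; y \<in> hcarrier H; z \<in> hcarrier H\<rbrakk> \<Longrightarrow>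
    hinner H z (hadd H x y) = hinner H z x + hinner H z y"
  by (metis add_in complex_cnj_add inner_addL inner_cnj)

lemma inner_scaleR [simp]:
  "\<lbrakk>x \<in> hcarrier H; y \<in> hcarrier H\<rbrakk> \<Longrightarrow> hinner H x (hscale H a y) = cnj a * hinner H x y"
  by (metis complex_cnj_mult inner_cnj inner_scaleL scale_in)

lemma inner_zeroL [simp]: "x \<in> hcarrier H \<Longrightarrow> hinner H (hzero H) x = 0"
  using add_neg[OF zero_in] inner_addL[of "hzero H" "hscale H (-1) (hzero H)" x] by simp

lemma inner_zeroR [simp]: "x \<in> hcarrier H \<Longrightarrow> hinner H x (hzero H) = 0"
  by (metis complex_cnj_zero inner_cnj inner_zeroL zero_in)

text \<open>Nondegeneracy: \<open>x - y\<close> pairs to zero with every vector, in particular with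
  itself. Many vector identities below are proved this way, since pairing with an arbitrary
  \<open>z\<close> turns them into arithmetic of complex numbers.\<close>

lemma inner_ext:
  assumes "x \<in> hcarrier H" "y \<in> hcarrier H" "\<And>z. z \<in> hcarrier H \<Longrightarrow> hinner H x z = hinner H y z"
  shows "x = y"
proof -
  have "hsub H x y = hzero H"
    using assms by (intro inner_self_0) auto
  then have "y = hadd H y (hsub H x y)" using assms add_0 by simp
  also have "\<dots> = hadd H x (hsub H y y)"
    using assms by (metis add_ac add_com scale_in)
  finally show ?thesis using assms by (simp add: add_neg add_0)
qed

lemma scale_0: "x \<in> hcarrier H \<Longrightarrow> hscale H 0 x = hzero H"
  by (rule inner_ext) auto

lemma scale_zero: "hscale H a (hzero H) = hzero H"
  by (rule inner_ext) auto

lemma zero_add: "x \<in> hcarrier H \<Longrightarrow> hadd H (hzero H) x = x"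
  by (rule inner_ext) auto

lemma hnorm_nonneg [simp]: "x \<in> hcarrier H \<Longrightarrow> 0 \<le> hnorm H x"
  using inner_self_nonneg[of x] by (auto simp: hnorm_def complex_nonneg_Reals_iff)

lemma hnorm_sq: "x \<in> hcarrier H \<Longrightarrow> (hnorm H x)\<^sup>2 = Re (hinner H x x)"
  using inner_self_nonneg[of x] by (auto simp: hnorm_def complex_nonneg_Reals_iff)

lemma inner_self: "x \<in> hcarrier H \<Longrightarrow> hinner H x x = complex_of_real ((hnorm H x)\<^sup>2)"
  using inner_self_nonneg[of x] by (auto simp: hnorm_sq complex_nonneg_Reals_iff complex_eq_iff)

lemma hnorm_zero [simp]: "hnorm H (hzero H) = 0"
  by (simp add: hnorm_def)

lemma hnorm_eq_0: "x \<in> hcarrier H \<Longrightarrow> hnorm H x = 0 \<longleftrightarrow> x = hzero H"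
  using inner_self inner_self_0 by fastforce

lemma Re_inner_sym: "\<lbrakk>x \<in> hcarrier H; y \<in> hcarrier H\<rbrakk> \<Longrightarrow> Re (hinner H x y) = Re (hinner H y x)"
  by (subst inner_cnj) auto

lemma hnorm_scale [simp]: "x \<in> hcarrier H \<Longrightarrow> hnorm H (hscale H a x) = cmod a * hnorm H x"
proof -
  assume x: "x \<in> hcarrier H"
  have "complex_of_real ((hnorm H (hscale H a x))\<^sup>2) = (a * cnj a) * hinner H x x"
    using x by (subst inner_self[symmetric]) auto
  also have "\<dots> = complex_of_real ((cmod a * hnorm H x)\<^sup>2)"
    using x complex_norm_square[of a] by (simp add: inner_self power_mult_distrib)
  finally have "(hnorm H (hscale H a x))\<^sup>2 = (cmod a * hnorm H x)\<^sup>2"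
    using of_real_eq_iff by blast
  then show ?thesis using x by (simp add: power2_eq_iff_nonneg)
qed

lemma hnorm_add_sq:
  "\<lbrakk>x \<in> hcarrier H; y \<in> hcarrier H\<rbrakk> \<Longrightarrow>
    (hnorm H (hadd H x y))\<^sup>2 = (hnorm H x)\<^sup>2 + 2 * Re (hinner H x y) + (hnorm H y)\<^sup>2"
  using Re_inner_sym[of x y] by (simp add: hnorm_sq)

lemma cauchy_schwarz:
  assumes x: "x \<in> hcarrier H" and y: "y \<in> hcarrier H"
  shows "cmod (hinner H x y) \<le> hnorm H x * hnorm H y"
proof (cases "hnorm H y = 0")
  case True
  then show ?thesis using hnorm_eq_0 x y by simp
next
  case False
  define n where "n = (hnorm H y)\<^sup>2"
  define c where "c = hinner H x y"
  have n: "n > 0" using False by (simp add: n_def)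
  \<comment> \<open>With this \<open>a\<close> the vector \<open>x + a y\<close> is the component of
    \<open>x\<close> orthogonal to \<open>y\<close>. That its square norm is nonnegative is the
    inequality.\<close>
  define a where "a = - c / complex_of_real n"
  have "0 \<le> (hnorm H (hadd H x (hscale H a y)))\<^sup>2" by simp
  also have "\<dots> = (hnorm H x)\<^sup>2 + 2 * Re (cnj a * c) + (cmod a)\<^sup>2 * n"
    using x y by (simp add: hnorm_add_sq c_def n_def power_mult_distrib)
  also have "cnj a * c = - complex_of_real ((cmod c)\<^sup>2 / n)"
    using complex_norm_square[of c] by (simp add: a_def mult.commute)
  also have "(cmod a)\<^sup>2 * n = (cmod c)\<^sup>2 / n"
    using n by (simp add: a_def norm_divide power_divide power2_eq_square)
  finally have "(cmod c)\<^sup>2 / n \<le> (hnorm H x)\<^sup>2" by simp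
  then have "(cmod c)\<^sup>2 \<le> (hnorm H x * hnorm H y)\<^sup>2"
    using n by (simp add: n_def power_mult_distrib field_simps)
  then show ?thesis unfolding c_def by (rule power2_le_imp_le) (use x y in simp)
qed

lemma hnorm_triangle:
  assumes x: "x \<in> hcarrier H" and y: "y \<in> hcarrier H"
  shows "hnorm H (hadd H x y) \<le> hnorm H x + hnorm H y"
proof -
  have "Re (hinner H x y) \<le> hnorm H x * hnorm H y"
    using cauchy_schwarz[OF x y] complex_Re_le_cmod order_trans by blast
  then have "(hnorm H (hadd H x y))\<^sup>2 \<le> (hnorm H x + hnorm H y)\<^sup>2"
    using x y by (simp add: hnorm_add_sq power2_sum)
  then show ?thesis by (rule power2_le_imp_le) (use x y in simp)
qed

lemma hdist_eq: "\<lbrakk>x \<in> hcarrier H; y \<in> hcarrier H\<rbrakk> \<Longrightarrow> hdist H x y = hnorm H (hsub H x y)"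
  by (simp add: hdist_def)

lemma hdist_commute: "hdist H x y = hdist H y x"
proof (cases "x \<in> hcarrier H \<and> y \<in> hcarrier H")
  case True
  then have "hsub H y x = hscale H (-1) (hsub H x y)" by (intro inner_ext) auto
  then show ?thesis using True by (simp add: hdist_eq)
qed (auto simp: hdist_def)

sublocale Metric_space "hcarrier H" "hdist H"
proof
  fix x y z
  show "0 \<le> hdist H x y" by (auto simp: hdist_def)
  show "hdist H x y = hdist H y x" by (rule hdist_commute)
  assume x: "x \<in> hcarrier H" and y: "y \<in> hcarrier H"
  show "hdist H x y = 0 \<longleftrightarrow> x = y"
  proof
    assume "hdist H x y = 0"
    then have 0: "hsub H x y = hzero H" using x y by (simp add: hdist_eq hnorm_eq_0)
    have "hinner H (hsub H x y) v = 0" if "v \<in> hcarrier H" for v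
      using 0 that by simp
    then show "x = y" using x y by (intro inner_ext) auto
  qed (use x in \<open>simp add: hdist_eq add_neg\<close>)
  assume z: "z \<in> hcarrier H"
  have "hsub H x z = hadd H (hsub H x y) (hsub H y z)"
    using x y z by (intro inner_ext) auto
  then show "hdist H x z \<le> hdist H x y + hdist H y z"
    using x y z by (simp add: hdist_eq hnorm_triangle)
qed

section \<open>Distances, limits and completeness\<close>

lemma hdist_nonneg: "0 \<le> hdist H x y"
  by (auto simp: hdist_def)

lemma hdist_add:
  assumes "x \<in> hcarrier H" "y \<in> hcarrier H" "u \<in> hcarrier H" "v \<in> hcarrier H"
  shows "hdist H (hadd H x y) (hadd H u v) \<le> hdist H x u + hdist H y v"
proof -
  have "hsub H (hadd H x y) (hadd H u v) = hadd H (hsub H x u) (hsub H y v)"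
    using assms by (intro inner_ext) auto
  then show ?thesis using assms by (simp add: hdist_eq hnorm_triangle)
qed

lemma hdist_scale:
  assumes "x \<in> hcarrier H" "y \<in> hcarrier H"
  shows "hdist H (hscale H a x) (hscale H a y) = cmod a * hdist H x y"
proof -
  have "hsub H (hscale H a x) (hscale H a y) = hscale H a (hsub H x y)"
    using assms by (intro inner_ext) (auto simp: algebra_simps)
  then show ?thesis using assms by (simp add: hdist_eq)
qed

lemma inner_hdist:
  assumes "x \<in> hcarrier H" "y \<in> hcarrier H" "z \<in> hcarrier H"
  shows "cmod (hinner H x z - hinner H y z) \<le> hdist H x y * hnorm H z"
  using cauchy_schwarz[of "hsub H x y" z] assms by (simp add: hdist_eq)

text \<open>Since \<open>hdist\<close> is zero off the carrier, small distances do not force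
  membership in the carrier; it is recorded as a separate conjunct and is obtained from the metric
  definition at the radius \<open>1\<close>.\<close>

lemma limitin_iff:
  "limitin mtopology s l sequentially \<longleftrightarrow>
    l \<in> hcarrier H \<and> (\<forall>\<^sub>F n in sequentially. s n \<in> hcarrier H) \<and> (\<lambda>n. hdist H (s n) l) \<longlonglongrightarrow> 0"
proof -
  have "(\<lambda>n. hdist H (s n) l) \<longlonglongrightarrow> 0 \<longleftrightarrow> (\<forall>e>0. \<forall>\<^sub>F n in sequentially. hdist H (s n) l < e)"
    by (simp add: tendsto_iff dist_real_def)
  then show ?thesis
    unfolding limitin_metric by (auto simp: eventually_conj_iff dest: spec[of _ "1::real"])
qed

lemma inner_limitL:
  assumes "\<And>n. s n \<in> hcarrier H" "l \<in> hcarrier H" "z \<in> hcarrier H"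
    and lim: "(\<lambda>n. hdist H (s n) l) \<longlonglongrightarrow> 0"
  shows "(\<lambda>n. hinner H (s n) z) \<longlonglongrightarrow> hinner H l z"
proof (rule LIM_zero_cancel, rule Lim_null_comparison)
  show "\<forall>\<^sub>F n in sequentially. norm (hinner H (s n) z - hinner H l z) \<le> hdist H (s n) l * hnorm H z"
    using assms by (simp add: inner_hdist)
  show "(\<lambda>n. hdist H (s n) l * hnorm H z) \<longlonglongrightarrow> 0"
    using tendsto_mult_right[OF lim, of "hnorm H z"] by simp
qed

text \<open>Reduces completeness to exhibiting limits of Cauchy sequences, phrased with real
  sequences of distances. Both new spaces, the range of a projection and the direct sum, are shown
  to be complete through it.\<close>

lemma hilbert_spaceI:
  assumes "\<And>s. \<lbrakk>\<And>n. s n \<in> hcarrier H; \<And>e. e > 0 \<Longrightarrow> \<exists>N. \<forall>m\<ge>N. \<forall>n\<ge>N. hdist H (s m) (s n) < e\<rbrakk>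
    \<Longrightarrow> \<exists>l\<in>hcarrier H. (\<lambda>n. hdist H (s n) l) \<longlonglongrightarrow> 0"
  shows "hilbert_space H"
proof -
  have "mcomplete"
    unfolding mcomplete_def
  proof (intro allI impI)
    fix s assume s: "MCauchy s"
    then have s1: "s n \<in> hcarrier H" for n by (auto simp: MCauchy_def)
    moreover have "\<exists>N. \<forall>m\<ge>N. \<forall>n\<ge>N. hdist H (s m) (s n) < e" if "e > 0" for e
      using s that unfolding MCauchy_def by meson
    ultimately obtain l where "l\<in>hcarrier H" "(\<lambda>n. hdist H (s n) l) \<longlonglongrightarrow> 0"
      using assms[of s] by blast
    then show "\<exists>x. limitin mtopology s x sequentially"
      using s1 by (auto simp: limitin_iff)
  qed
  show ?thesis
    by unfold_locales
      (fact \<open>mcomplete\<close> zero_in add_in scale_in add_ac add_com add_0 add_neg scale_distrib scale_add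
        scale_mult scale_1 inner_addL inner_scaleL inner_cnj inner_self_nonneg inner_self_0)+
qed

end

section \<open>Self-dual cones and orthogonal projections in complete spaces\<close>

context hilbert_space
begin

lemma cauchy_limit:
  assumes "\<And>n. s n \<in> hcarrier H" "\<And>e. e > 0 \<Longrightarrow> \<exists>N. \<forall>m\<ge>N. \<forall>n\<ge>N. hdist H (s m) (s n) < e"
  obtains l where "l \<in> hcarrier H" "(\<lambda>n. hdist H (s n) l) \<longlonglongrightarrow> 0"
proof -
  have "MCauchy s"
    using assms unfolding MCauchy_def by blast
  then obtain l where "limitin mtopology s l sequentially"
    using complete unfolding mcomplete_def by blast
  then show ?thesis using that by (auto simp: limitin_iff)
qed

text \<open>The vectors with nonnegative pairing against a given set form a closed convex cone,
  because the pairing is additive, homogeneous and continuous and the nonnegative reals are closed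
  under sums, products and limits. A candidate cone is thus recognised by its duality
  equation.\<close>

lemma self_dual_cone_iff:
  "self_dual_cone H P \<longleftrightarrow> P = {\<xi> \<in> hcarrier H. \<forall>\<eta>\<in>P. hinner H \<xi> \<eta> \<in> \<real>\<^sub>\<ge>\<^sub>0}"
proof
  assume P: "P = {\<xi> \<in> hcarrier H. \<forall>\<eta>\<in>P. hinner H \<xi> \<eta> \<in> \<real>\<^sub>\<ge>\<^sub>0}"
  then have sub: "P \<subseteq> hcarrier H" by blast
  have closed: "closedin mtopology P"
    unfolding metric_closedin_iff_sequentially_closed
  proof (intro conjI allI impI sub)
    fix s l assume "range s \<subseteq> P \<and> limitin mtopology s l sequentially"
    then have s: "s n \<in> P" and l: "l \<in> hcarrier H" and lim: "(\<lambda>n. hdist H (s n) l) \<longlonglongrightarrow> 0" for n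
      by (auto simp: limitin_iff)
    have "hinner H l \<eta> \<in> \<real>\<^sub>\<ge>\<^sub>0" if "\<eta> \<in> P" for \<eta>
    proof -
      have "(\<lambda>n. hinner H (s n) \<eta>) \<longlonglongrightarrow> hinner H l \<eta>"
        using s l lim sub that by (intro inner_limitL) auto
      moreover have "hinner H (s n) \<eta> \<in> \<real>\<^sub>\<ge>\<^sub>0" for n
        using s[of n] that P by blast
      ultimately show ?thesis
        by (rule closed_sequentially[OF closed_nonneg_Reals_complex, rotated])
    qed
    with l show "l \<in> P" using P by blast
  qed
  have "hadd H \<xi> \<eta> \<in> P" if "\<xi> \<in> P" "\<eta> \<in> P" for \<xi> \<eta>
  proof -
    have "hinner H (hadd H \<xi> \<eta>) \<zeta> \<in> \<real>\<^sub>\<ge>\<^sub>0" if z: "\<zeta> \<in> P" for \<zeta>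
    proof -
      have "hinner H \<xi> \<zeta> \<in> \<real>\<^sub>\<ge>\<^sub>0" "hinner H \<eta> \<zeta> \<in> \<real>\<^sub>\<ge>\<^sub>0"
        using P \<open>\<xi> \<in> P\<close> \<open>\<eta> \<in> P\<close> z by blast+
      then show ?thesis using sub \<open>\<xi> \<in> P\<close> \<open>\<eta> \<in> P\<close> z by (subst inner_addL) (auto intro: nonneg_Reals_add_I)
    qed
    moreover have "hadd H \<xi> \<eta> \<in> hcarrier H" using sub that by (meson add_in scale_in subsetD)
    ultimately show ?thesis using P by blast
  qed
  moreover have "hscale H (complex_of_real r) \<xi> \<in> P" if "\<xi> \<in> P" "r \<ge> 0" for \<xi> r
  proof -
    have "hinner H (hscale H (complex_of_real r) \<xi>) \<zeta> \<in> \<real>\<^sub>\<ge>\<^sub>0" if z: "\<zeta> \<in> P" for \<zeta>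
    proof -
      have "hinner H \<xi> \<zeta> \<in> \<real>\<^sub>\<ge>\<^sub>0"
        using P \<open>\<xi> \<in> P\<close> z by blast
      then show ?thesis using sub \<open>\<xi> \<in> P\<close> z \<open>r \<ge> 0\<close>
        by (subst inner_scaleL) (auto intro!: nonneg_Reals_mult_I)
    qed
    moreover have "hscale H (complex_of_real r) \<xi> \<in> hcarrier H" using sub that by (meson add_in scale_in subsetD)
    ultimately show ?thesis using P by blast
  qed
  ultimately show "self_dual_cone H P"
    unfolding self_dual_cone_def using sub closed P by blast
qed (simp add: self_dual_cone_def)

text \<open>Orthogonal projection onto the closure of a subspace \<open>W\<close>, the closure being encoded as the
  bi-orthogonal complement.\<close>

lemma projection_exists:
  assumes W: "W \<subseteq> hcarrier H" "hzero H \<in> W" "\<And>x y. \<lbrakk>x \<in> W; y \<in> W\<rbrakk> \<Longrightarrow> hadd H x y \<in> W"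
    "\<And>a x. x \<in> W \<Longrightarrow> hscale H a x \<in> W"
    and x: "x \<in> hcarrier H"
  obtains l where "l \<in> hcarrier H" "\<And>w. w \<in> W \<Longrightarrow> hinner H (hsub H x l) w = 0"
    "\<And>u. \<lbrakk>u \<in> hcarrier H; \<And>w. w \<in> W \<Longrightarrow> hinner H w u = 0\<rbrakk> \<Longrightarrow> hinner H l u = 0"
proof -
  define f where "f = (\<lambda>w. (hdist H x w)\<^sup>2)"
  define d where "d = Inf (f ` W)"
  have bdd: "bdd_below (f ` W)" unfolding f_def by (rule bdd_belowI[of _ 0]) auto
  have d_le: "d \<le> f w" if "w \<in> W" for w
    unfolding d_def using bdd that by (simp add: cInf_lower)
  have ex: "\<exists>w. w \<in> W \<and> f w < d + inverse (real (Suc n))" for n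
  proof -
    have "d < d + inverse (real (Suc n))" by simp
    then show ?thesis unfolding d_def using W(2) bdd by (subst (asm) cInf_less_iff) auto
  qed
  define s where "s = (\<lambda>n. SOME w. w \<in> W \<and> f w < d + inverse (real (Suc n)))"
  have s: "s n \<in> W" "f (s n) < d + inverse (real (Suc n))" for n
    using someI_ex[OF ex[of n]] by (auto simp: s_def)
  have sH: "s n \<in> hcarrier H" for n using s W by auto
  have cau: "(hdist H (s m) (s n))\<^sup>2 \<le> 2 * inverse (real (Suc m)) + 2 * inverse (real (Suc n))" for m n
  proof -
    \<comment> \<open>The midpoint lies in \<open>W\<close>, so \<open>f u\<close> is at least
      \<open>d\<close>. The parallelogram identity then forces near-minimisers to be close to each
      other.\<close>
    define u where "u = hscale H (1/2) (hadd H (s m) (s n))"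
    have u: "u \<in> W" unfolding u_def using W s by auto
    have "(hdist H (s m) (s n))\<^sup>2 = 2 * f (s m) + 2 * f (s n) - 4 * f u"
      unfolding f_def u_def using sH x
      by (simp add: hdist_eq hnorm_sq algebra_simps Re_inner_sym[of "s m" "s n"]
        Re_inner_sym[of x "s m"] Re_inner_sym[of x "s n"])
    then show ?thesis using d_le[OF u] s(2)[of m] s(2)[of n] by linarith
  qed
  have "\<exists>N. \<forall>m\<ge>N. \<forall>n\<ge>N. hdist H (s m) (s n) < e" if "e > 0" for e
  proof -
    have "0 < e\<^sup>2 / 4" using that by simp
    then obtain N where N: "inverse (real (Suc N)) < e\<^sup>2 / 4" using reals_Archimedean by blast
    have "hdist H (s m) (s n) < e" if "m \<ge> N" "n \<ge> N" for m n
    proof -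
      have "inverse (real (Suc m)) \<le> inverse (real (Suc N))"
        "inverse (real (Suc n)) \<le> inverse (real (Suc N))" using that by (auto simp: field_simps)
      then have "(hdist H (s m) (s n))\<^sup>2 < e\<^sup>2" using cau[of m n] N by linarith
      then show ?thesis by (rule power2_less_imp_less) (use \<open>e > 0\<close> in simp)
    qed
    then show ?thesis by blast
  qed
  then obtain l where l: "l \<in> hcarrier H" "(\<lambda>n. hdist H (s n) l) \<longlonglongrightarrow> 0"
    using cauchy_limit[of s] sH by blast
  show thesis
  proof
    show "l \<in> hcarrier H" by fact
    show "hinner H l u = 0" if "u \<in> hcarrier H" "\<And>w. w \<in> W \<Longrightarrow> hinner H w u = 0" for u
    proof -
      have "(\<lambda>n. hinner H (s n) u) \<longlonglongrightarrow> hinner H l u"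
        using sH l that by (intro inner_limitL) auto
      moreover have "hinner H (s n) u = 0" for n using that(2) s(1) .
      ultimately show ?thesis by (simp add: LIMSEQ_const_iff)
    qed
    show "hinner H (hsub H x l) w = 0" if w: "w \<in> W" for w
    proof (cases "hnorm H w = 0")
      case True
      then show ?thesis using w W(1) x l hnorm_eq_0 by (metis add_in inner_zeroR scale_in subsetD)
    next
      case False
      have wH: "w \<in> hcarrier H" using w W by auto
      define c where "c = (hnorm H w)\<^sup>2"
      have c: "c > 0" using False by (simp add: c_def)
      have bound: "(cmod (hinner H (hsub H x (s n)) w))\<^sup>2 \<le> inverse (real (Suc n)) * c" for n
      proof -
        define g where "g = hinner H (hsub H x (s n)) w"
        \<comment> \<open>Moving from \<open>s n\<close> by \<open>a w\<close> is the best
          correction in the direction of \<open>w\<close> and lowers \<open>f\<close> by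
          \<open>|g|^2 / c\<close>. As \<open>s n\<close> is within \<open>1 / (n + 1)\<close> of
          the infimum, the gain cannot exceed that amount.\<close>
        define a where "a = g / complex_of_real c"
        have 1: "hadd H (s n) (hscale H a w) \<in> W" using w W s by auto
        have "hsub H x (hadd H (s n) (hscale H a w)) = hadd H (hsub H x (s n)) (hscale H (-a) w)"
          using x wH sH by (intro inner_ext) (auto simp: algebra_simps)
        then have "f (hadd H (s n) (hscale H a w)) = f (s n) + 2 * Re (- cnj a * g) + (cmod a)\<^sup>2 * c"
          unfolding f_def using x wH sH
          by (simp add: hdist_eq hnorm_add_sq[of "hsub H x (s n)" "hscale H (-a) w"] c_def
              power_mult_distrib flip: g_def)
        also have "- cnj a * g = - complex_of_real ((cmod g)\<^sup>2 / c)"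
          using complex_norm_square[of g] by (simp add: a_def mult.commute)
        also have "(cmod a)\<^sup>2 * c = (cmod g)\<^sup>2 / c"
          using c by (simp add: a_def norm_divide power_divide power2_eq_square)
        finally have "f (hadd H (s n) (hscale H a w)) = f (s n) - (cmod g)\<^sup>2 / c" by simp
        then have "(cmod g)\<^sup>2 / c \<le> inverse (real (Suc n))"
          using d_le[OF 1] s(2)[of n] by linarith
        then show ?thesis using c by (simp add: g_def pos_divide_le_eq)
      qed
      have lim: "(\<lambda>n. hinner H (hsub H x (s n)) w) \<longlonglongrightarrow> hinner H (hsub H x l) w"
        using inner_limitL[OF sH l(1) wH l(2)] sH l x wH by (auto intro!: tendsto_intros)
      have "(\<lambda>n. (cmod (hinner H (hsub H x (s n)) w))\<^sup>2) \<longlonglongrightarrow> (cmod (hinner H (hsub H x l) w))\<^sup>2"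
        by (intro tendsto_intros lim)
      moreover have "(\<lambda>n. inverse (real (Suc n)) * c) \<longlonglongrightarrow> 0"
        using tendsto_mult_left_zero[OF LIMSEQ_inverse_real_of_nat] .
      ultimately have "(cmod (hinner H (hsub H x l) w))\<^sup>2 \<le> 0"
        using bound by (intro LIMSEQ_le) auto
      then show ?thesis by simp
    qed
  qed
qed

end

section \<open>Operators\<close>

definition op_one :: "'h hilb \<Rightarrow> 'h \<Rightarrow> 'h" where
  "op_one H = (\<lambda>x\<in>hcarrier H. x)"

definition op_zero :: "'h hilb \<Rightarrow> 'h \<Rightarrow> 'h" where
  "op_zero H = (\<lambda>x\<in>hcarrier H. hzero H)"

lemma op_apply [simp]:
  assumes "x \<in> hcarrier H"
  shows "op_mult H S T x = S (T x)" "op_add H S T x = hadd H (S x) (T x)"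
    "op_scale H a T x = hscale H a (T x)" "op_one H x = x" "op_zero H x = hzero H"
  using assms by (auto simp: op_mult_def op_add_def op_scale_def op_one_def op_zero_def compose_def)

lemma op_extensional:
  "op_mult H S T \<in> extensional (hcarrier H)" "op_add H S T \<in> extensional (hcarrier H)"
  "op_scale H a T \<in> extensional (hcarrier H)" "op_one H \<in> extensional (hcarrier H)"
  "op_zero H \<in> extensional (hcarrier H)"
  by (auto simp: op_mult_def op_add_def op_scale_def op_one_def op_zero_def)

lemma bop_in: "\<lbrakk>T \<in> bounded_op H; x \<in> hcarrier H\<rbrakk> \<Longrightarrow> T x \<in> hcarrier H"
  by (auto simp: bounded_op_def)

lemma bop_ext:
  "\<lbrakk>S \<in> bounded_op H; T \<in> bounded_op H; \<And>x. x \<in> hcarrier H \<Longrightarrow> S x = T x\<rbrakk> \<Longrightarrow> S = T"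
  unfolding bounded_op_def by (auto intro: PiE_ext)

lemma bop_extensional: "T \<in> bounded_op H \<Longrightarrow> T \<in> extensional (hcarrier H)"
  by (auto simp: bounded_op_def PiE_def)

lemma bop_add: "\<lbrakk>T \<in> bounded_op H; x \<in> hcarrier H; y \<in> hcarrier H\<rbrakk> \<Longrightarrow>
    T (hadd H x y) = hadd H (T x) (T y)"
  by (auto simp: bounded_op_def)

lemma bop_scale: "\<lbrakk>T \<in> bounded_op H; x \<in> hcarrier H\<rbrakk> \<Longrightarrow> T (hscale H a x) = hscale H a (T x)"
  by (auto simp: bounded_op_def)

lemma bopI:
  assumes "\<And>x. x \<in> hcarrier H \<Longrightarrow> T x \<in> hcarrier H" "T \<in> extensional (hcarrier H)"
    "\<And>x y. \<lbrakk>x \<in> hcarrier H; y \<in> hcarrier H\<rbrakk> \<Longrightarrow> T (hadd H x y) = hadd H (T x) (T y)"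
    "\<And>a x. x \<in> hcarrier H \<Longrightarrow> T (hscale H a x) = hscale H a (T x)"
    "\<And>x. x \<in> hcarrier H \<Longrightarrow> hnorm H (T x) \<le> B * hnorm H x"
  shows "T \<in> bounded_op H"
  unfolding bounded_op_def PiE_def using assms by blast

lemma adjoint_inner:
  "\<lbrakk>is_adjoint H T S; x \<in> hcarrier H; y \<in> hcarrier H\<rbrakk> \<Longrightarrow> hinner H (T x) y = hinner H x (S y)"
  by (auto simp: is_adjoint_def)

lemma adjoint_bop: "is_adjoint H T S \<Longrightarrow> T \<in> bounded_op H" "is_adjoint H T S \<Longrightarrow> S \<in> bounded_op H"
  by (auto simp: is_adjoint_def)

context pre_hilbert
begin

lemma bop_zero: "T \<in> bounded_op H \<Longrightarrow> T (hzero H) = hzero H"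
  using bop_scale[of T H "hzero H" 0] bop_in[of T H "hzero H"] by (simp add: scale_0 scale_zero)

lemma bop_bound:
  assumes "T \<in> bounded_op H"
  obtains B where "B > 0" "\<And>x. x \<in> hcarrier H \<Longrightarrow> hnorm H (T x) \<le> B * hnorm H x"
proof -
  obtain B where B: "\<forall>x\<in>hcarrier H. hnorm H (T x) \<le> B * hnorm H x"
    using assms by (auto simp: bounded_op_def)
  have "hnorm H (T x) \<le> (\<bar>B\<bar> + 1) * hnorm H x" if "x \<in> hcarrier H" for x
  proof -
    have "B * hnorm H x \<le> (\<bar>B\<bar> + 1) * hnorm H x" using that by (intro mult_right_mono) auto
    then show ?thesis using B that by fastforce
  qed
  then show ?thesis using that[of "\<bar>B\<bar> + 1"] by simp
qed

lemma hdist_bop: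
  assumes "T \<in> bounded_op H" "\<And>x. x \<in> hcarrier H \<Longrightarrow> hnorm H (T x) \<le> B * hnorm H x"
    "x \<in> hcarrier H" "y \<in> hcarrier H"
  shows "hdist H (T x) (T y) \<le> B * hdist H x y"
  using assms(2)[of "hsub H x y"] assms by (simp add: hdist_eq bop_add bop_scale bop_in)

lemma op_one_bop [simp]: "op_one H \<in> bounded_op H"
  by (rule bopI[where B=1]) (auto simp: op_extensional)

lemma op_zero_bop [simp]: "op_zero H \<in> bounded_op H"
  by (rule bopI[where B=0]) (auto simp: op_extensional add_0 scale_zero)

lemma op_add_bop:
  assumes S: "S \<in> bounded_op H" and T: "T \<in> bounded_op H"
  shows "op_add H S T \<in> bounded_op H"
proof -
  obtain A B where AB: "\<And>x. x \<in> hcarrier H \<Longrightarrow> hnorm H (S x) \<le> A * hnorm H x"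
    "\<And>x. x \<in> hcarrier H \<Longrightarrow> hnorm H (T x) \<le> B * hnorm H x"
    using bop_bound[OF S] bop_bound[OF T] by metis
  show ?thesis
  proof (rule bopI[where B="A+B"])
    fix x y a assume x: "x \<in> hcarrier H"
    show "hnorm H (op_add H S T x) \<le> (A + B) * hnorm H x"
      using hnorm_triangle[of "S x" "T x"] AB[OF x] S T x
      by (simp add: bop_in algebra_simps)
    show "op_add H S T (hscale H a x) = hscale H a (op_add H S T x)"
      using S T x by (simp add: bop_in bop_scale scale_distrib)
    assume y: "y \<in> hcarrier H"
    show "op_add H S T (hadd H x y) = hadd H (op_add H S T x) (op_add H S T y)"
      using S T x y by (intro inner_ext) (auto simp: bop_in bop_add)
  qed (use S T in \<open>auto simp: bop_in op_extensional\<close>)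
qed

lemma op_scale_bop:
  assumes S: "S \<in> bounded_op H"
  shows "op_scale H a S \<in> bounded_op H"
proof -
  obtain A where A: "\<And>x. x \<in> hcarrier H \<Longrightarrow> hnorm H (S x) \<le> A * hnorm H x"
    using bop_bound[OF S] by metis
  show ?thesis
  proof (rule bopI[where B="cmod a * A"])
    fix x y b assume x: "x \<in> hcarrier H"
    show "hnorm H (op_scale H a S x) \<le> (cmod a * A) * hnorm H x"
      using A[OF x] S x by (simp add: bop_in mult_left_mono mult.assoc)
    show "op_scale H a S (hscale H b x) = hscale H b (op_scale H a S x)"
      using S x by (simp add: bop_in bop_scale scale_mult mult.commute)
    assume y: "y \<in> hcarrier H"
    show "op_scale H a S (hadd H x y) = hadd H (op_scale H a S x) (op_scale H a S y)"
      using S x y by (simp add: bop_in bop_add scale_distrib)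
  qed (use S in \<open>auto simp: bop_in op_extensional\<close>)
qed

lemma op_mult_bop:
  assumes S: "S \<in> bounded_op H" and T: "T \<in> bounded_op H"
  shows "op_mult H S T \<in> bounded_op H"
proof -
  obtain A B where AB: "A > 0" "\<And>x. x \<in> hcarrier H \<Longrightarrow> hnorm H (S x) \<le> A * hnorm H x"
    "\<And>x. x \<in> hcarrier H \<Longrightarrow> hnorm H (T x) \<le> B * hnorm H x"
    using bop_bound[OF S] bop_bound[OF T] by metis
  show ?thesis
  proof (rule bopI[where B="A*B"])
    fix x y a assume x: "x \<in> hcarrier H"
    have "hnorm H (S (T x)) \<le> A * hnorm H (T x)" by (rule AB(2)[OF bop_in[OF T x]])
    also have "\<dots> \<le> A * (B * hnorm H x)" using AB x by (intro mult_left_mono) auto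
    finally show "hnorm H (op_mult H S T x) \<le> (A * B) * hnorm H x"
      using x by (simp add: mult.assoc)
  qed (use S T in \<open>auto simp: bop_in bop_add bop_scale op_extensional\<close>)
qed

lemma adjoint_sym: "is_adjoint H T S \<Longrightarrow> is_adjoint H S T"
  unfolding is_adjoint_def by (metis bop_in inner_cnj)

lemma adjoint_unique:
  assumes "is_adjoint H T S" "is_adjoint H T S'"
  shows "S = S'"
proof (rule bop_ext)
  fix x assume x: "x \<in> hcarrier H"
  show "S x = S' x"
    using assms x by (intro inner_ext) (metis adjoint_bop(2) adjoint_inner adjoint_sym bop_in)+
qed (use assms in \<open>auto dest: adjoint_bop\<close>)

text \<open>From \<open>|S x|^2 = <T (S x), x> \<le> B |S x| |x|\<close> one cancels
  \<open>|S x|\<close>; if that is zero, the right-hand side is nonnegative because it bounds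
  \<open>|T x|\<close>. The constant is literally the same for \<open>S\<close>, which keeps
  families of adjoints uniformly bounded.\<close>

lemma adjoint_bound:
  assumes adj: "is_adjoint H T S" and B: "\<And>x. x \<in> hcarrier H \<Longrightarrow> hnorm H (T x) \<le> B * hnorm H x"
    and x: "x \<in> hcarrier H"
  shows "hnorm H (S x) \<le> B * hnorm H x"
proof (cases "hnorm H (S x) = 0")
  case True
  then show ?thesis using B[OF x] hnorm_nonneg x adj by (metis adjoint_bop(1) bop_in order_trans)
next
  case False
  have Sx: "S x \<in> hcarrier H" by (rule bop_in[OF adjoint_bop(2)[OF adj] x])
  have TSx: "T (S x) \<in> hcarrier H" by (rule bop_in[OF adjoint_bop(1)[OF adj] Sx])
  have "complex_of_real ((hnorm H (S x))\<^sup>2) = hinner H (T (S x)) x"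
    using adjoint_inner[OF adj Sx x] inner_self[OF Sx] by simp
  then have "(hnorm H (S x))\<^sup>2 \<le> hnorm H (T (S x)) * hnorm H x"
    using cauchy_schwarz[OF TSx x] by (metis norm_of_real abs_of_nonneg zero_le_power2)
  also have "\<dots> \<le> (B * hnorm H (S x)) * hnorm H x"
    using B[OF Sx] x by (simp add: mult_right_mono)
  finally show ?thesis using False Sx hnorm_nonneg[OF Sx] by (simp add: power2_eq_square)
qed

lemma op_one_adjoint: "is_adjoint H (op_one H) (op_one H)"
  by (simp add: is_adjoint_def)

lemma op_zero_adjoint: "is_adjoint H (op_zero H) (op_zero H)"
  by (simp add: is_adjoint_def)

section \<open>Commutants\<close>

lemma commutant_iff:
  assumes "M \<subseteq> bounded_op H"
  shows "S \<in> commutant H M \<longleftrightarrow> S \<in> bounded_op H \<and> (\<forall>T\<in>M. \<forall>x\<in>hcarrier H. S (T x) = T (S x))"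
proof -
  have "op_mult H S T = op_mult H T S \<longleftrightarrow> (\<forall>x\<in>hcarrier H. S (T x) = T (S x))" for S T
  proof
    assume eq: "op_mult H S T = op_mult H T S"
    show "\<forall>x\<in>hcarrier H. S (T x) = T (S x)" using fun_cong[OF eq] by (metis op_apply(1))
  next
    assume "\<forall>x\<in>hcarrier H. S (T x) = T (S x)"
    then show "op_mult H S T = op_mult H T S"
      by (intro extensionalityI[OF op_extensional(1) op_extensional(1)]) simp
  qed
  then show ?thesis by (auto simp: commutant_def)
qed

lemma commutant_bop: "commutant H M \<subseteq> bounded_op H"
  by (auto simp: commutant_def)

lemma commutant_closed:
  assumes M: "M \<subseteq> bounded_op H"
  shows "op_one H \<in> commutant H M" "op_zero H \<in> commutant H M"
    "\<lbrakk>S \<in> commutant H M; T \<in> commutant H M\<rbrakk> \<Longrightarrow> op_add H S T \<in> commutant H M"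
    "S \<in> commutant H M \<Longrightarrow> op_scale H a S \<in> commutant H M"
    "\<lbrakk>S \<in> commutant H M; T \<in> commutant H M\<rbrakk> \<Longrightarrow> op_mult H S T \<in> commutant H M"
  using M unfolding commutant_iff[OF M]
  by (simp_all add: subset_iff bop_in bop_zero op_add_bop op_scale_bop op_mult_bop bop_add bop_scale)

end

text \<open>In a complete space, compact closure means total boundedness. The centres of the nets
  may be any vectors here, whereas \<open>mtotally_bounded\<close> asks for centres in the image
  itself; the free form is the one that is easy to push through projections and sums.\<close>

lemma (in hilbert_space) compact_op_iff:
  "compact_op H T \<longleftrightarrow> T \<in> bounded_op H \<and> (\<forall>e>0. \<exists>F. finite F \<and> F \<subseteq> hcarrier H \<and>
    (\<forall>x\<in>hcarrier H. hnorm H x \<le> 1 \<longrightarrow> (\<exists>y\<in>F. hdist H (T x) y < e)))" (is "_ \<longleftrightarrow> _ \<and> ?tb")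
proof (cases "T \<in> bounded_op H")
  case True
  define B where "B = {x \<in> hcarrier H. hnorm H x \<le> 1}"
  have sub: "T ` B \<subseteq> hcarrier H" using True bop_in by (auto simp: B_def)
  have "compact_op H T \<longleftrightarrow> mtotally_bounded (T ` B)"
    using True sub mtotally_bounded_eq_compact_closure_of[OF complete, of "T ` B"]
    by (simp add: compact_op_def B_def)
  also have "\<dots> \<longleftrightarrow> ?tb"
  proof
    assume tb: "mtotally_bounded (T ` B)"
    show ?tb
    proof (intro allI impI)
      fix e :: real assume "e > 0"
      then obtain F where F: "finite F" "F \<subseteq> T ` B" "T ` B \<subseteq> (\<Union>x\<in>F. mball x e)"
        using tb unfolding mtotally_bounded_def by meson
      have "\<exists>y\<in>F. hdist H (T x) y < e" if "x \<in> hcarrier H" "hnorm H x \<le> 1" for x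
      proof -
        have "T x \<in> T ` B" using that by (simp add: B_def)
        then have "T x \<in> (\<Union>x\<in>F. mball x e)" using F(3) by (rule subsetD[rotated])
        then show ?thesis by (auto simp: hdist_commute)
      qed
      then show "\<exists>F. finite F \<and> F \<subseteq> hcarrier H \<and>
          (\<forall>x\<in>hcarrier H. hnorm H x \<le> 1 \<longrightarrow> (\<exists>y\<in>F. hdist H (T x) y < e))"
        using F sub by (meson subset_trans)
    qed
  next
    assume tb: ?tb
    show "mtotally_bounded (T ` B)"
      unfolding mtotally_bounded_def
    proof (intro allI impI)
      fix e :: real assume "e > 0"
      then obtain F where F: "finite F" "F \<subseteq> hcarrier H"
        "\<And>x. x \<in> B \<Longrightarrow> \<exists>y\<in>F. hdist H (T x) y < e/2"
        using tb half_gt_zero unfolding B_def by (metis (mono_tags, lifting) mem_Collect_eq)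
      \<comment> \<open>Each centre \<open>y\<close> that is within \<open>e/2\<close> of the image
        is replaced by such a point \<open>c y\<close> of the image. Points near \<open>y\<close>
        are then within \<open>e\<close> of \<open>c y\<close>, and the remaining centres are
        dropped.\<close>
      define c where "c = (\<lambda>y. SOME z. z \<in> T ` B \<and> hdist H z y < e/2)"
      define F' where "F' = c ` {y \<in> F. \<exists>z\<in>T ` B. hdist H z y < e/2}"
      have c: "c y \<in> T ` B \<and> hdist H (c y) y < e/2" if "z \<in> T ` B" "hdist H z y < e/2" for z y
        unfolding c_def by (rule someI[of _ z]) (use that in auto)
      have "finite F'" by (simp add: F'_def F(1))
      moreover have "F' \<subseteq> T ` B"
      proof
        fix u assume "u \<in> F'"
        then obtain y z where "u = c y" "z \<in> T ` B" "hdist H z y < e/2" by (auto simp: F'_def)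
        then show "u \<in> T ` B" using c[of z y] by simp
      qed
      moreover have "T ` B \<subseteq> (\<Union>x\<in>F'. mball x e)"
      proof
        fix z assume z: "z \<in> T ` B"
        then obtain y where y: "y \<in> F" "hdist H z y < e/2" using F(3) by auto
        note cy = c[OF z y(2)]
        have "hdist H (c y) z \<le> hdist H (c y) y + hdist H z y"
          using cy y z F(2) sub by (intro triangle') auto
        then have "z \<in> mball (c y) e" using cy y z sub by auto
        then show "z \<in> (\<Union>x\<in>F'. mball x e)" unfolding F'_def using y z by blast
      qed
      ultimately show "\<exists>K. finite K \<and> K \<subseteq> T ` B \<and> T ` B \<subseteq> (\<Union>x\<in>K. mball x e)" by blast
    qed
  qed
  finally show ?thesis using True by simp
qed (simp add: compact_op_def)

section \<open>Von Neumann algebras and standard forms\<close>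

locale vn_algebra = hilbert_space H for H :: "'h hilb" +
  fixes M :: "('h \<Rightarrow> 'h) set"
  assumes vn: "von_neumann_algebra H M"
begin

lemma M_bop: "M \<subseteq> bounded_op H"
  using vn by (simp only: von_neumann_algebra_def)

lemma adjoint_ex: "T \<in> M \<Longrightarrow> \<exists>S\<in>M. is_adjoint H T S"
  using vn by (simp only: von_neumann_algebra_def)

lemma bicommutant: "commutant H (commutant H M) = M"
  using vn by (simp only: von_neumann_algebra_def)

lemma M_in: "\<lbrakk>T \<in> M; x \<in> hcarrier H\<rbrakk> \<Longrightarrow> T x \<in> hcarrier H"
  by (rule bop_in[OF subsetD[OF M_bop]])

text \<open>\<open>M\<close> is itself a commutant, namely that of \<open>commutant H M\<close>, and
  every commutant is a unital algebra.\<close>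

lemma M_closed:
  "op_one H \<in> M" "op_zero H \<in> M"
  "\<lbrakk>S \<in> M; T \<in> M\<rbrakk> \<Longrightarrow> op_add H S T \<in> M" "S \<in> M \<Longrightarrow> op_scale H a S \<in> M"
  "\<lbrakk>S \<in> M; T \<in> M\<rbrakk> \<Longrightarrow> op_mult H S T \<in> M"
  using commutant_closed[OF commutant_bop[of M]] unfolding bicommutant by auto

lemma M_memI:
  "\<lbrakk>T \<in> bounded_op H; \<And>S x. \<lbrakk>S \<in> commutant H M; x \<in> hcarrier H\<rbrakk> \<Longrightarrow> T (S x) = S (T x)\<rbrakk> \<Longrightarrow> T \<in> M"
  using commutant_iff[OF commutant_bop, of T M] bicommutant by auto

lemma commutantD: "\<lbrakk>S \<in> commutant H M; T \<in> M; x \<in> hcarrier H\<rbrakk> \<Longrightarrow> S (T x) = T (S x)"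
  using commutant_iff[OF M_bop] by blast

lemma commutantI:
  "\<lbrakk>S \<in> bounded_op H; \<And>T x. \<lbrakk>T \<in> M; x \<in> hcarrier H\<rbrakk> \<Longrightarrow> S (T x) = T (S x)\<rbrakk> \<Longrightarrow> S \<in> commutant H M"
  using commutant_iff[OF M_bop] by blast

end

lemma vn_algebraI: "von_neumann_algebra H M \<Longrightarrow> vn_algebra H M"
  by (simp add: vn_algebra_def vn_algebra_axioms_def von_neumann_algebra_def)

locale std_form = vn_algebra H M for H :: "'h hilb" and M +
  fixes J :: "'h \<Rightarrow> 'h" and P :: "'h set"
  assumes std: "standard_form H M J P"
begin

lemma J_in [simp]: "x \<in> hcarrier H \<Longrightarrow> J x \<in> hcarrier H"
  and J_add: "\<lbrakk>x \<in> hcarrier H; y \<in> hcarrier H\<rbrakk> \<Longrightarrow> J (hadd H x y) = hadd H (J x) (J y)"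
  and J_scale: "x \<in> hcarrier H \<Longrightarrow> J (hscale H a x) = hscale H (cnj a) (J x)"
  and J_norm: "x \<in> hcarrier H \<Longrightarrow> hnorm H (J x) = hnorm H x"
  and J_J [simp]: "x \<in> hcarrier H \<Longrightarrow> J (J x) = x"
  using std by (auto simp: standard_form_def conj_linear_involution_def PiE_def)

lemma J_P: "\<xi> \<in> P \<Longrightarrow> J \<xi> = \<xi>"
  and xJxJ_P: "\<lbrakk>x \<in> M; \<xi> \<in> P\<rbrakk> \<Longrightarrow> x (J (x (J \<xi>))) \<in> P"
  and J_image: "J_conj H J ` M = commutant H M"
  and J_central: "\<lbrakk>c \<in> M; c \<in> commutant H M\<rbrakk> \<Longrightarrow> is_adjoint H c (J_conj H J c)"
  and P_cone: "self_dual_cone H P"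
  using std by (auto simp: standard_form_def)

lemma P_sub: "P \<subseteq> hcarrier H" and P_iff: "\<xi> \<in> P \<longleftrightarrow> \<xi> \<in> hcarrier H \<and> (\<forall>\<eta>\<in>P. hinner H \<xi> \<eta> \<in> \<real>\<^sub>\<ge>\<^sub>0)"
  using P_cone by (auto simp: self_dual_cone_def)

lemma hzero_P: "hzero H \<in> P"
  using P_iff[of "hzero H"] P_sub by auto

lemma J_conj_apply: "x \<in> hcarrier H \<Longrightarrow> J_conj H J T x = J (T (J x))"
  by (simp add: J_conj_def)

text \<open>The equation \<open>JMJ = M'\<close> read backwards: \<open>J\<close> is an involution,
  so conjugation by \<open>J\<close> undoes itself and sends the commutant into
  \<open>M\<close>.\<close>

lemma J_conj_commutant: 
  assumes "S \<in> commutant H M" shows "J_conj H J S \<in> M"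
proof -
  obtain y where y: "y \<in> M" "S = J_conj H J y" using assms J_image by blast
  have "J_conj H J S = y"
  proof (rule extensionalityI)
    show "J_conj H J S \<in> extensional (hcarrier H)" by (simp add: J_conj_def op_extensional)
    show "y \<in> extensional (hcarrier H)" by (rule bop_extensional[OF subsetD[OF M_bop y(1)]])
    show "J_conj H J S x = y x" if "x \<in> hcarrier H" for x
      using that y by (simp add: J_conj_apply M_in)
  qed
  then show ?thesis using y by simp
qed

end

lemma standard_form_vn: "standard_form H M J P \<Longrightarrow> von_neumann_algebra H M"
  by (simp only: standard_form_def)

lemma std_formI: "standard_form H M J P \<Longrightarrow> std_form H M J P"
  by (intro std_form.intro[OF vn_algebraI std_form_axioms.intro] standard_form_vn)

section \<open>The approximation property without filters\<close>

definition approximable ::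
    "'h hilb \<Rightarrow> ('h \<Rightarrow> 'h) set \<Rightarrow> ('h \<Rightarrow> 'h) \<Rightarrow> 'h set \<Rightarrow> bool" where
  "approximable H M J P \<longleftrightarrow> (\<forall>S e. finite S \<and> S \<subseteq> hcarrier H \<and> 0 < e \<longrightarrow>
     (\<exists>T. ccp H M J P T \<and> compact_op H T \<and> (\<forall>\<xi>\<in>S. hdist H (T \<xi>) \<xi> < e)))"

text \<open>The sets of admissible \<open>T\<close> that move each vector of a finite set
  \<open>S\<close> by less than \<open>e\<close> are directed under enlarging \<open>S\<close> and
  shrinking \<open>e\<close>; they generate the filter, which is proper because none of them is
  empty. Conversely, finitely many eventual conditions hold together eventually, and a condition
  that holds eventually in a proper filter is satisfied by some \<open>T\<close>.\<close>

lemma (in hilbert_space) approximable_iff_filter: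
  "approximable H M J P \<longleftrightarrow> (\<exists>\<F>. \<F> \<noteq> bot \<and>
     (\<forall>\<^sub>F T in \<F>. ccp H M J P T \<and> compact_op H T) \<and>
     (\<forall>\<xi>\<in>hcarrier H. limitin (htopology H) (\<lambda>T. T \<xi>) \<xi> \<F>))" (is "_ \<longleftrightarrow> ?R")
proof
  assume ap: "approximable H M J P"
  define A where "A = {(S, e). finite S \<and> S \<subseteq> hcarrier H \<and> 0 < (e::real)}"
  define G where "G = (\<lambda>(S, e). {T. ccp H M J P T \<and> compact_op H T \<and> (\<forall>\<xi>\<in>S. hdist H (T \<xi>) \<xi> < e)})"
  define \<F> where "\<F> = (INF p\<in>A. principal (G p))"
  have base: "eventually Q \<F> \<longleftrightarrow> (\<exists>p\<in>A. eventually Q (principal (G p)))" for Q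
    unfolding \<F>_def
  proof (rule eventually_INF_base)
    have "({}, 1) \<in> A" by (simp add: A_def)
    then show "A \<noteq> {}" by blast
    fix p q assume "p \<in> A" "q \<in> A"
    then obtain S e S' e' where pq: "p = (S, e)" "q = (S', e')" "(S, e) \<in> A" "(S', e') \<in> A"
      by (metis surj_pair)
    then show "\<exists>r\<in>A. principal (G r) \<le> inf (principal (G p)) (principal (G q))"
      by (intro bexI[of _ "(S \<union> S', min e e')"]) (auto simp: A_def G_def)
  qed
  have ne: "G p \<noteq> {}" if "p \<in> A" for p
    using that ap unfolding approximable_def A_def G_def by (auto 0 3)
  have "\<F> \<noteq> bot"
    using base[of "\<lambda>_. False"] ne by (auto simp: eventually_principal trivial_limit_def)
  moreover have "\<forall>\<^sub>F T in \<F>. ccp H M J P T \<and> compact_op H T"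
    unfolding base eventually_principal
    by (rule bexI[of _ "({}, 1)"]) (auto simp: A_def G_def)
  moreover have "limitin (htopology H) (\<lambda>T. T \<xi>) \<xi> \<F>" if \<xi>: "\<xi> \<in> hcarrier H" for \<xi>
    unfolding limitin_metric base eventually_principal
  proof (intro conjI allI impI \<xi>)
    fix e :: real assume "e > 0"
    then show "\<exists>p\<in>A. \<forall>T\<in>G p. T \<xi> \<in> hcarrier H \<and> hdist H (T \<xi>) \<xi> < e"
      using \<xi> by (intro bexI[of _ "({\<xi>}, e)"]) (auto simp: A_def G_def compact_op_def bop_in)
  qed
  ultimately show ?R by blast
next
  assume ?R
  then obtain \<F> where \<F>: "\<F> \<noteq> bot" "\<forall>\<^sub>F T in \<F>. ccp H M J P T \<and> compact_op H T"
    "\<And>\<xi>. \<xi> \<in> hcarrier H \<Longrightarrow> limitin (htopology H) (\<lambda>T. T \<xi>) \<xi> \<F>" by blast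
  show "approximable H M J P"
    unfolding approximable_def
  proof (intro allI impI)
    fix S and e :: real assume S: "finite S \<and> S \<subseteq> hcarrier H \<and> 0 < e"
    have "\<forall>\<xi>\<in>S. \<forall>\<^sub>F T in \<F>. hdist H (T \<xi>) \<xi> < e"
    proof
      fix \<xi> assume "\<xi> \<in> S"
      then have "limitin (htopology H) (\<lambda>T. T \<xi>) \<xi> \<F>" using S \<F>(3) by blast
      then have "\<forall>\<^sub>F T in \<F>. T \<xi> \<in> hcarrier H \<and> hdist H (T \<xi>) \<xi> < e"
        using S unfolding limitin_metric by blast
      then show "\<forall>\<^sub>F T in \<F>. hdist H (T \<xi>) \<xi> < e" by (rule eventually_mono) simp
    qed
    then have "\<forall>\<^sub>F T in \<F>. \<forall>\<xi>\<in>S. hdist H (T \<xi>) \<xi> < e"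
      using S by (simp add: eventually_ball_finite)
    then have "\<forall>\<^sub>F T in \<F>. (ccp H M J P T \<and> compact_op H T) \<and> (\<forall>\<xi>\<in>S. hdist H (T \<xi>) \<xi> < e)"
      using \<F>(2) by (rule eventually_conj[rotated])
    then show "\<exists>T. ccp H M J P T \<and> compact_op H T \<and> (\<forall>\<xi>\<in>S. hdist H (T \<xi>) \<xi> < e)"
      using eventually_happens'[OF \<F>(1)] by blast
  qed
qed

lemma haagerup_iff_approximable:
  fixes H :: "'h hilb"
  shows "haagerup_approximation_property H M \<longleftrightarrow> (\<exists>(K :: 'h sf_univ hilb) N J P \<phi>.
     standard_form K N J P \<and> star_isomorphism H M K N \<phi> \<and> approximable K N J P)"
proof -
  have "hilbert_space K" if "standard_form K N J P" for K :: "'h sf_univ hilb" and N J P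
    using that by (simp add: standard_form_def von_neumann_algebra_def)
  then show ?thesis
    unfolding haagerup_approximation_property_def
    by (intro ex_cong1 conj_cong refl) (simp add: hilbert_space.approximable_iff_filter)
qed

section \<open>Cutting down a standard form by a central projection\<close>

text \<open>The projection onto the closure of \<open>M \<xi>\<close>.\<close>

lemma (in vn_algebra) cyclic_projection:
  assumes \<xi>: "\<xi> \<in> hcarrier H"
  obtains p where "p \<in> commutant H M" "p \<xi> = \<xi>"
    "\<And>\<eta>. \<lbrakk>\<eta> \<in> hcarrier H; \<And>x. x \<in> M \<Longrightarrow> hinner H (x \<xi>) \<eta> = 0\<rbrakk> \<Longrightarrow> p \<eta> = hzero H"
proof -
  define perp where "perp = (\<lambda>u. \<forall>x\<in>M. hinner H (x \<xi>) u = 0)"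
  \<comment> \<open>\<open>rel \<eta> l\<close> says that \<open>l\<close> is the orthogonal
    projection of \<open>\<eta>\<close> onto the closure of \<open>M \<xi>\<close>, membership in
    the closure being expressed as orthogonality to all of \<open>perp\<close>.\<close>
  define rel where "rel = (\<lambda>\<eta> l. l \<in> hcarrier H \<and> perp (hsub H \<eta> l) \<and>
    (\<forall>u\<in>hcarrier H. perp u \<longrightarrow> hinner H l u = 0))"
  note MI = M_in[OF _ \<xi>]
  have ex: "\<exists>l. rel \<eta> l" if \<eta>: "\<eta> \<in> hcarrier H" for \<eta>
  proof -
    define W where "W = (\<lambda>x. x \<xi>) ` M"
    have W: "W \<subseteq> hcarrier H" using MI by (auto simp: W_def)
    have W0: "hzero H \<in> W"
      unfolding W_def using M_closed(2) \<xi> by (metis imageI op_apply(5))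
    have W1: "hadd H u v \<in> W" if "u \<in> W" "v \<in> W" for u v
    proof -
      obtain x y where "u = x \<xi>" "v = y \<xi>" "x \<in> M" "y \<in> M" using \<open>u \<in> W\<close> \<open>v \<in> W\<close> by (auto simp: W_def)
      then show ?thesis unfolding W_def using M_closed(3)[of x y] \<xi>
        by (intro image_eqI[of _ _ "op_add H x y"]) auto
    qed
    have W2: "hscale H a u \<in> W" if "u \<in> W" for a u
    proof -
      obtain x where "u = x \<xi>" "x \<in> M" using \<open>u \<in> W\<close> by (auto simp: W_def)
      then show ?thesis unfolding W_def using M_closed(4)[of x a] \<xi>
        by (intro image_eqI[of _ _ "op_scale H a x"]) auto
    qed
    obtain l where l: "l \<in> hcarrier H" "\<And>w. w \<in> W \<Longrightarrow> hinner H (hsub H \<eta> l) w = 0"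
      "\<And>u. \<lbrakk>u \<in> hcarrier H; \<And>w. w \<in> W \<Longrightarrow> hinner H w u = 0\<rbrakk> \<Longrightarrow> hinner H l u = 0"
      using projection_exists[OF W W0 W1 W2 \<eta>] by blast
    have "perp (hsub H \<eta> l)"
      unfolding perp_def
    proof
      fix x assume x: "x \<in> M"
      have "hinner H (hsub H \<eta> l) (x \<xi>) = 0" using l(2) x by (simp add: W_def)
      then show "hinner H (x \<xi>) (hsub H \<eta> l) = 0"
        using inner_cnj[of "x \<xi>" "hsub H \<eta> l"] MI[OF x] l(1) \<eta> by simp
    qed
    moreover have "hinner H l u = 0" if "u \<in> hcarrier H" "perp u" for u
      using l(3)[OF that(1)] that(2) by (auto simp: W_def perp_def)
    ultimately show ?thesis using l(1) unfolding rel_def by blast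
  qed
  have uniq: "l = l'" if \<eta>: "\<eta> \<in> hcarrier H" and l: "rel \<eta> l" and l': "rel \<eta> l'" for \<eta> l l'
  proof -
    have lH: "l \<in> hcarrier H" "l' \<in> hcarrier H" using l l' by (auto simp: rel_def)
    \<comment> \<open>The difference of two candidates lies in \<open>perp\<close>, while each
      candidate is orthogonal to \<open>perp\<close>; hence the difference is orthogonal to
      itself.\<close>
    have "perp (hsub H l l')"
      unfolding perp_def
    proof
      fix x assume x: "x \<in> M"
      have "hinner H (x \<xi>) (hsub H \<eta> l) = 0" "hinner H (x \<xi>) (hsub H \<eta> l') = 0"
        using l l' x by (auto simp: rel_def perp_def)
      then show "hinner H (x \<xi>) (hsub H l l') = 0" using lH \<eta> MI[OF x] by simp
    qed
    then have "hinner H l (hsub H l l') = 0" "hinner H l' (hsub H l l') = 0"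
      using l l' lH unfolding rel_def by (meson add_in scale_in)+
    then have "hinner H (hsub H l l') (hsub H l l') = 0" using lH by simp
    then have "hdist H l l' = 0"
      using inner_self_0[of "hsub H l l'"] lH by (simp add: hdist_eq)
    then show ?thesis using lH zero by blast
  qed
  define p where "p = (\<lambda>\<eta>\<in>hcarrier H. SOME l. rel \<eta> l)"
  have p: "rel \<eta> (p \<eta>)" if "\<eta> \<in> hcarrier H" for \<eta>
    using someI_ex[OF ex[OF that]] that by (simp add: p_def)
  have pI: "p \<eta> = l" if "\<eta> \<in> hcarrier H" "rel \<eta> l" for \<eta> l
    using uniq[OF that(1) p[OF that(1)] that(2)] .
  have pH: "p \<eta> \<in> hcarrier H" if "\<eta> \<in> hcarrier H" for \<eta>
    using p[OF that] by (simp add: rel_def)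
  have bop: "p \<in> bounded_op H"
  proof (rule bopI[where B=1])
    show "p \<in> extensional (hcarrier H)" by (simp add: p_def)
  next
    fix \<eta> a assume \<eta>: "\<eta> \<in> hcarrier H"
    show "p \<eta> \<in> hcarrier H" using pH \<eta> .
    show "p (hscale H a \<eta>) = hscale H a (p \<eta>)"
      using p[OF \<eta>] \<eta> MI by (intro pI) (auto simp: rel_def perp_def algebra_simps)
    have "perp (hsub H \<eta> (p \<eta>))" using p[OF \<eta>] by (simp add: rel_def)
    then have "hinner H (p \<eta>) (hsub H \<eta> (p \<eta>)) = 0"
      using p[OF \<eta>] pH[OF \<eta>] \<eta> unfolding rel_def by (meson add_in scale_in)
    then have "hinner H (p \<eta>) (p \<eta>) = hinner H (p \<eta>) \<eta>" using pH[OF \<eta>] \<eta> by simp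
    then have "(hnorm H (p \<eta>))\<^sup>2 \<le> hnorm H (p \<eta>) * hnorm H \<eta>"
      using cauchy_schwarz[OF pH[OF \<eta>] \<eta>] hnorm_sq[OF pH[OF \<eta>]] complex_Re_le_cmod[of "hinner H (p \<eta>) \<eta>"]
      by simp
    then show "hnorm H (p \<eta>) \<le> 1 * hnorm H \<eta>"
      using hnorm_nonneg[OF pH[OF \<eta>]] hnorm_nonneg[OF \<eta>]
      by (cases "hnorm H (p \<eta>) = 0") (auto simp: power2_eq_square)
    fix \<zeta> assume \<zeta>: "\<zeta> \<in> hcarrier H"
    show "p (hadd H \<eta> \<zeta>) = hadd H (p \<eta>) (p \<zeta>)"
      using p[OF \<eta>] p[OF \<zeta>] \<eta> \<zeta> MI by (intro pI) (auto simp: rel_def perp_def algebra_simps)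
  qed
  show thesis
  proof
    show "p \<in> commutant H M"
    proof (rule commutantI[OF bop])
      fix y \<eta> assume y: "y \<in> M" and \<eta>: "\<eta> \<in> hcarrier H"
      obtain z where z: "z \<in> M" "is_adjoint H y z" using adjoint_ex[OF y] by blast
      have yb: "y \<in> bounded_op H" using z adjoint_bop by blast
      \<comment> \<open>Both \<open>M \<xi>\<close> and its orthogonal complement are invariant
        under \<open>y\<close>, because \<open>z x\<close> and \<open>y x\<close> stay in
        \<open>M\<close>. So \<open>y\<close> applied to the decomposition of \<open>\<eta>\<close>
        is the decomposition of \<open>y \<eta>\<close>.\<close>
      have "perp (hsub H (y \<eta>) (y (p \<eta>)))"
        unfolding perp_def
      proof
        fix x assume x: "x \<in> M"
        have "hsub H (y \<eta>) (y (p \<eta>)) = y (hsub H \<eta> (p \<eta>))"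
          using yb \<eta> pH by (simp add: bop_add bop_scale)
        then have "hinner H (x \<xi>) (hsub H (y \<eta>) (y (p \<eta>))) = hinner H (op_mult H z x \<xi>) (hsub H \<eta> (p \<eta>))"
          using adjoint_inner[OF adjoint_sym[OF z(2)] MI[OF x], of "hsub H \<eta> (p \<eta>)"] \<eta> pH \<xi> by simp
        also have "\<dots> = 0" using p[OF \<eta>] M_closed(5)[OF z(1) x] unfolding rel_def perp_def by blast
        finally show "hinner H (x \<xi>) (hsub H (y \<eta>) (y (p \<eta>))) = 0" .
      qed
      moreover have "hinner H (y (p \<eta>)) u = 0" if u: "u \<in> hcarrier H" "perp u" for u
      proof -
        have "perp (z u)" unfolding perp_def
        proof
          fix x assume x: "x \<in> M"
          have "hinner H (x \<xi>) (z u) = hinner H (op_mult H y x \<xi>) u"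
            using adjoint_inner[OF z(2) MI[OF x] u(1)] \<xi> by simp
          then show "hinner H (x \<xi>) (z u) = 0" using u M_closed(5)[OF y x] by (simp add: perp_def)
        qed
        then show ?thesis
          using p[OF \<eta>] adjoint_inner[OF z(2) pH[OF \<eta>] u(1)] M_in[OF z(1) u(1)] by (simp add: rel_def)
      qed
      ultimately show "p (y \<eta>) = y (p \<eta>)"
        using M_in[OF y] \<eta> pH by (intro pI) (auto simp: rel_def)
    qed
    show "p \<xi> = \<xi>"
    proof (rule pI[OF \<xi>])
      show "rel \<xi> \<xi>"
        unfolding rel_def perp_def using \<xi> MI M_closed(1) by (force simp: add_neg)
    qed
    show "p \<eta> = hzero H" if "\<eta> \<in> hcarrier H" "\<And>x. x \<in> M \<Longrightarrow> hinner H (x \<xi>) \<eta> = 0" for \<eta>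
      using that MI by (intro pI) (auto simp: rel_def perp_def)
  qed
qed

section \<open>Central projections and coding of vectors by algebra elements\<close>

locale corner = std_form K N J P for K :: "'k hilb" and N J P +
  fixes q :: "'k \<Rightarrow> 'k"
  assumes q_N: "q \<in> N" and q_comm: "q \<in> commutant K N"
    and q_idem: "op_mult K q q = q" and q_adj: "is_adjoint K q q"
begin

definition R where "R = {x \<in> hcarrier K. q x = x}"

lemma q_bop: "q \<in> bounded_op K"
  using q_adj adjoint_bop by blast

lemma q_in [simp]: "x \<in> hcarrier K \<Longrightarrow> q x \<in> hcarrier K"
  by (rule bop_in[OF q_bop])

lemma q_q [simp]: "x \<in> hcarrier K \<Longrightarrow> q (q x) = q x"
  by (metis op_apply(1) q_idem)

text \<open>For the central element \<open>q\<close>, the standard form gives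
  \<open>JqJ = q*\<close>, and \<open>q\<close> is its own adjoint.\<close>

lemma q_J: "x \<in> hcarrier K \<Longrightarrow> q (J x) = J (q x)"
proof -
  assume x: "x \<in> hcarrier K"
  have "J_conj K J q = q" using adjoint_unique[OF q_adj J_central[OF q_N q_comm]] by simp
  then have "J (q (J x)) = q x" using x by (metis J_conj_apply)
  then show ?thesis using x by (metis J_J J_in q_in)
qed

lemma q_inner: "\<lbrakk>x \<in> hcarrier K; y \<in> hcarrier K\<rbrakk> \<Longrightarrow> hinner K (q x) y = hinner K x (q y)"
  by (rule adjoint_inner[OF q_adj])

lemma q_norm: "x \<in> hcarrier K \<Longrightarrow> hnorm K (q x) \<le> hnorm K x"
proof -
  assume x: "x \<in> hcarrier K"
  have "hinner K (q x) (q x) = hinner K (q x) x" using q_inner[of "q x" x] x by simp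
  then have "(hnorm K (q x))\<^sup>2 \<le> hnorm K (q x) * hnorm K x"
    using cauchy_schwarz[of "q x" x] x hnorm_sq[of "q x"] complex_Re_le_cmod[of "hinner K (q x) x"] by simp
  then show ?thesis
    using hnorm_nonneg[OF bop_in[OF q_bop x]] hnorm_nonneg[OF x]
    by (cases "hnorm K (q x) = 0") (auto simp: power2_eq_square)
qed

lemma q_dist: "\<lbrakk>x \<in> hcarrier K; y \<in> hcarrier K\<rbrakk> \<Longrightarrow> hdist K (q x) (q y) \<le> hdist K x y"
  using hdist_bop[OF q_bop, of 1] q_norm by simp

text \<open>The condition \<open>xJxJ P \<subseteq> P\<close> at \<open>x = q\<close>: as
  \<open>q\<close> commutes with \<open>J\<close> and is idempotent, \<open>qJqJ\<close> acts on
  \<open>P\<close> as \<open>q\<close>.\<close>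

lemma q_P: "\<xi> \<in> P \<Longrightarrow> q \<xi> \<in> P"
  using xJxJ_P[OF q_N, of \<xi>] P_sub q_J J_P by (metis q_q subsetD)

lemma q_M: "\<lbrakk>y \<in> N; x \<in> hcarrier K\<rbrakk> \<Longrightarrow> q (y x) = y (q x)"
  by (rule commutantD[OF q_comm])

lemma R_sub: "x \<in> R \<Longrightarrow> x \<in> hcarrier K" and R_q: "x \<in> R \<Longrightarrow> q x = x"
  by (auto simp: R_def)

lemma q_R [simp]: "x \<in> hcarrier K \<Longrightarrow> q x \<in> R"
  by (simp add: R_def)

lemma R_closed: "hzero K \<in> R" "\<lbrakk>x \<in> R; y \<in> R\<rbrakk> \<Longrightarrow> hadd K x y \<in> R" "x \<in> R \<Longrightarrow> hscale K a x \<in> R"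
  "x \<in> R \<Longrightarrow> J x \<in> R" "\<lbrakk>T \<in> N; x \<in> R\<rbrakk> \<Longrightarrow> T x \<in> R"
  using q_bop by (auto simp: R_def bop_zero bop_add bop_scale q_J q_M M_in)

text \<open>A maximal family of nonzero vectors of \<open>R\<close> with pairwise orthogonal
  \<open>N \<xi>\<close> is total in \<open>R\<close>, since a vector orthogonal to all
  \<open>N \<xi>\<close> could be added. The map \<open>e\<close> labels the family by elements of
  \<open>q N\<close>: with \<open>p\<close> the projection onto the closure of
  \<open>N \<xi>\<close>, the label is \<open>q J p J\<close>. These labels allow the family to be
  indexed inside the algebra, whatever the type of the vectors.\<close>

lemma total_family:
  obtains S e where "S \<subseteq> R" "inj_on e S" "\<And>\<xi>. \<xi> \<in> S \<Longrightarrow> e \<xi> \<in> N \<and> op_mult K q (e \<xi>) = e \<xi>"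
    "\<And>\<eta>. \<lbrakk>\<eta> \<in> R; \<And>\<xi> x. \<lbrakk>\<xi> \<in> S; x \<in> N\<rbrakk> \<Longrightarrow> hinner K \<eta> (x \<xi>) = 0\<rbrakk> \<Longrightarrow> \<eta> = hzero K"
proof -
  \<comment> \<open>As \<open>N\<close> is closed under products and adjoints, orthogonality of all
    \<open>x \<xi>\<close> to \<open>\<eta>\<close> already makes \<open>N \<xi>\<close> and
    \<open>N \<eta>\<close> orthogonal.\<close>
  define A where "A = {S. S \<subseteq> R - {hzero K} \<and>
    (\<forall>\<xi>\<in>S. \<forall>\<eta>\<in>S. \<xi> \<noteq> \<eta> \<longrightarrow> (\<forall>x\<in>N. hinner K (x \<xi>) \<eta> = 0))}"
  have "\<exists>S\<in>A. \<forall>X\<in>A. S \<subseteq> X \<longrightarrow> X = S"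
  proof (rule subset_Zorn')
    fix C assume C: "subset.chain A C"
    then have CA: "C \<subseteq> A" by (auto simp: subset_chain_def)
    have "\<forall>x\<in>N. hinner K (x \<xi>) \<eta> = 0" if in_C: "\<xi> \<in> \<Union>C" "\<eta> \<in> \<Union>C" and ne: "\<xi> \<noteq> \<eta>" for \<xi> \<eta>
    proof -
      obtain X Y where "X \<in> C" "Y \<in> C" "\<xi> \<in> X" "\<eta> \<in> Y" using in_C by blast
      then obtain Z where "Z \<in> C" "\<xi> \<in> Z" "\<eta> \<in> Z"
        using C unfolding subset_chain_def by blast
      then show ?thesis using CA ne unfolding A_def by blast
    qed
    moreover have "\<Union>C \<subseteq> R - {hzero K}" using CA unfolding A_def by blast
    ultimately show "\<Union>C \<in> A" unfolding A_def by blast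
  qed
  then obtain S where S: "S \<in> A" and max: "\<And>X. \<lbrakk>X \<in> A; S \<subseteq> X\<rbrakk> \<Longrightarrow> X = S" by blast
  have SR: "S \<subseteq> R" "hzero K \<notin> S"
    and orth: "\<And>\<xi> \<eta> x. \<lbrakk>\<xi> \<in> S; \<eta> \<in> S; \<xi> \<noteq> \<eta>; x \<in> N\<rbrakk> \<Longrightarrow> hinner K (x \<xi>) \<eta> = 0"
    using S unfolding A_def by blast+
  have SK: "\<xi> \<in> hcarrier K" if "\<xi> \<in> S" for \<xi> using that SR R_sub by blast
  have tot: "\<eta> = hzero K" if \<eta>: "\<eta> \<in> R" and 0: "\<And>\<xi> x. \<lbrakk>\<xi> \<in> S; x \<in> N\<rbrakk> \<Longrightarrow> hinner K \<eta> (x \<xi>) = 0" for \<eta>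
  proof (rule ccontr)
    assume ne: "\<eta> \<noteq> hzero K"
    have \<eta>K: "\<eta> \<in> hcarrier K" using R_sub[OF \<eta>] .
    have 1: "hinner K (x \<xi>) \<eta> = 0" if "\<xi> \<in> S" "x \<in> N" for \<xi> x
      using 0[OF that] inner_cnj[OF M_in[OF that(2) SK[OF that(1)]] \<eta>K] by simp
    \<comment> \<open>The condition in \<open>A\<close> ranges over ordered pairs, so the new vector
      must also be tested in the first position; the adjoint of \<open>x\<close> moves
      \<open>x\<close> to the other side.\<close>
    have 2: "hinner K (x \<eta>) \<xi> = 0" if \<xi>: "\<xi> \<in> S" and x: "x \<in> N" for \<xi> x
    proof -
      obtain z where "z \<in> N" "is_adjoint K x z" using adjoint_ex[OF x] by blast
      then show ?thesis using 0[OF \<xi>] adjoint_inner[of K x z \<eta> \<xi>] \<eta>K SK[OF \<xi>] by simp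
    qed
    have "insert \<eta> S \<in> A"
      using SR \<eta> ne orth 1 2 unfolding A_def by auto
    then have "\<eta> \<in> S" using max by blast
    \<comment> \<open>By maximality the new vector already belongs to \<open>S\<close>, and the case
      \<open>x = 1\<close> makes it orthogonal to itself.\<close>
    then have "hinner K \<eta> \<eta> = 0" using 0[of \<eta> "op_one K"] M_closed(1) \<eta>K by simp
    then show False using ne \<eta>K inner_self_0 by blast
  qed
  have "\<exists>p. p \<in> commutant K N \<and> p \<xi> = \<xi> \<and>
     (\<forall>\<eta>\<in>hcarrier K. (\<forall>x\<in>N. hinner K (x \<xi>) \<eta> = 0) \<longrightarrow> p \<eta> = hzero K)" if "\<xi> \<in> S" for \<xi>
    using cyclic_projection[OF SK[OF that]] by metis
  then obtain p where p: "\<And>\<xi>. \<xi> \<in> S \<Longrightarrow> p \<xi> \<in> commutant K N" "\<And>\<xi>. \<xi> \<in> S \<Longrightarrow> p \<xi> \<xi> = \<xi>"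
    "\<And>\<xi> \<eta>. \<lbrakk>\<xi> \<in> S; \<eta> \<in> hcarrier K; \<forall>x\<in>N. hinner K (x \<xi>) \<eta> = 0\<rbrakk> \<Longrightarrow> p \<xi> \<eta> = hzero K"
    by metis
  define e where "e = (\<lambda>\<xi>. op_mult K q (J_conj K J (p \<xi>)))"
  have J0: "J (hzero K) = hzero K"
    using J_scale[of "hzero K" 0] by (simp add: scale_zero scale_0)
  \<comment> \<open>The label \<open>e \<xi>\<close> fixes \<open>J \<xi>\<close> and annihilates
    \<open>J \<eta>\<close> for every other member \<open>\<eta>\<close>. Equal labels of distinct
    members would therefore force \<open>J \<eta> = 0\<close>.\<close>
  have e1: "e \<xi> (J \<xi>) = J \<xi>" if "\<xi> \<in> S" for \<xi>
    using SK[OF that] p(2)[OF that] SR that by (auto simp: e_def J_conj_apply q_J R_q)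
  have e2: "e \<xi> (J \<eta>) = hzero K" if "\<xi> \<in> S" "\<eta> \<in> S" "\<xi> \<noteq> \<eta>" for \<xi> \<eta>
    using SK[OF that(2)] p(3)[OF that(1) SK[OF that(2)]] orth[OF that] J0 bop_zero[OF q_bop]
    by (auto simp: e_def J_conj_apply)
  show thesis
  proof
    show "S \<subseteq> R" by fact
    show "inj_on e S"
    proof (rule inj_onI, rule ccontr)
      fix \<xi> \<eta> assume *: "\<xi> \<in> S" "\<eta> \<in> S" "e \<xi> = e \<eta>" "\<xi> \<noteq> \<eta>"
      then have "J \<eta> = hzero K" using e1[of \<eta>] e2[of \<xi> \<eta>] by simp
      then have "\<eta> = hzero K" using J0 SK[OF *(2)] by (metis J_J)
      then show False using * SR by blast
    qed
    show "e \<xi> \<in> N \<and> op_mult K q (e \<xi>) = e \<xi>" if "\<xi> \<in> S" for \<xi>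
    proof
      show eN: "e \<xi> \<in> N" unfolding e_def
        by (rule M_closed(5)[OF q_N J_conj_commutant[OF p(1)[OF that]]])
      show "op_mult K q (e \<xi>) = e \<xi>"
      proof (rule extensionalityI[OF op_extensional(1)])
        show "e \<xi> \<in> extensional (hcarrier K)" by (simp add: e_def op_extensional)
        show "op_mult K q (e \<xi>) x = e \<xi> x" if "x \<in> hcarrier K" for x
          using that M_in[OF J_conj_commutant[OF p(1)[OF \<open>\<xi> \<in> S\<close>]] that] by (simp add: e_def)
      qed
    qed
  qed (use tot in blast)
qed

text \<open>A vector of \<open>R\<close> is determined by its pairings with the vectors
  \<open>x \<xi>\<close>. These lie in \<open>R\<close>, so \<open>x\<close> may be replaced by
  \<open>q x\<close>, which comes from \<open>M\<close> through \<open>\<psi>\<close>; the index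
  \<open>\<xi>\<close> comes from \<open>M\<close> through its label \<open>e \<xi>\<close> in
  \<open>q N\<close>. Hence the pairs of elements of \<open>M\<close> as arguments of
  \<open>g \<eta>\<close>.\<close>

lemma embedding:
  fixes \<psi> :: "'m \<Rightarrow> 'k \<Rightarrow> 'k"
  assumes \<psi>: "bij_betw \<psi> M {y \<in> N. op_mult K q y = y}"
  obtains g :: "'k \<Rightarrow> 'm \<times> 'm \<Rightarrow> complex" where "inj_on g R"
proof -
  obtain S e where S: "S \<subseteq> R" "inj_on e S" "\<And>\<xi>. \<xi> \<in> S \<Longrightarrow> e \<xi> \<in> N \<and> op_mult K q (e \<xi>) = e \<xi>"
    "\<And>\<eta>. \<lbrakk>\<eta> \<in> R; \<And>\<xi> x. \<lbrakk>\<xi> \<in> S; x \<in> N\<rbrakk> \<Longrightarrow> hinner K \<eta> (x \<xi>) = 0\<rbrakk> \<Longrightarrow> \<eta> = hzero K"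
    using total_family by blast
  define g where "g = (\<lambda>\<eta> (x, m). hinner K \<eta> (\<psi> x (inv_into S e (\<psi> m))))"
  have "inj_on g R"
  proof (rule inj_onI)
    fix \<eta> \<zeta> assume R: "\<eta> \<in> R" "\<zeta> \<in> R" and eq: "g \<eta> = g \<zeta>"
    have K: "\<eta> \<in> hcarrier K" "\<zeta> \<in> hcarrier K" using R R_sub by auto
    have "hsub K \<eta> \<zeta> = hzero K"
    proof (rule S(4))
      show sR: "hsub K \<eta> \<zeta> \<in> R" using R R_closed by blast
      fix \<xi> x assume \<xi>: "\<xi> \<in> S" and x: "x \<in> N"
      have \<xi>R: "\<xi> \<in> R" and \<xi>K: "\<xi> \<in> hcarrier K" using \<xi> S(1) R_sub by auto
      have "op_mult K q x \<in> {y \<in> N. op_mult K q y = y}"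
        using M_closed(5)[OF q_N x] M_in[OF x]
        by (auto intro!: extensionalityI[OF op_extensional(1) op_extensional(1)])
      then obtain x' where x': "x' \<in> M" "\<psi> x' = op_mult K q x"
        using \<psi> unfolding bij_betw_def by (metis (no_types, lifting) imageE)
      obtain m where m: "\<psi> m = e \<xi>"
        using \<psi> S(3)[OF \<xi>] unfolding bij_betw_def by (metis (mono_tags, lifting) imageE mem_Collect_eq)
      have "g \<eta> (x', m) = g \<zeta> (x', m)" using eq by simp
      then have "hinner K \<eta> (q (x \<xi>)) = hinner K \<zeta> (q (x \<xi>))"
        using x' m \<xi>K inv_into_f_f[OF S(2) \<xi>] by (simp add: g_def)
      then have "hinner K \<eta> (x \<xi>) = hinner K \<zeta> (x \<xi>)"
        using R_q[OF R_closed(5)[OF x \<xi>R]] by simp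
      then show "hinner K (hsub K \<eta> \<zeta>) (x \<xi>) = 0" using K M_in[OF x \<xi>K] by simp
    qed
    then have "hdist K \<eta> \<zeta> = 0" using K by (simp add: hdist_eq)
    then show "\<eta> = \<zeta>" using K zero by blast
  qed
  then show thesis by (rule that)
qed

end

section \<open>Finite sums of vectors\<close>

lemma hsum_cong: "(\<And>i. i < n \<Longrightarrow> f i = g i) \<Longrightarrow> hsum H f n = hsum H g n"
  by (induction n) auto

context pre_hilbert
begin

lemma hsum_in: "(\<And>i. i < n \<Longrightarrow> f i \<in> hcarrier H) \<Longrightarrow> hsum H f n \<in> hcarrier H"
  by (induction n) auto

lemma hsum_bop:
  assumes "T \<in> bounded_op H"
  shows "(\<And>i. i < n \<Longrightarrow> f i \<in> hcarrier H) \<Longrightarrow> hsum H (\<lambda>i. T (f i)) n = T (hsum H f n)"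
  using assms by (induction n) (auto simp: bop_zero bop_add hsum_in)

end

text \<open>The range \<open>R\<close> of \<open>q\<close> is cut out and moved along an injection \<open>g\<close> in one step, so that both
  directions of the theorem can place their standard form in the type required by the definition.\<close>

locale transported = corner K N J P q for K :: "'k hilb" and N J P q +
  fixes g :: "'k \<Rightarrow> 'l"
  assumes inj: "inj_on g R"
begin

definition V where "V = inv_into R g"

definition K' where
  "K' = \<lparr>hcarrier = g ` R, hzero = g (hzero K), hadd = (\<lambda>v w. g (hadd K (V v) (V w))),
    hscale = (\<lambda>a v. g (hscale K a (V v))), hinner = (\<lambda>v w. hinner K (V v) (V w))\<rparr>"

definition cut where "cut T = (\<lambda>v\<in>g ` R. g (q (T (V v))))"

text \<open>Extension by zero: the operator \<open>S\<close> pulled back to the range of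
  \<open>q\<close> and set to zero on the range of \<open>1 - q\<close>. It is a right inverse of
  \<open>cut\<close> on bounded operators.\<close>

definition lift_op where "lift_op S = (\<lambda>x\<in>hcarrier K. V (S (g (q x))))"

definition J' where "J' = (\<lambda>v\<in>g ` R. g (J (V v)))"

text \<open>Because \<open>q\<close> maps \<open>P\<close> into itself and fixes \<open>R\<close>,
  the intersection \<open>P \<inter> R\<close> is the same set as \<open>q P\<close>.\<close>

definition P' where "P' = g ` (P \<inter> R)"

lemma V_g [simp]: "x \<in> R \<Longrightarrow> V (g x) = x"
  by (simp add: V_def inj)

lemma g_V [simp]: "v \<in> g ` R \<Longrightarrow> g (V v) = v"
  by (simp add: V_def f_inv_into_f)

lemma V_R [simp]: "v \<in> g ` R \<Longrightarrow> V v \<in> R"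
  by auto

lemma V_K [simp]: "v \<in> g ` R \<Longrightarrow> V v \<in> hcarrier K"
  using V_R R_sub by blast

lemma V_q [simp]: "v \<in> g ` R \<Longrightarrow> q (V v) = V v"
  using V_R R_q by blast

lemma V_eqI: "\<lbrakk>v \<in> g ` R; w \<in> g ` R; V v = V w\<rbrakk> \<Longrightarrow> v = w"
  by (metis g_V)

lemma K'_simps [simp]:
  "hcarrier K' = g ` R" "hzero K' = g (hzero K)" "hadd K' v w = g (hadd K (V v) (V w))"
  "hscale K' a v = g (hscale K a (V v))" "hinner K' v w = hinner K (V v) (V w)"
  "hnorm K' v = hnorm K (V v)"
  by (simp_all add: K'_def hnorm_def)

section \<open>The Hilbert space carried by the moved range of \<open>q\<close>\<close>

lemma pre_hilbert_K': "pre_hilbert K'"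
proof -
  note [simp] = R_closed
  show ?thesis
  proof
    fix x y z a b assume x: "x \<in> hcarrier K'"
    show "hadd K' x (hzero K') = x" "hadd K' x (hscale K' (- 1) x) = hzero K'"
      "hscale K' (a + b) x = hadd K' (hscale K' a x) (hscale K' b x)"
      "hscale K' a (hscale K' b x) = hscale K' (a * b) x" "hscale K' 1 x = x"
      using x by (auto simp: R_sub add_0 add_neg scale_add scale_mult scale_1)
    show "hinner K' x x \<in> \<real>\<^sub>\<ge>\<^sub>0" using x by (simp add: inner_self_nonneg)
    show "x = hzero K'" if "hinner K' x x = 0"
      using x that inner_self_0[of "V x"] by (intro V_eqI) auto
    assume y: "y \<in> hcarrier K'"
    show "hadd K' x y = hadd K' y x" "hscale K' a (hadd K' x y) = hadd K' (hscale K' a x) (hscale K' a y)"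
      using x y by (simp_all add: scale_distrib add_com)
    show "hinner K' x y = cnj (hinner K' y x)" using x y by (simp add: inner_cnj[symmetric])
    show "hinner K' (hscale K' a x) y = a * hinner K' x y" using x y by simp
    assume z: "z \<in> hcarrier K'"
    show "hadd K' (hadd K' x y) z = hadd K' x (hadd K' y z)" using x y z by (simp add: add_ac)
    show "hinner K' (hadd K' x y) z = hinner K' x z + hinner K' y z" using x y z by simp
  qed auto
qed

lemma hdist_K': "\<lbrakk>v \<in> g ` R; w \<in> g ` R\<rbrakk> \<Longrightarrow> hdist K' v w = hdist K (V v) (V w)"
  by (simp add: hdist_def R_closed)

sublocale K': hilbert_space K'
proof (rule pre_hilbert.hilbert_spaceI[OF pre_hilbert_K'])
  fix s :: "nat \<Rightarrow> 'l" assume s: "\<And>n. s n \<in> hcarrier K'"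
    and cau: "\<And>e. e > 0 \<Longrightarrow> \<exists>N. \<forall>m\<ge>N. \<forall>n\<ge>N. hdist K' (s m) (s n) < e"
  have sR: "s n \<in> g ` R" for n using s by simp
  have cau': "\<exists>N. \<forall>m\<ge>N. \<forall>n\<ge>N. hdist K (V (s m)) (V (s n)) < e" if "e > 0" for e
    using cau[OF that] by (simp add: hdist_K' sR)
  obtain l where l: "l \<in> hcarrier K" "(\<lambda>n. hdist K (V (s n)) l) \<longlonglongrightarrow> 0"
    by (rule cauchy_limit[OF V_K[OF sR] cau'])
  \<comment> \<open>\<open>q\<close> fixes every \<open>V (s n)\<close> and does not increase
    distances, so \<open>q l\<close> is as good a limit as \<open>l\<close>. The limit therefore
    lies in \<open>R\<close>.\<close>
  have "hdist K (q l) l \<le> 2 * hdist K (V (s n)) l" for n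
  proof -
    have "hdist K (q l) l \<le> hdist K (V (s n)) (q l) + hdist K (V (s n)) l"
      using l(1) sR by (intro triangle'') auto
    moreover have "hdist K (V (s n)) (q l) \<le> hdist K (V (s n)) l"
      using q_dist[of "V (s n)" l] l(1) sR by simp
    ultimately show ?thesis by simp
  qed
  then have "hdist K (q l) l \<le> 2 * 0"
    using l(2) by (intro LIMSEQ_le_const[OF tendsto_mult_left]) auto
  then have "hdist K (q l) l = 0" using hdist_nonneg[of "q l" l] by simp
  then have R: "l \<in> R" using l(1) zero[of "q l" l] by (simp add: R_def)
  then have "hdist K' (s n) (g l) = hdist K (V (s n)) l" for n by (simp add: hdist_K' sR)
  then show "\<exists>l\<in>hcarrier K'. (\<lambda>n. hdist K' (s n) l) \<longlonglongrightarrow> 0"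
    using l(2) R by (intro bexI[of _ "g l"]) auto
qed

lemma cut_apply: "v \<in> g ` R \<Longrightarrow> cut T v = g (q (T (V v)))"
  by (simp add: cut_def)

lemma lift_op_apply: "x \<in> hcarrier K \<Longrightarrow> lift_op S x = V (S (g (q x)))"
  by (simp add: lift_op_def)

lemma V_cut: "\<lbrakk>T \<in> bounded_op K; v \<in> g ` R\<rbrakk> \<Longrightarrow> V (cut T v) = q (T (V v))"
  by (simp add: cut_apply bop_in)

lemma cut_bop:
  assumes T: "T \<in> bounded_op K" shows "cut T \<in> bounded_op K'"
proof -
  obtain B where B: "\<And>x. x \<in> hcarrier K \<Longrightarrow> hnorm K (T x) \<le> B * hnorm K x"
    using bop_bound[OF T] by metis
  have q: "q (T (V v)) \<in> R" if "v \<in> g ` R" for v using that T by (simp add: bop_in)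
  show ?thesis
  proof (rule bopI[where B=B])
    fix v w a assume v: "v \<in> hcarrier K'"
    then show "cut T v \<in> hcarrier K'" using q by (simp add: cut_apply)
    show "cut T (hscale K' a v) = hscale K' a (cut T v)"
      using v T q q_bop by (simp add: cut_apply R_closed bop_scale bop_in)
    show "hnorm K' (cut T v) \<le> B * hnorm K' v"
      using v T q[of v] q_norm[of "T (V v)"] B[of "V v"] by (simp add: cut_apply bop_in)
    assume w: "w \<in> hcarrier K'"
    show "cut T (hadd K' v w) = hadd K' (cut T v) (cut T w)"
      using v w T q q_bop by (simp add: cut_apply R_closed bop_add bop_in)
  qed (simp add: cut_def)
qed

lemma lift_op_bop:
  assumes S: "S \<in> bounded_op K'" shows "lift_op S \<in> bounded_op K"
proof -
  obtain B where B: "B > 0" "\<And>x. x \<in> hcarrier K' \<Longrightarrow> hnorm K' (S x) \<le> B * hnorm K' x"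
    using K'.bop_bound[OF S] by metis
  have SR: "S v \<in> g ` R" if "v \<in> g ` R" for v using bop_in[OF S] that by simp
  show ?thesis
  proof (rule bopI[where B=B])
    fix x y a assume x: "x \<in> hcarrier K"
    show "lift_op S x \<in> hcarrier K" using x SR by (simp add: lift_op_apply)
    have "g (q (hscale K a x)) = hscale K' a (g (q x))"
      using x by (simp add: bop_scale[OF q_bop])
    then have "S (g (q (hscale K a x))) = hscale K' a (S (g (q x)))"
      using bop_scale[OF S, of "g (q x)" a] x by simp
    then show "lift_op S (hscale K a x) = hscale K a (lift_op S x)"
      using x SR by (simp add: lift_op_apply R_closed)
    have "hnorm K (lift_op S x) \<le> B * hnorm K (q x)"
      using B(2)[of "g (q x)"] x by (simp add: lift_op_apply)
    also have "\<dots> \<le> B * hnorm K x" using B(1) q_norm[OF x] by (intro mult_left_mono) auto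
    finally show "hnorm K (lift_op S x) \<le> B * hnorm K x" .
    assume y: "y \<in> hcarrier K"
    have "g (q (hadd K x y)) = hadd K' (g (q x)) (g (q y))"
      using x y by (simp add: bop_add[OF q_bop])
    then have "S (g (q (hadd K x y))) = hadd K' (S (g (q x))) (S (g (q y)))"
      using bop_add[OF S, of "g (q x)" "g (q y)"] x y by simp
    then show "lift_op S (hadd K x y) = hadd K (lift_op S x) (lift_op S y)"
      using x y SR by (simp add: lift_op_apply R_closed)
  qed (simp add: lift_op_def)
qed

lemma cut_lift_op:
  assumes S: "S \<in> bounded_op K'" shows "cut (lift_op S) = S"
proof (rule bop_ext[OF cut_bop[OF lift_op_bop[OF S]] S])
  fix v assume v: "v \<in> hcarrier K'"
  then have "S v \<in> g ` R" using bop_in[OF S] by simp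
  then show "cut (lift_op S) v = S v" using v by (simp add: cut_apply lift_op_apply)
qed

text \<open>An operator commuting with the compressed family extends by zero to one commuting with
  \<open>A\<close>, because \<open>q\<close> commutes with \<open>A\<close>; conversely, the inner
  factors \<open>q\<close> in a product of compressions are absorbed. The statement is for a general
  family \<open>A\<close> so that it serves both for \<open>N\<close> and for its commutant, which
  together give the bicommutant.\<close>

lemma commutant_cut:
  assumes A: "A \<subseteq> bounded_op K" and qA: "\<And>T x. \<lbrakk>T \<in> A; x \<in> hcarrier K\<rbrakk> \<Longrightarrow> q (T x) = T (q x)"
  shows "commutant K' (cut ` A) = cut ` commutant K A"
proof -
  have cA: "cut ` A \<subseteq> bounded_op K'" using A cut_bop by blast
  show ?thesis
  proof (intro equalityI subsetI)
    fix S assume S: "S \<in> commutant K' (cut ` A)"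
    have Sb: "S \<in> bounded_op K'" using S K'.commutant_bop by blast
    have SR: "S v \<in> g ` R" if "v \<in> g ` R" for v using bop_in[OF Sb] that by simp
    have "lift_op S \<in> commutant K A"
      unfolding commutant_iff[OF A]
    proof (intro conjI ballI lift_op_bop[OF Sb])
      fix T x assume T: "T \<in> A" and x: "x \<in> hcarrier K"
      have Tb: "T \<in> bounded_op K" using A T by blast
      have *: "g (q x) \<in> g ` R" using x by simp
      have "S (cut T (g (q x))) = cut T (S (g (q x)))"
        using S T x unfolding K'.commutant_iff[OF cA] by simp
      then have "V (S (g (q (T (q x))))) = q (T (V (S (g (q x)))))"
        using x * SR[OF *] V_cut[OF Tb] by (simp add: cut_apply)
      moreover have "q (T (q x)) = q (T x)" using qA[OF T x] bop_in[OF Tb x] by (metis q_q)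
      ultimately show "lift_op S (T x) = T (lift_op S x)"
        using x qA[OF T, of "V (S (g (q x)))"] SR[OF *] bop_in[OF Tb] by (simp add: lift_op_apply)
    qed
    then show "S \<in> cut ` commutant K A" using cut_lift_op[OF Sb] by (metis imageI)
  next
    fix S assume "S \<in> cut ` commutant K A"
    then obtain T where T: "T \<in> commutant K A" "S = cut T" by blast
    have Tb: "T \<in> bounded_op K" using T commutant_bop by blast
    show "S \<in> commutant K' (cut ` A)"
      unfolding K'.commutant_iff[OF cA] T(2)
    proof (intro conjI ballI cut_bop[OF Tb])
      fix Y v assume "Y \<in> cut ` A" and v: "v \<in> hcarrier K'"
      then obtain y where y: "y \<in> A" "Y = cut y" by blast
      have yb: "y \<in> bounded_op K" using y A by blast
      have vK: "V v \<in> hcarrier K" using v by simp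
      have cT: "T (y x) = y (T x)" if "x \<in> hcarrier K" for x
        using T(1) y(1) that unfolding commutant_iff[OF A] by blast
      have "q (T (q (y (V v)))) = q (T (y (V v)))"
        using qA[OF y(1) vK] v by simp
      also have "\<dots> = q (y (T (V v)))" using cT vK by simp
      also have "\<dots> = q (y (q (T (V v))))"
        using qA[OF y(1) bop_in[OF Tb vK]] bop_in[OF yb bop_in[OF Tb vK]] by (metis q_q)
      finally show "cut T (Y v) = Y (cut T v)"
        using v vK y(2) bop_in[OF Tb] bop_in[OF yb] by (simp add: cut_apply)
    qed
  qed
qed

lemma cut_adjoint:
  assumes adj: "is_adjoint K y z" shows "is_adjoint K' (cut y) (cut z)"
  unfolding is_adjoint_def
proof (intro conjI ballI cut_bop adjoint_bop[OF adj])
  fix v w assume v: "v \<in> hcarrier K'" and w: "w \<in> hcarrier K'"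
  have "y (V v) \<in> hcarrier K" "z (V w) \<in> hcarrier K"
    using v w adjoint_bop[OF adj] by (simp_all add: bop_in)
  then show "hinner K' (cut y v) w = hinner K' v (cut z w)"
    using v w q_inner[of "y (V v)" "V w"] q_inner[of "V v" "z (V w)"] adjoint_inner[OF adj, of "V v" "V w"]
    by (simp add: cut_apply)
qed

lemma vn_K': "von_neumann_algebra K' (cut ` N)"
  unfolding von_neumann_algebra_def
proof (intro conjI ballI)
  show "hilbert_space K'" by (rule K'.hilbert_space_axioms)
  show "cut ` N \<subseteq> bounded_op K'" using M_bop cut_bop by blast
  have "commutant K' (cut ` N) = cut ` commutant K N"
    using M_bop q_M by (rule commutant_cut)
  moreover have "commutant K' (cut ` commutant K N) = cut ` commutant K (commutant K N)"
    using commutant_bop commutantD[OF _ q_N] by (intro commutant_cut) auto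
  ultimately show "commutant K' (commutant K' (cut ` N)) = cut ` N" by (simp add: bicommutant)
  fix T assume "T \<in> cut ` N"
  then obtain y where y: "y \<in> N" "T = cut y" by blast
  obtain z where z: "z \<in> N" "is_adjoint K y z" using adjoint_ex[OF y(1)] by blast
  then show "\<exists>S\<in>cut ` N. is_adjoint K' T S" using cut_adjoint y by blast
qed


section \<open>The compressed standard form and its matrix cones\<close>

lemma J'_apply: "v \<in> g ` R \<Longrightarrow> J' v = g (J (V v))"
  by (simp add: J'_def)

lemma J_conj_cut:
  assumes y: "y \<in> N" shows "J_conj K' J' (cut y) = cut (J_conj K J y)"
proof (rule extensionalityI)
  show "J_conj K' J' (cut y) \<in> extensional (g ` R)"
    using op_extensional(1)[of K'] by (simp add: J_conj_def)
  show "cut (J_conj K J y) \<in> extensional (g ` R)" by (simp add: cut_def)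
  fix v assume v: "v \<in> g ` R"
  then have "J' v \<in> g ` R" "V (J' v) = J (V v)" by (auto simp: J'_apply R_closed)
  moreover have "q (y (J (V v))) = y (J (V v))"
    using R_q[OF R_closed(5)[OF y R_closed(4)[OF V_R[OF v]]]] .
  moreover have "y (J (V v)) \<in> R" using R_closed(5)[OF y R_closed(4)[OF V_R[OF v]]] .
  ultimately show "J_conj K' J' (cut y) v = cut (J_conj K J y) v"
    using v by (simp add: J_conj_def cut_apply J'_apply R_closed R_q)
qed

lemma P_inner: "\<lbrakk>\<xi> \<in> P; \<eta> \<in> P\<rbrakk> \<Longrightarrow> hinner K \<xi> \<eta> \<in> \<real>\<^sub>\<ge>\<^sub>0"
  by (simp only: P_iff[of \<xi>])

lemma cone_K': "self_dual_cone K' P'"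
  unfolding K'.self_dual_cone_iff
proof (intro equalityI subsetI)
  fix v assume "v \<in> P'"
  then show "v \<in> {\<xi> \<in> hcarrier K'. \<forall>\<eta>\<in>P'. hinner K' \<xi> \<eta> \<in> \<real>\<^sub>\<ge>\<^sub>0}"
    using P_inner by (auto simp: P'_def)
next
  fix v assume v: "v \<in> {\<xi> \<in> hcarrier K'. \<forall>\<eta>\<in>P'. hinner K' \<xi> \<eta> \<in> \<real>\<^sub>\<ge>\<^sub>0}"
  then have vR: "v \<in> g ` R" by simp
  have "hinner K (V v) \<eta> \<in> \<real>\<^sub>\<ge>\<^sub>0" if \<eta>: "\<eta> \<in> P" for \<eta>
  proof -
    have \<eta>K: "\<eta> \<in> hcarrier K" using P_sub \<eta> by blast
    \<comment> \<open>Duality in the range is a condition on \<open>q \<eta>\<close> only. This is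
      enough, since \<open>V v = q (V v)\<close> makes the pairings of \<open>V v\<close> with
      \<open>\<eta>\<close> and with \<open>q \<eta>\<close> equal.\<close>
    have "g (q \<eta>) \<in> P'" using q_P[OF \<eta>] \<eta>K by (auto simp: P'_def)
    then have "hinner K' v (g (q \<eta>)) \<in> \<real>\<^sub>\<ge>\<^sub>0" using v by blast
    then show ?thesis using \<eta>K q_inner[of "V v" \<eta>] vR by simp
  qed
  then have "V v \<in> P" using P_iff[of "V v"] vR by simp
  then show "v \<in> P'" unfolding P'_def using vR g_V[OF vR] V_R[OF vR] by (metis IntI imageI)
qed

lemma standard_form_K': "standard_form K' (cut ` N) J' P'"
  unfolding standard_form_def
proof (intro conjI ballI vn_K' cone_K')
  show "conj_linear_involution K' J'"
    unfolding conj_linear_involution_def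
    by (auto simp: J'_def R_closed J_add J_scale J_norm R_sub)
  have com: "commutant K' (cut ` N) = cut ` commutant K N"
    using M_bop q_M by (rule commutant_cut)
  have "J_conj K' J' ` (cut ` N) = cut ` (J_conj K J ` N)"
    using J_conj_cut by (simp add: image_image)
  then show "J_conj K' J' ` (cut ` N) = commutant K' (cut ` N)" using com J_image by simp
  show "J' \<xi> = \<xi>" if \<xi>: "\<xi> \<in> P'" for \<xi>
  proof -
    obtain \<eta> where "\<eta> \<in> P" "\<eta> \<in> R" "\<xi> = g \<eta>" using \<xi> by (auto simp: P'_def)
    then show ?thesis using J_P by (simp add: J'_apply)
  qed
  show "x (J' (x (J' \<xi>))) \<in> P'" if x: "x \<in> cut ` N" and \<xi>: "\<xi> \<in> P'" for x \<xi>
  proof -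
    obtain y where y: "y \<in> N" "x = cut y" using x by blast
    obtain \<eta> where \<eta>: "\<eta> \<in> P" "\<eta> \<in> R" "\<xi> = g \<eta>" using \<xi> by (auto simp: P'_def)
    have 1: "y (J \<eta>) \<in> R" "y (J (y (J \<eta>))) \<in> R" using \<eta> y by (simp_all add: R_closed)
    then have "x (J' (x (J' \<xi>))) = g (y (J (y (J \<eta>))))"
      using \<eta> y(2) by (simp add: cut_apply J'_apply R_closed R_q)
    then show ?thesis using 1 xJxJ_P[OF y(1) \<eta>(1)] by (simp add: P'_def)
  qed
  show "is_adjoint K' c (J_conj K' J' c)" if c: "c \<in> cut ` N \<inter> commutant K' (cut ` N)" for c
  proof -
    obtain y where y: "y \<in> N" "c = cut y" using c by blast
    obtain z where z: "z \<in> commutant K N" "c = cut z" using c com by blast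
    \<comment> \<open>A central element of the compressed algebra is both \<open>cut y\<close> with
      \<open>y\<close> in \<open>N\<close> and \<open>cut z\<close> with \<open>z\<close> in the
      commutant, but neither \<open>y\<close> nor \<open>z\<close> need be central. Equal
      compressions give \<open>q y = q z\<close>, so \<open>w\<close> lies in \<open>N\<close> and
      in the commutant and \<open>J_central\<close> applies to it.\<close>
    define w where "w = op_mult K q y"
    have wN: "w \<in> N" unfolding w_def by (rule M_closed(5)[OF q_N y(1)])
    have cw: "c = cut w"
      unfolding y(2) by (rule ext) (auto simp: w_def cut_def M_in[OF y(1)])
    have "w \<in> commutant K N"
    proof -
      have zb: "z \<in> bounded_op K" using z(1) commutant_bop by blast
      have "w = op_mult K q z"
      proof (rule extensionalityI)
        fix x assume x: "x \<in> hcarrier K"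
        have gq: "g (q x) \<in> g ` R" using x by simp
        have "V (cut y (g (q x))) = V (cut z (g (q x)))" using y(2) z(2) by simp
        then have "q (y (q x)) = q (z (q x))"
          unfolding V_cut[OF subsetD[OF M_bop y(1)] gq] V_cut[OF zb gq] using x by simp
        moreover have "q (y (q x)) = q (y x)" using q_M[OF y(1) x] M_in[OF y(1) x] by (metis q_q)
        moreover have "q (z (q x)) = q (z x)"
          using x commutantD[OF z(1) q_N x] bop_in[OF zb x] by simp
        ultimately show "w x = op_mult K q z x" using x by (simp add: w_def)
      qed (simp_all add: w_def op_extensional)
      then show ?thesis using commutant_closed(5)[OF M_bop q_comm z(1)] by simp
    qed
    then have "is_adjoint K w (J_conj K J w)" by (rule J_central[OF wN])
    then show ?thesis using cut_adjoint J_conj_cut[OF wN] cw by metis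
  qed
qed

text \<open>All vectors \<open>x i (J (x j (J (V (\<xi> i j)))))\<close> stay in \<open>R\<close>,
  where \<open>q\<close> acts as the identity. Thus each summand on the new side is the
  \<open>g\<close>-image of the corresponding one in \<open>K\<close>, and \<open>g\<close> carries
  \<open>P \<inter> R\<close> bijectively onto \<open>P'\<close>.\<close>

lemma matrix_cone_K':
  "\<xi> \<in> matrix_cone K' (cut ` N) J' P' n \<longleftrightarrow>
    (\<forall>i<n. \<forall>j<n. \<xi> i j \<in> g ` R) \<and> (\<lambda>i j. V (\<xi> i j)) \<in> matrix_cone K N J P n"
proof (cases "\<forall>i<n. \<forall>j<n. \<xi> i j \<in> g ` R")
  case True
  define \<sigma> where "\<sigma> = (\<lambda>x. hsum K (\<lambda>i. hsum K (\<lambda>j. x i (J (x j (J (V (\<xi> i j)))))) n) n)"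
  have tR: "x i (J (x j (J (V (\<xi> i j))))) \<in> R" "x j (J (V (\<xi> i j))) \<in> R"
    if "\<forall>i<n. x i \<in> N" "i < n" "j < n" for x i j
    using that True by (simp_all add: R_closed)
  have hsR: "hsum K f m \<in> R" if "\<And>i. i < m \<Longrightarrow> f i \<in> R" for f m
    using that by (induction m) (auto simp: R_closed)
  have hsV: "hsum K' f m = g (hsum K (\<lambda>i. V (f i)) m)" if "\<And>i. i < m \<Longrightarrow> f i \<in> g ` R" for f m
    using that
  proof (induction m)
    case (Suc m)
    have "hsum K (\<lambda>i. V (f i)) m \<in> R" using Suc.prems by (intro hsR) auto
    then show ?case using Suc by simp
  qed simp
  have \<sigma>R: "\<sigma> x \<in> R" if x: "\<forall>i<n. x i \<in> N" for x
    unfolding \<sigma>_def using tR[OF x] by (intro hsR) auto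
  have \<sigma>': "hsum K' (\<lambda>i. hsum K' (\<lambda>j. cut (x i) (J' (cut (x j) (J' (\<xi> i j))))) n) n = g (\<sigma> x)"
    if x: "\<forall>i<n. x i \<in> N" for x
  proof -
    have t: "cut (x i) (J' (cut (x j) (J' (\<xi> i j)))) = g (x i (J (x j (J (V (\<xi> i j))))))"
      if "i < n" "j < n" for i j
      using that True tR[OF x that] by (simp add: cut_apply J'_apply R_closed R_q)
    have inner: "hsum K' (\<lambda>j. cut (x i) (J' (cut (x j) (J' (\<xi> i j))))) n
        = g (hsum K (\<lambda>j. x i (J (x j (J (V (\<xi> i j)))))) n)" if "i < n" for i
    proof -
      have "hsum K' (\<lambda>j. cut (x i) (J' (cut (x j) (J' (\<xi> i j))))) n
          = hsum K' (\<lambda>j. g (x i (J (x j (J (V (\<xi> i j))))))) n"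
        using t[OF that] by (intro hsum_cong) auto
      also have "\<dots> = g (hsum K (\<lambda>j. V (g (x i (J (x j (J (V (\<xi> i j)))))))) n)"
        using tR[OF x that] by (intro hsV) auto
      also have "hsum K (\<lambda>j. V (g (x i (J (x j (J (V (\<xi> i j)))))))) n
          = hsum K (\<lambda>j. x i (J (x j (J (V (\<xi> i j)))))) n"
        using tR[OF x that] by (intro hsum_cong) auto
      finally show ?thesis .
    qed
    have iR: "hsum K (\<lambda>j. x i (J (x j (J (V (\<xi> i j)))))) n \<in> R" if "i < n" for i
      using tR[OF x that] by (intro hsR) auto
    have "hsum K' (\<lambda>i. hsum K' (\<lambda>j. cut (x i) (J' (cut (x j) (J' (\<xi> i j))))) n) n
        = hsum K' (\<lambda>i. g (hsum K (\<lambda>j. x i (J (x j (J (V (\<xi> i j)))))) n)) n"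
      using inner by (intro hsum_cong) auto
    also have "\<dots> = g (hsum K (\<lambda>i. V (g (hsum K (\<lambda>j. x i (J (x j (J (V (\<xi> i j)))))) n))) n)"
      using iR by (intro hsV) auto
    also have "hsum K (\<lambda>i. V (g (hsum K (\<lambda>j. x i (J (x j (J (V (\<xi> i j)))))) n))) n = \<sigma> x"
      unfolding \<sigma>_def using iR by (intro hsum_cong) auto
    finally show ?thesis .
  qed
  have gP: "g (\<sigma> x) \<in> P' \<longleftrightarrow> \<sigma> x \<in> P" if x: "\<forall>i<n. x i \<in> N" for x
    using \<sigma>R[OF x] inj unfolding P'_def inj_on_def by blast
  have "(\<forall>x. (\<forall>i<n. x i \<in> cut ` N) \<longrightarrow>
      hsum K' (\<lambda>i. hsum K' (\<lambda>j. x i (J' (x j (J' (\<xi> i j))))) n) n \<in> P')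
    \<longleftrightarrow> (\<forall>x. (\<forall>i<n. x i \<in> N) \<longrightarrow> \<sigma> x \<in> P)" (is "?A \<longleftrightarrow> ?B")
  proof
    assume A: ?A
    show ?B
    proof (intro allI impI)
      fix x assume x: "\<forall>i<n. x i \<in> N"
      then have "\<forall>i<n. cut (x i) \<in> cut ` N" by simp
      then have "hsum K' (\<lambda>i. hsum K' (\<lambda>j. cut (x i) (J' (cut (x j) (J' (\<xi> i j))))) n) n \<in> P'"
        using A[rule_format, of "\<lambda>i. cut (x i)"] by simp
      then show "\<sigma> x \<in> P" using \<sigma>'[OF x] gP[OF x] by simp
    qed
  next
    assume B: ?B
    show ?A
    proof (intro allI impI)
      fix x assume "\<forall>i<n. x i \<in> cut ` N"
      then have "\<forall>i. \<exists>y. i < n \<longrightarrow> y \<in> N \<and> x i = cut y" by blast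
      then obtain y where y: "\<And>i. i < n \<Longrightarrow> y i \<in> N" "\<And>i. i < n \<Longrightarrow> x i = cut (y i)" by metis
      have "hsum K' (\<lambda>i. hsum K' (\<lambda>j. x i (J' (x j (J' (\<xi> i j))))) n) n
          = hsum K' (\<lambda>i. hsum K' (\<lambda>j. cut (y i) (J' (cut (y j) (J' (\<xi> i j))))) n) n"
        using y(2) by (intro hsum_cong) auto
      then show "hsum K' (\<lambda>i. hsum K' (\<lambda>j. x i (J' (x j (J' (\<xi> i j))))) n) n \<in> P'"
        using \<sigma>'[of y] gP[of y] B y(1) by simp
    qed
  qed
  then show ?thesis using True by (simp add: matrix_cone_def \<sigma>_def)
qed (auto simp: matrix_cone_def)

text \<open>Complete positivity of \<open>q\<close>: it commutes with the \<open>x i\<close> and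
  with \<open>J\<close>, so it can be pulled out of the double sum, and then
  \<open>q P \<subseteq> P\<close> applies.\<close>

lemma matrix_cone_q:
  assumes \<xi>: "\<xi> \<in> matrix_cone K N J P n"
  shows "(\<lambda>i j. q (\<xi> i j)) \<in> matrix_cone K N J P n"
proof -
  have \<xi>K: "\<xi> i j \<in> hcarrier K" if "i < n" "j < n" for i j using \<xi> that by (simp add: matrix_cone_def)
  have "hsum K (\<lambda>i. hsum K (\<lambda>j. x i (J (x j (J (q (\<xi> i j)))))) n) n \<in> P"
    if x: "\<forall>i<n. x i \<in> N" for x
  proof -
    have tK: "x i (J (x j (J (\<xi> i j)))) \<in> hcarrier K" if "i < n" "j < n" for i j
      using that x \<xi>K[OF that] by (simp add: M_in)
    have t: "x i (J (x j (J (q (\<xi> i j))))) = q (x i (J (x j (J (\<xi> i j)))))" if "i < n" "j < n" for i j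
    proof -
      have "x j (J (\<xi> i j)) \<in> hcarrier K" using that x \<xi>K by (simp add: M_in)
      then show ?thesis using that x \<xi>K by (simp add: q_J[symmetric] q_M[symmetric])
    qed
    have "hsum K (\<lambda>j. x i (J (x j (J (q (\<xi> i j)))))) n = q (hsum K (\<lambda>j. x i (J (x j (J (\<xi> i j))))) n)"
      if "i < n" for i
      using t[OF that] tK[OF that] by (subst hsum_bop[OF q_bop, symmetric]) (auto intro!: hsum_cong)
    then have "hsum K (\<lambda>i. hsum K (\<lambda>j. x i (J (x j (J (q (\<xi> i j)))))) n) n
        = q (hsum K (\<lambda>i. hsum K (\<lambda>j. x i (J (x j (J (\<xi> i j))))) n) n)"
      using tK by (subst hsum_bop[OF q_bop, symmetric]) (auto intro!: hsum_cong hsum_in)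
    then show ?thesis using q_P \<xi> x by (simp add: matrix_cone_def)
  qed
  then show ?thesis using \<xi>K by (simp add: matrix_cone_def)
qed

text \<open>On \<open>R\<close> the operator is \<open>q T\<close>, a composition of completely
  positive contractions. Entries with an index beyond \<open>n\<close> are arbitrary, so matrices
  are compared below \<open>n\<close> only.\<close>

lemma ccp_cut:
  assumes T: "ccp K N J P T" shows "ccp K' (cut ` N) J' P' (cut T)"
proof -
  have Tb: "T \<in> bounded_op K" using T by (simp add: ccp_def completely_positive_def)
  show ?thesis
    unfolding ccp_def completely_positive_def
  proof (intro conjI allI impI ballI cut_bop[OF Tb])
    fix n :: nat and \<xi> assume n: "1 \<le> n" and \<xi>: "\<xi> \<in> matrix_cone K' (cut ` N) J' P' n"
    have \<xi>R: "\<xi> i j \<in> g ` R" if "i < n" "j < n" for i j using \<xi> that unfolding matrix_cone_K' by simp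
    have "(\<lambda>i j. q (T (V (\<xi> i j)))) \<in> matrix_cone K N J P n"
      using T n \<xi> by (intro matrix_cone_q) (simp add: ccp_def completely_positive_def matrix_cone_K')
    moreover have "V (cut T (\<xi> i j)) = q (T (V (\<xi> i j)))" if "i < n" "j < n" for i j
      using V_cut[OF Tb \<xi>R[OF that]] .
    ultimately have "(\<lambda>i j. V (cut T (\<xi> i j))) \<in> matrix_cone K N J P n"
      unfolding matrix_cone_def by (simp cong: hsum_cong)
    moreover have "cut T (\<xi> i j) \<in> g ` R" if "i < n" "j < n" for i j
      using bop_in[OF cut_bop[OF Tb], of "\<xi> i j"] \<xi>R[OF that] by simp
    ultimately show "(\<lambda>i j. cut T (\<xi> i j)) \<in> matrix_cone K' (cut ` N) J' P' n"
      unfolding matrix_cone_K' by simp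
  next
    fix v assume v: "v \<in> hcarrier K'"
    then have vK: "V v \<in> hcarrier K" by simp
    have "hnorm K (q (T (V v))) \<le> hnorm K (V v)"
      using q_norm[OF bop_in[OF Tb vK]] T vK unfolding ccp_def by fastforce
    then show "hnorm K' (cut T v) \<le> hnorm K' v" using V_cut[OF Tb] v by simp
  qed
qed

text \<open>A finite net for the image of the unit ball under \<open>T\<close> is mapped by the
  contraction \<open>q\<close> to a net for the image under \<open>q T\<close>, and \<open>V\<close>
  is isometric.\<close>

lemma compact_cut:
  assumes T: "compact_op K T" shows "compact_op K' (cut T)"
proof -
  have Tb: "T \<in> bounded_op K" using T by (simp add: compact_op_def)
  show ?thesis
    unfolding K'.compact_op_iff
  proof (intro conjI allI impI cut_bop[OF Tb])
    fix e :: real assume "e > 0"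
    then obtain F where F: "finite F" "F \<subseteq> hcarrier K"
      "\<And>x. \<lbrakk>x \<in> hcarrier K; hnorm K x \<le> 1\<rbrakk> \<Longrightarrow> \<exists>y\<in>F. hdist K (T x) y < e"
      using T unfolding compact_op_iff by meson
    show "\<exists>F. finite F \<and> F \<subseteq> hcarrier K' \<and>
        (\<forall>x\<in>hcarrier K'. hnorm K' x \<le> 1 \<longrightarrow> (\<exists>y\<in>F. hdist K' (cut T x) y < e))"
    proof (intro exI[of _ "(\<lambda>y. g (q y)) ` F"] conjI ballI impI)
      show "(\<lambda>y. g (q y)) ` F \<subseteq> hcarrier K'" using F(2) by auto
      fix v assume v: "v \<in> hcarrier K'" "hnorm K' v \<le> 1"
      then have vK: "V v \<in> hcarrier K" by simp
      obtain y where y: "y \<in> F" "hdist K (T (V v)) y < e" using F(3)[OF vK] v by auto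
      have yK: "y \<in> hcarrier K" using y F by blast
      have "hdist K' (cut T v) (g (q y)) = hdist K (q (T (V v))) (q y)"
        using v yK Tb vK by (simp add: cut_apply hdist_K' bop_in)
      also have "\<dots> < e" using q_dist[OF bop_in[OF Tb vK] yK] y(2) by simp
      finally show "\<exists>y\<in>(\<lambda>y. g (q y)) ` F. hdist K' (cut T v) y < e" using y(1) by blast
    qed (use F in auto)
  qed
qed

text \<open>As \<open>q\<close> fixes \<open>V v\<close>, the distance of \<open>q (T (V v))\<close>
  to \<open>V v\<close> is a distance between two images under \<open>q\<close>, hence at most that
  of \<open>T (V v)\<close> to \<open>V v\<close>.\<close>

lemma approximable_K':
  assumes "approximable K N J P" shows "approximable K' (cut ` N) J' P'"
  unfolding approximable_def
proof (intro allI impI)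
  fix S and e :: real assume S: "finite S \<and> S \<subseteq> hcarrier K' \<and> 0 < e"
  then have "finite (V ` S) \<and> V ` S \<subseteq> hcarrier K \<and> 0 < e"
    using V_K by (metis (no_types, lifting) K'_simps(1) finite_imageI image_subsetI subsetD)
  then obtain T where T: "ccp K N J P T" "compact_op K T" "\<And>\<xi>. \<xi> \<in> V ` S \<Longrightarrow> hdist K (T \<xi>) \<xi> < e"
    using assms unfolding approximable_def by meson
  have Tb: "T \<in> bounded_op K" using T(2) by (simp add: compact_op_def)
  have "hdist K' (cut T v) v < e" if v: "v \<in> S" for v
  proof -
    have vR: "v \<in> g ` R" using v S by auto
    have "hdist K' (cut T v) v = hdist K (q (T (V v))) (q (V v))"
      using vR Tb by (simp add: cut_apply hdist_K' bop_in)
    also have "\<dots> \<le> hdist K (T (V v)) (V v)" using vR Tb by (intro q_dist) (simp_all add: bop_in)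
    also have "\<dots> < e" using T(3) v by simp
    finally show ?thesis .
  qed
  then show "\<exists>T. ccp K' (cut ` N) J' P' T \<and> compact_op K' T \<and> (\<forall>\<xi>\<in>S. hdist K' (T \<xi>) \<xi> < e)"
    using ccp_cut[OF T(1)] compact_cut[OF T(2)] by blast
qed

lemma star_isomorphism_K':
  assumes \<psi>: "star_isomorphism H M K {y \<in> N. op_mult K q y = y} \<psi>"
  shows "star_isomorphism H M K' (cut ` N) (\<lambda>x. cut (\<psi> x))"
proof -
  have bij: "bij_betw \<psi> M {y \<in> N. op_mult K q y = y}"
    using \<psi> by (simp add: star_isomorphism_def)
  have \<psi>N: "\<psi> x \<in> N" and q\<psi>: "op_mult K q (\<psi> x) = \<psi> x" if "x \<in> M" for x
    using bij_betwE[OF bij] that by auto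
  have \<psi>b: "\<psi> x \<in> bounded_op K" if "x \<in> M" for x using \<psi>N[OF that] M_bop by blast
  have \<psi>R: "\<psi> x v \<in> R" if "x \<in> M" "v \<in> R" for x v using R_closed(5)[OF \<psi>N[OF that(1)] that(2)] .
  have eqI: "S = T" if "S \<in> extensional (hcarrier K')" "T \<in> extensional (hcarrier K')"
    "\<And>v. v \<in> g ` R \<Longrightarrow> S v = T v" for S T :: "'l \<Rightarrow> 'l"
    using that by (intro extensionalityI[of S "hcarrier K'" T]) auto
  have cext: "cut T \<in> extensional (hcarrier K')" for T by (simp add: cut_def)
  have cinj: "inj_on cut {y \<in> N. op_mult K q y = y}"
  proof (rule inj_onI)
    fix y z assume y: "y \<in> {y \<in> N. op_mult K q y = y}" and z: "z \<in> {y \<in> N. op_mult K q y = y}"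
      and eq: "cut y = cut z"
    \<comment> \<open>An element \<open>w = q w\<close> is recovered from its compression, because
      centrality lets both factors \<open>q\<close> be absorbed into \<open>w\<close>.\<close>
    have cy: "q (w (q x)) = w x" if "w \<in> {y \<in> N. op_mult K q y = y}" "x \<in> hcarrier K" for w x
      using that q_M[of w x] M_in[of w x] by (metis (mono_tags, lifting) mem_Collect_eq op_apply(1) q_q)
    show "y = z"
    proof (rule bop_ext)
      show "y \<in> bounded_op K" "z \<in> bounded_op K" using y z M_bop by blast+
      fix x assume x: "x \<in> hcarrier K"
      have w: "V (cut w (g (q x))) = w x" if "w \<in> {y \<in> N. op_mult K q y = y}" for w
      proof -
        have "w \<in> bounded_op K" using that M_bop by blast
        then show ?thesis using V_cut[of w "g (q x)"] x cy[OF that x] by simp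
      qed
      show "y x = z x" using w[OF y] w[OF z] eq by simp
    qed
  qed
  have "cut ` {y \<in> N. op_mult K q y = y} = cut ` N"
  proof (intro equalityI subsetI)
    fix c assume "c \<in> cut ` N"
    then obtain y where y: "y \<in> N" "c = cut y" by blast
    have "c = cut (op_mult K q y)" unfolding y(2)
      using M_in[OF y(1)] by (intro eqI cext) (simp add: cut_apply)
    moreover have "op_mult K q y \<in> {y \<in> N. op_mult K q y = y}"
      using M_closed(5)[OF q_N y(1)] M_in[OF y(1)]
      by (auto intro!: extensionalityI[OF op_extensional(1) op_extensional(1)])
    ultimately show "c \<in> cut ` {y \<in> N. op_mult K q y = y}" by blast
  qed auto
  then have "bij_betw cut {y \<in> N. op_mult K q y = y} (cut ` N)"
    using cinj by (simp add: bij_betw_def)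
  then have bij': "bij_betw (\<lambda>x. cut (\<psi> x)) M (cut ` N)"
    using bij_betw_trans[OF bij] by (simp add: comp_def)
  show ?thesis
    unfolding star_isomorphism_def
  proof (intro conjI allI ballI impI bij')
    fix x y a assume x: "x \<in> M"
    have "\<psi> (op_scale H a x) = op_scale K a (\<psi> x)" using \<psi> x by (simp add: star_isomorphism_def)
    then show "cut (\<psi> (op_scale H a x)) = op_scale K' a (cut (\<psi> x))"
      using \<psi>R[OF x] by (intro eqI cext op_extensional) (simp add: cut_apply R_closed R_q)
    assume y: "y \<in> M"
    have "\<psi> (op_add H x y) = op_add K (\<psi> x) (\<psi> y)" using \<psi> x y by (simp add: star_isomorphism_def)
    then show "cut (\<psi> (op_add H x y)) = op_add K' (cut (\<psi> x)) (cut (\<psi> y))"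
      using \<psi>R[OF x] \<psi>R[OF y] by (intro eqI cext op_extensional) (simp add: cut_apply R_closed R_q)
    have "\<psi> (op_mult H x y) = op_mult K (\<psi> x) (\<psi> y)" using \<psi> x y by (simp add: star_isomorphism_def)
    then show "cut (\<psi> (op_mult H x y)) = op_mult K' (cut (\<psi> x)) (cut (\<psi> y))"
      using \<psi>R[OF x] \<psi>R[OF y] by (intro eqI cext op_extensional) (simp add: cut_apply R_closed R_q)
    assume "is_adjoint H x y"
    then have "is_adjoint K (\<psi> x) (\<psi> y)" using \<psi> x y by (simp add: star_isomorphism_def)
    then show "is_adjoint K' (cut (\<psi> x)) (cut (\<psi> y))" by (rule cut_adjoint)
  qed
qed

end

text \<open>The common last step of both directions: \<open>K\<close> may have any type, and
  \<open>embedding\<close> supplies the injection of \<open>R\<close> into the type prescribed for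
  \<open>M\<close>.\<close>

lemma (in corner) haagerup_corner:
  fixes H :: "'h hilb"
  assumes ap: "approximable K N J P"
    and \<psi>: "star_isomorphism H M K {y \<in> N. op_mult K q y = y} \<psi>"
  shows "haagerup_approximation_property H M"
proof -
  have "bij_betw \<psi> M {y \<in> N. op_mult K q y = y}" using \<psi> by (simp add: star_isomorphism_def)
  then obtain g :: "'k \<Rightarrow> 'h sf_univ" where "inj_on g R" using embedding by blast
  then interpret transported K N J P q g by unfold_locales
  show ?thesis
    unfolding haagerup_iff_approximable
    using standard_form_K' star_isomorphism_K'[OF \<psi>] approximable_K'[OF ap] by blast
qed

section \<open>Direct sums of Hilbert spaces\<close>

locale hilbert_family =
  fixes I :: "'i set" and H :: "'i \<Rightarrow> 'h hilb"
  assumes hilbert_at: "i \<in> I \<Longrightarrow> hilbert_space (H i)"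
begin

abbreviation S where "S \<equiv> hilbert_sum I H"

lemma pre_hilbert_at: "i \<in> I \<Longrightarrow> pre_hilbert (H i)"
proof -
  assume "i \<in> I"
  then interpret hilbert_space "H i" by (rule hilbert_at)
  show ?thesis by (rule pre_hilbert_axioms)
qed

lemma S_simps:
  "hzero S = (\<lambda>i\<in>I. hzero (H i))" "hadd S = (\<lambda>f g. \<lambda>i\<in>I. hadd (H i) (f i) (g i))"
  "hscale S = (\<lambda>a f. \<lambda>i\<in>I. hscale (H i) a (f i))"
  "hinner S = (\<lambda>f g. \<Sum>\<^sub>\<infinity>i\<in>I. hinner (H i) (f i) (g i))"
  by (simp_all add: hilbert_sum_def)

lemma S_apply:
  assumes "i \<in> I"
  shows "hzero S i = hzero (H i)" "hadd S f g i = hadd (H i) (f i) (g i)"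
    "hscale S a f i = hscale (H i) a (f i)"
  using assms by (simp_all add: S_simps)

lemma S_carrier: "f \<in> hcarrier S \<longleftrightarrow> f \<in> (\<Pi>\<^sub>E i\<in>I. hcarrier (H i)) \<and> (\<lambda>i. (hnorm (H i) (f i))\<^sup>2) summable_on I"
  by (simp add: hilbert_sum_def)

lemma S_in: "\<lbrakk>f \<in> hcarrier S; i \<in> I\<rbrakk> \<Longrightarrow> f i \<in> hcarrier (H i)"
  by (auto simp: S_carrier)

lemma S_summable: "f \<in> hcarrier S \<Longrightarrow> (\<lambda>i. (hnorm (H i) (f i))\<^sup>2) summable_on I"
  by (simp add: S_carrier)

lemma S_ext: "\<lbrakk>f \<in> hcarrier S; g \<in> hcarrier S; \<And>i. i \<in> I \<Longrightarrow> f i = g i\<rbrakk> \<Longrightarrow> f = g"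
  by (auto simp: S_carrier intro: PiE_ext)

lemma S_memI:
  assumes "f \<in> extensional I" "\<And>i. i \<in> I \<Longrightarrow> f i \<in> hcarrier (H i)"
    and g: "g summable_on I" and le: "\<And>i. i \<in> I \<Longrightarrow> (hnorm (H i) (f i))\<^sup>2 \<le> g i"
  shows "f \<in> hcarrier S"
proof -
  have "(\<lambda>i. (hnorm (H i) (f i))\<^sup>2) summable_on I"
    by (rule summable_on_comparison_test[OF g le]) auto
  then show ?thesis using assms by (auto simp: S_carrier PiE_def)
qed

lemma S_add:
  assumes f: "f \<in> hcarrier S" and g: "g \<in> hcarrier S"
  shows "hadd S f g \<in> hcarrier S"
proof (rule S_memI)
  show "(\<lambda>i. 2 * (hnorm (H i) (f i))\<^sup>2 + 2 * (hnorm (H i) (g i))\<^sup>2) summable_on I"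
    using S_summable[OF f] S_summable[OF g] by (intro summable_on_add summable_on_cmult_right)
  fix i assume i: "i \<in> I"
  interpret pre_hilbert "H i" by (rule pre_hilbert_at[OF i])
  show "hadd S f g i \<in> hcarrier (H i)" using i S_in[OF f i] S_in[OF g i] by (simp add: S_simps)
  have "(hnorm (H i) (hadd (H i) (f i) (g i)))\<^sup>2 \<le> (hnorm (H i) (f i) + hnorm (H i) (g i))\<^sup>2"
    using hnorm_triangle[OF S_in[OF f i] S_in[OF g i]] S_in[OF f i] S_in[OF g i] by (intro power_mono) auto
  also have "\<dots> \<le> 2 * (hnorm (H i) (f i))\<^sup>2 + 2 * (hnorm (H i) (g i))\<^sup>2"
    using zero_le_power2[of "hnorm (H i) (f i) - hnorm (H i) (g i)"]
    unfolding power2_sum power2_diff by linarith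
  finally show "(hnorm (H i) (hadd S f g i))\<^sup>2 \<le> 2 * (hnorm (H i) (f i))\<^sup>2 + 2 * (hnorm (H i) (g i))\<^sup>2"
    using i by (simp add: S_simps)
qed (simp add: S_simps)

lemma S_scale:
  assumes f: "f \<in> hcarrier S"
  shows "hscale S a f \<in> hcarrier S"
proof (rule S_memI)
  show "(\<lambda>i. (cmod a)\<^sup>2 * (hnorm (H i) (f i))\<^sup>2) summable_on I"
    using S_summable[OF f] by (intro summable_on_cmult_right)
  fix i assume i: "i \<in> I"
  interpret pre_hilbert "H i" by (rule pre_hilbert_at[OF i])
  show "hscale S a f i \<in> hcarrier (H i)" using i S_in[OF f i] by (simp add: S_simps)
  show "(hnorm (H i) (hscale S a f i))\<^sup>2 \<le> (cmod a)\<^sup>2 * (hnorm (H i) (f i))\<^sup>2"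
    using i S_in[OF f i] by (simp add: S_simps power_mult_distrib)
qed (simp add: S_simps)

lemma S_zero: "hzero S \<in> hcarrier S"
proof (rule S_memI)
  fix i assume i: "i \<in> I"
  interpret pre_hilbert "H i" by (rule pre_hilbert_at[OF i])
  show "hzero S i \<in> hcarrier (H i)" "(hnorm (H i) (hzero S i))\<^sup>2 \<le> 0" using i by (auto simp: S_simps)
qed (simp_all add: S_simps)

lemma S_inner_summable:
  assumes f: "f \<in> hcarrier S" and g: "g \<in> hcarrier S"
  shows "(\<lambda>i. hinner (H i) (f i) (g i)) summable_on I"
proof (rule abs_summable_summable, rule summable_on_comparison_test)
  show "(\<lambda>i. (hnorm (H i) (f i))\<^sup>2 + (hnorm (H i) (g i))\<^sup>2) summable_on I"
    using S_summable[OF f] S_summable[OF g] by (intro summable_on_add)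
  fix i assume i: "i \<in> I"
  interpret pre_hilbert "H i" by (rule pre_hilbert_at[OF i])
  have "cmod (hinner (H i) (f i) (g i)) \<le> hnorm (H i) (f i) * hnorm (H i) (g i)"
    by (rule cauchy_schwarz[OF S_in[OF f i] S_in[OF g i]])
  moreover have "0 \<le> hnorm (H i) (f i) * hnorm (H i) (g i)"
    using S_in[OF f i] S_in[OF g i] by simp
  moreover have "2 * (hnorm (H i) (f i) * hnorm (H i) (g i)) \<le> (hnorm (H i) (f i))\<^sup>2 + (hnorm (H i) (g i))\<^sup>2"
    using zero_le_power2[of "hnorm (H i) (f i) - hnorm (H i) (g i)"]
    unfolding power2_diff by linarith
  ultimately show "norm (hinner (H i) (f i) (g i)) \<le> (hnorm (H i) (f i))\<^sup>2 + (hnorm (H i) (g i))\<^sup>2"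
    by linarith
qed simp

lemma S_inner_self:
  assumes f: "f \<in> hcarrier S"
  shows "hinner S f f = complex_of_real (\<Sum>\<^sub>\<infinity>i\<in>I. (hnorm (H i) (f i))\<^sup>2)"
proof -
  have "hinner S f f = (\<Sum>\<^sub>\<infinity>i\<in>I. complex_of_real ((hnorm (H i) (f i))\<^sup>2))"
    unfolding S_simps by (intro infsum_cong pre_hilbert.inner_self[OF pre_hilbert_at] S_in[OF f])
  also have "\<dots> = complex_of_real (\<Sum>\<^sub>\<infinity>i\<in>I. (hnorm (H i) (f i))\<^sup>2)"
    by (intro infsumI has_sum_of_real has_sum_infsum S_summable[OF f])
  finally show ?thesis .
qed

lemma S_norm: "f \<in> hcarrier S \<Longrightarrow> (hnorm S f)\<^sup>2 = (\<Sum>\<^sub>\<infinity>i\<in>I. (hnorm (H i) (f i))\<^sup>2)"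
  by (simp add: hnorm_def[of S] S_inner_self infsum_nonneg)

lemma pre_hilbert_S: "pre_hilbert S"
proof
  show "hzero S \<in> hcarrier S" by (rule S_zero)
next
  fix x y assume "x \<in> hcarrier S" "y \<in> hcarrier S"
  then show "hadd S x y \<in> hcarrier S" by (rule S_add)
next
  fix x a assume "x \<in> hcarrier S"
  then show "hscale S a x \<in> hcarrier S" by (rule S_scale)
next
  fix x y z a b assume x: "x \<in> hcarrier S"
  note [simp] = S_in S_zero S_add S_scale
  note p = pre_hilbert.add_ac[OF pre_hilbert_at] pre_hilbert.add_0[OF pre_hilbert_at] pre_hilbert.add_neg[OF pre_hilbert_at]
    pre_hilbert.scale_distrib[OF pre_hilbert_at] pre_hilbert.scale_add[OF pre_hilbert_at] pre_hilbert.scale_mult[OF pre_hilbert_at]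
    pre_hilbert.scale_1[OF pre_hilbert_at] pre_hilbert.scale_in[OF pre_hilbert_at] pre_hilbert.add_in[OF pre_hilbert_at]
  show "hadd S x (hzero S) = x" using x by (intro S_ext) (auto simp: S_apply p)
  show "hadd S x (hscale S (- 1) x) = hzero S" using x by (intro S_ext) (auto simp: S_apply p)
  show "hscale S (a + b) x = hadd S (hscale S a x) (hscale S b x)"
    using x by (intro S_ext) (auto simp: S_apply p)
  show "hscale S a (hscale S b x) = hscale S (a * b) x" using x by (intro S_ext) (auto simp: S_apply p)
  show "hscale S 1 x = x" using x by (intro S_ext) (auto simp: S_apply p)
  show "hinner S x x \<in> \<real>\<^sub>\<ge>\<^sub>0" using x by (simp add: S_inner_self infsum_nonneg)
  show "x = hzero S" if "hinner S x x = 0"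
  proof (rule S_ext[OF x S_zero])
    fix i assume i: "i \<in> I"
    have "(\<Sum>\<^sub>\<infinity>i\<in>I. (hnorm (H i) (x i))\<^sup>2) = 0" using that x by (simp add: S_inner_self)
    then have "(hnorm (H i) (x i))\<^sup>2 = 0"
      by (intro nonneg_infsum_le_0D[OF _ S_summable[OF x] _ i]) auto
    then show "x i = hzero S i" using i pre_hilbert.hnorm_eq_0[OF pre_hilbert_at[OF i] S_in[OF x i]] by (simp add: S_simps)
  qed
  assume y: "y \<in> hcarrier S"
  show "hadd S x y = hadd S y x"
    using x y pre_hilbert.add_com[OF pre_hilbert_at] by (intro S_ext) (simp_all add: S_apply)
  show "hscale S a (hadd S x y) = hadd S (hscale S a x) (hscale S a y)"
    using x y by (intro S_ext) (auto simp: S_apply p)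
  show "hinner S x y = cnj (hinner S y x)"
    unfolding S_simps infsum_cnj[symmetric]
    by (intro infsum_cong pre_hilbert.inner_cnj[OF pre_hilbert_at] S_in[OF x] S_in[OF y])
  show "hinner S (hscale S a x) y = a * hinner S x y"
  proof -
    have "hinner S (hscale S a x) y = (\<Sum>\<^sub>\<infinity>i\<in>I. a * hinner (H i) (x i) (y i))"
      unfolding S_simps
      by (intro infsum_cong) (simp add: pre_hilbert.inner_scaleL[OF pre_hilbert_at] S_in[OF x] S_in[OF y])
    then show ?thesis by (simp add: infsum_cmult_right' S_simps)
  qed
  assume z: "z \<in> hcarrier S"
  show "hadd S (hadd S x y) z = hadd S x (hadd S y z)"
    using x y z by (intro S_ext) (auto simp: S_apply p)
  show "hinner S (hadd S x y) z = hinner S x z + hinner S y z"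
  proof -
    have "hinner S (hadd S x y) z = (\<Sum>\<^sub>\<infinity>i\<in>I. hinner (H i) (x i) (z i) + hinner (H i) (y i) (z i))"
      unfolding S_simps
      by (intro infsum_cong) (simp add: pre_hilbert.inner_addL[OF pre_hilbert_at] S_in[OF x] S_in[OF y] S_in[OF z])
    then show ?thesis
      using infsum_add[OF S_inner_summable[OF x z] S_inner_summable[OF y z]] by (simp add: S_simps)
  qed
qed

lemma S_sub: "i \<in> I \<Longrightarrow> hsub S f g i = hsub (H i) (f i) (g i)"
  by (simp add: S_simps)

lemma S_sum_le:
  assumes f: "f \<in> hcarrier S" and F: "finite F" "F \<subseteq> I"
  shows "(\<Sum>i\<in>F. (hnorm (H i) (f i))\<^sup>2) \<le> (hnorm S f)\<^sup>2"
  unfolding S_norm[OF f] using F by (intro finite_sum_le_infsum S_summable f) auto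

lemma S_dist_sum_le:
  assumes f: "f \<in> hcarrier S" and g: "g \<in> hcarrier S" and F: "finite F" "F \<subseteq> I"
  shows "(\<Sum>i\<in>F. (hdist (H i) (f i) (g i))\<^sup>2) \<le> (hdist S f g)\<^sup>2"
proof -
  interpret pre_hilbert S by (rule pre_hilbert_S)
  have "hdist (H i) (f i) (g i) = hnorm (H i) (hsub S f g i)" if "i \<in> F" for i
    using that F S_in[OF f] S_in[OF g] S_sub[of i f g] by (auto simp: hdist_def)
  then show ?thesis
    using S_sum_le[OF _ F, of "hsub S f g"] f g by (simp add: hdist_eq)
qed

lemma S_dist_coord:
  assumes f: "f \<in> hcarrier S" and g: "g \<in> hcarrier S" and i: "i \<in> I"
  shows "hdist (H i) (f i) (g i) \<le> hdist S f g"
proof (rule power2_le_imp_le)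
  show "(hdist (H i) (f i) (g i))\<^sup>2 \<le> (hdist S f g)\<^sup>2"
    using S_dist_sum_le[OF f g, of "{i}"] i by simp
  show "0 \<le> hdist S f g" using pre_hilbert.hdist_nonneg[OF pre_hilbert_S] .
qed

text \<open>The square of the distance is the supremum of the finite partial sums, so a bound on
  these is enough. Completeness, compactness and approximation in the sum are reduced to finite sums
  in this way.\<close>

lemma S_dist_le:
  assumes f: "f \<in> hcarrier S" and g: "g \<in> hcarrier S" and b: "b \<ge> 0"
    and le: "\<And>F. \<lbrakk>finite F; F \<subseteq> I\<rbrakk> \<Longrightarrow> (\<Sum>i\<in>F. (hdist (H i) (f i) (g i))\<^sup>2) \<le> b\<^sup>2"
  shows "hdist S f g \<le> b"
proof (rule power2_le_imp_le[OF _ b])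
  interpret pre_hilbert S by (rule pre_hilbert_S)
  have h: "hsub S f g \<in> hcarrier S" using f g by simp
  have "(hnorm S (hsub S f g))\<^sup>2 \<le> b\<^sup>2"
    unfolding S_norm[OF h]
  proof (rule infsum_le_finite_sums[OF S_summable[OF h]])
    fix F assume F: "finite F" "F \<subseteq> I"
    have "hdist (H i) (f i) (g i) = hnorm (H i) (hsub S f g i)" if "i \<in> F" for i
      using that F S_in[OF f] S_in[OF g] S_sub[of i f g] by (auto simp: hdist_def)
    then show "(\<Sum>i\<in>F. (hnorm (H i) (hsub S f g i))\<^sup>2) \<le> b\<^sup>2" using le[OF F] by simp
  qed
  then show "(hdist S f g)\<^sup>2 \<le> b\<^sup>2" using f g by (simp add: hdist_eq)
qed

lemma hilbert_space_S: "hilbert_space S"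
proof (rule pre_hilbert.hilbert_spaceI[OF pre_hilbert_S])
  interpret S: pre_hilbert S by (rule pre_hilbert_S)
  fix s :: "nat \<Rightarrow> 'i \<Rightarrow> 'h" assume s: "\<And>n. s n \<in> hcarrier S"
    and cau: "\<And>e. e > 0 \<Longrightarrow> \<exists>N. \<forall>m\<ge>N. \<forall>n\<ge>N. hdist S (s m) (s n) < e"
  have "\<exists>l. l \<in> hcarrier (H i) \<and> (\<lambda>n. hdist (H i) (s n i) l) \<longlonglongrightarrow> 0" if i: "i \<in> I" for i
  proof -
    have "\<exists>N. \<forall>m\<ge>N. \<forall>n\<ge>N. hdist (H i) (s m i) (s n i) < e" if "e > 0" for e
      using cau[OF that] S_dist_coord[OF s s i] by (meson order_le_less_trans)
    then show ?thesis
      using hilbert_space.cauchy_limit[OF hilbert_at[OF i], of "\<lambda>n. s n i"] S_in[OF s i] by metis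
  qed
  then obtain l0 where l0: "\<And>i. i \<in> I \<Longrightarrow> l0 i \<in> hcarrier (H i)"
    "\<And>i. i \<in> I \<Longrightarrow> (\<lambda>n. hdist (H i) (s n i) (l0 i)) \<longlonglongrightarrow> 0" by metis
  define l where "l = restrict l0 I"
  have l: "l i \<in> hcarrier (H i)" "(\<lambda>n. hdist (H i) (s n i) (l i)) \<longlonglongrightarrow> 0" if "i \<in> I" for i
    using l0 that by (auto simp: l_def)
  \<comment> \<open>For finite \<open>F\<close> the Cauchy estimate survives the passage to the
    coordinatewise limit in the second index; the bound \<open>e\<close> does not depend on
    \<open>F\<close>.\<close>
  have bound: "(\<Sum>i\<in>F. (hdist (H i) (s m i) (l i))\<^sup>2) \<le> e\<^sup>2"
    if F: "finite F" "F \<subseteq> I" and e: "e > 0" and N: "\<forall>m\<ge>N. \<forall>n\<ge>N. hdist S (s m) (s n) < e" and m: "m \<ge> N"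
    for F e N m
  proof -
    have "(\<lambda>n. hdist (H i) (s m i) (s n i)) \<longlonglongrightarrow> hdist (H i) (s m i) (l i)" if "i \<in> F" for i
    proof (rule LIM_zero_cancel, rule Lim_null_comparison)
      have i: "i \<in> I" using that F by blast
      interpret Hi: pre_hilbert "H i" by (rule pre_hilbert_at[OF i])
      show "\<forall>\<^sub>F n in sequentially. norm (hdist (H i) (s m i) (s n i) - hdist (H i) (s m i) (l i))
          \<le> hdist (H i) (s n i) (l i)"
        using Hi.mdist_reverse_triangle[OF S_in[OF s i] S_in[OF s i] l(1)[OF i]]
        by (intro always_eventually allI)
          (metis Hi.hdist_commute Hi.mdist_reverse_triangle S_in[OF s i] l(1)[OF i] real_norm_def)
      show "(\<lambda>n. hdist (H i) (s n i) (l i)) \<longlonglongrightarrow> 0" by (rule l(2)[OF i])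
    qed
    then have "(\<lambda>n. \<Sum>i\<in>F. (hdist (H i) (s m i) (s n i))\<^sup>2) \<longlonglongrightarrow> (\<Sum>i\<in>F. (hdist (H i) (s m i) (l i))\<^sup>2)"
      by (intro tendsto_intros)
    then show ?thesis
    proof (rule LIMSEQ_le_const2)
      show "\<exists>N. \<forall>n\<ge>N. (\<Sum>i\<in>F. (hdist (H i) (s m i) (s n i))\<^sup>2) \<le> e\<^sup>2"
      proof (intro exI allI impI)
        fix n assume "n \<ge> N"
        then have "hdist S (s m) (s n) < e" using N m by blast
        then have "(hdist S (s m) (s n))\<^sup>2 \<le> e\<^sup>2" using S.hdist_nonneg by (intro power_mono) auto
        then show "(\<Sum>i\<in>F. (hdist (H i) (s m i) (s n i))\<^sup>2) \<le> e\<^sup>2"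
          using S_dist_sum_le[OF s s F, of m n] by linarith
      qed
    qed
  qed
  have lS: "l \<in> hcarrier S"
  proof -
    obtain N where N: "\<forall>m\<ge>N. \<forall>n\<ge>N. hdist S (s m) (s n) < 1" using cau[of 1] by auto
    \<comment> \<open>The coordinatewise limit is not yet known to be square summable, but by the
      bound its difference from \<open>s N\<close> is; then \<open>l = s N - d\<close> lies in the
      sum.\<close>
    define d where "d = (\<lambda>i\<in>I. hsub (H i) (s N i) (l i))"
    have dn: "hnorm (H i) (d i) = hdist (H i) (s N i) (l i)" if "i \<in> I" for i
      using that S_in[OF s that] l(1)[OF that] by (simp add: d_def hdist_def)
    have "(\<lambda>i. (hnorm (H i) (d i))\<^sup>2) summable_on I"
    proof (rule nonneg_bdd_above_summable_on)
      show "bdd_above (sum (\<lambda>i. (hnorm (H i) (d i))\<^sup>2) ` {F. F \<subseteq> I \<and> finite F})"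
      proof (rule bdd_aboveI2)
        fix F assume "F \<in> {F. F \<subseteq> I \<and> finite F}"
        then have F: "finite F" "F \<subseteq> I" by auto
        have "(\<Sum>i\<in>F. (hnorm (H i) (d i))\<^sup>2) = (\<Sum>i\<in>F. (hdist (H i) (s N i) (l i))\<^sup>2)"
          using F dn by (intro sum.cong) auto
        also have "\<dots> \<le> 1\<^sup>2" by (rule bound[OF F _ N]) auto
        finally show "(\<Sum>i\<in>F. (hnorm (H i) (d i))\<^sup>2) \<le> 1\<^sup>2" .
      qed
    qed simp
    moreover have dH: "d i \<in> hcarrier (H i)" if "i \<in> I" for i
    proof -
      interpret pre_hilbert "H i" by (rule pre_hilbert_at[OF that])
      show ?thesis using that S_in[OF s that] l(1)[OF that] by (simp add: d_def)
    qed
    ultimately have "d \<in> hcarrier S" by (auto simp: S_carrier d_def)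
    then have "hsub S (s N) d \<in> hcarrier S" using s by simp
    moreover have "hsub S (s N) d = l"
    proof (rule extensionalityI)
      fix i assume i: "i \<in> I"
      interpret pre_hilbert "H i" by (rule pre_hilbert_at[OF i])
      have "hsub (H i) (s N i) (hsub (H i) (s N i) (l i)) = l i"
        using S_in[OF s i] l(1)[OF i] by (intro inner_ext) auto
      then show "hsub S (s N) d i = l i" using i by (simp add: S_sub d_def)
    qed (auto simp: S_simps l_def)
    ultimately show ?thesis by simp
  qed
  have "(\<lambda>n. hdist S (s n) l) \<longlonglongrightarrow> 0"
  proof (rule LIMSEQ_I)
    fix r :: real assume "0 < r"
    then obtain N where N: "\<forall>m\<ge>N. \<forall>n\<ge>N. hdist S (s m) (s n) < r/2" using cau[of "r/2"] by auto
    have "norm (hdist S (s n) l - 0) < r" if "n \<ge> N" for n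
    proof -
      have "hdist S (s n) l \<le> r/2"
        using bound[OF _ _ _ N that] \<open>0 < r\<close> by (intro S_dist_le s lS) auto
      then show ?thesis using \<open>0 < r\<close> S.hdist_nonneg[of "s n" l] by simp
    qed
    then show "\<exists>no. \<forall>n\<ge>no. norm (hdist S (s n) l - 0) < r" by blast
  qed
  then show "\<exists>l\<in>hcarrier S. (\<lambda>n. hdist S (s n) l) \<longlonglongrightarrow> 0" using lS by blast
qed

sublocale S: hilbert_space S
  by (rule hilbert_space_S)

section \<open>The summands inside the direct sum\<close>

definition emb where "emb i v = (\<lambda>j\<in>I. if j = i then v else hzero (H j))"

lemma emb_in: "\<lbrakk>i \<in> I; v \<in> hcarrier (H i)\<rbrakk> \<Longrightarrow> emb i v \<in> hcarrier S"
proof (rule S_memI)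
  assume i: "i \<in> I" and v: "v \<in> hcarrier (H i)"
  show "emb i v j \<in> hcarrier (H j)" if "j \<in> I" for j
    using that i v pre_hilbert.zero_in[OF pre_hilbert_at] by (simp add: emb_def)
  show "(\<lambda>j. if j = i then (hnorm (H i) v)\<^sup>2 else 0) summable_on I"
    by (rule finite_nonzero_values_imp_summable_on)
      (auto intro: finite_subset[of _ "{i}"])
  show "(hnorm (H j) (emb i v j))\<^sup>2 \<le> (if j = i then (hnorm (H i) v)\<^sup>2 else 0)" if "j \<in> I" for j
    using that pre_hilbert.hnorm_zero[OF pre_hilbert_at] by (simp add: emb_def)
qed (simp add: emb_def)

lemma emb_apply [simp]: "i \<in> I \<Longrightarrow> emb i v i = v"
  by (simp add: emb_def)

lemma emb_inner:
  assumes i: "i \<in> I" and v: "v \<in> hcarrier (H i)" and f: "f \<in> hcarrier S"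
  shows "hinner S (emb i v) f = hinner (H i) v (f i)"
proof -
  have "hinner S (emb i v) f = (\<Sum>\<^sub>\<infinity>j\<in>{i}. hinner (H j) (emb i v j) (f j))"
    unfolding S_simps
    using i S_in[OF f] by (intro infsum_cong_neutral) (auto simp: emb_def pre_hilbert.inner_zeroL[OF pre_hilbert_at])
  then show ?thesis using i by simp
qed

lemma emb_norm: "\<lbrakk>i \<in> I; v \<in> hcarrier (H i)\<rbrakk> \<Longrightarrow> hnorm S (emb i v) = hnorm (H i) v"
  using emb_inner[of i v "emb i v"] emb_in[of i v] by (simp add: hnorm_def)

lemma S_norm_coord: "\<lbrakk>f \<in> hcarrier S; i \<in> I\<rbrakk> \<Longrightarrow> hnorm (H i) (f i) \<le> hnorm S f"
  using S_sum_le[of f "{i}"] S.hnorm_nonneg[of f] power2_le_imp_le[of "hnorm (H i) (f i)" "hnorm S f"]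
  by simp

lemma emb_add: 
  assumes "i \<in> I" "v \<in> hcarrier (H i)" "w \<in> hcarrier (H i)"
  shows "emb i (hadd (H i) v w) = hadd S (emb i v) (emb i w)"
  using assms pre_hilbert.add_0[OF pre_hilbert_at] pre_hilbert.zero_in[OF pre_hilbert_at] 
  by (intro extensionalityI[of _ I]) (auto simp: emb_def S_simps)

lemma emb_scale:
  assumes "i \<in> I" "v \<in> hcarrier (H i)"
  shows "emb i (hscale (H i) a v) = hscale S a (emb i v)"
  using assms pre_hilbert.scale_zero[OF pre_hilbert_at]
  by (intro extensionalityI[of _ I]) (auto simp: emb_def S_simps)

end

section \<open>Direct sums of von Neumann algebras and of standard forms\<close>

context hilbert_family
begin

text \<open>No linearity is built in: the same diagonal action serves for bounded families of
  operators and for the conjugate-linear involutions \<open>J i\<close>.\<close>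

definition diag :: "('i \<Rightarrow> 'h \<Rightarrow> 'h) \<Rightarrow> ('i \<Rightarrow> 'h) \<Rightarrow> 'i \<Rightarrow> 'h" where "diag x = (\<lambda>f\<in>hcarrier S. \<lambda>i\<in>I. x i (f i))"

definition bounded_family where
  "bounded_family M = {x \<in> (\<Pi>\<^sub>E i\<in>I. M i).
     \<exists>B. \<forall>i\<in>I. \<forall>v\<in>hcarrier (H i). hnorm (H i) (x i v) \<le> B * hnorm (H i) v}"

abbreviation bops where "bops \<equiv> bounded_family (\<lambda>i. bounded_op (H i))"

lemma vN_sum_eq: "vN_sum I H M = diag ` bounded_family M"
  by (simp add: vN_sum_def diag_def[abs_def] bounded_family_def)

lemma bounded_family_mono: "(\<And>i. i \<in> I \<Longrightarrow> M i \<subseteq> N i) \<Longrightarrow> bounded_family M \<subseteq> bounded_family N"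
  unfolding bounded_family_def by (auto simp: PiE_iff)

lemma bounded_family_in: "\<lbrakk>x \<in> bounded_family M; i \<in> I\<rbrakk> \<Longrightarrow> x i \<in> M i"
  by (auto simp: bounded_family_def)

lemma bounded_family_bound:
  assumes "x \<in> bounded_family M"
  obtains B where "B > 0" "\<And>i v. \<lbrakk>i \<in> I; v \<in> hcarrier (H i)\<rbrakk> \<Longrightarrow> hnorm (H i) (x i v) \<le> B * hnorm (H i) v"
proof -
  obtain B where B: "\<And>i v. \<lbrakk>i \<in> I; v \<in> hcarrier (H i)\<rbrakk> \<Longrightarrow> hnorm (H i) (x i v) \<le> B * hnorm (H i) v"
    using assms by (auto simp: bounded_family_def)
  have "hnorm (H i) (x i v) \<le> (\<bar>B\<bar> + 1) * hnorm (H i) v" if "i \<in> I" "v \<in> hcarrier (H i)" for i v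
  proof -
    have "B * hnorm (H i) v \<le> (\<bar>B\<bar> + 1) * hnorm (H i) v"
      using pre_hilbert.hnorm_nonneg[OF pre_hilbert_at[OF that(1)] that(2)] by (intro mult_right_mono) auto
    then show ?thesis using B[OF that] by linarith
  qed
  then show thesis using that[of "\<bar>B\<bar> + 1"] by simp
qed

lemma bounded_familyI:
  assumes "x \<in> extensional I" "\<And>i. i \<in> I \<Longrightarrow> x i \<in> M i"
    "\<And>i v. \<lbrakk>i \<in> I; v \<in> hcarrier (H i)\<rbrakk> \<Longrightarrow> hnorm (H i) (x i v) \<le> B * hnorm (H i) v"
  shows "x \<in> bounded_family M"
  using assms by (auto simp: bounded_family_def PiE_def)

section \<open>Diagonal operators\<close>

lemma bops_in: "\<lbrakk>x \<in> bops; i \<in> I; v \<in> hcarrier (H i)\<rbrakk> \<Longrightarrow> x i v \<in> hcarrier (H i)"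
  by (rule bop_in[OF bounded_family_in])

lemma diag_apply: "\<lbrakk>f \<in> hcarrier S; i \<in> I\<rbrakk> \<Longrightarrow> diag x f i = x i (f i)"
  by (simp add: diag_def)

lemma diag_extensional: "diag x \<in> extensional (hcarrier S)" "f \<in> hcarrier S \<Longrightarrow> diag x f \<in> extensional I"
  by (simp_all add: diag_def)

lemma diag_bounded:
  assumes x: "\<And>i v. \<lbrakk>i \<in> I; v \<in> hcarrier (H i)\<rbrakk> \<Longrightarrow> x i v \<in> hcarrier (H i)" and B: "B \<ge> 0"
    "\<And>i v. \<lbrakk>i \<in> I; v \<in> hcarrier (H i)\<rbrakk> \<Longrightarrow> hnorm (H i) (x i v) \<le> B * hnorm (H i) v"
    and f: "f \<in> hcarrier S"
  shows "diag x f \<in> hcarrier S" "hnorm S (diag x f) \<le> B * hnorm S f"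
proof -
  have le: "(hnorm (H i) (diag x f i))\<^sup>2 \<le> B\<^sup>2 * (hnorm (H i) (f i))\<^sup>2" if i: "i \<in> I" for i
  proof -
    have "(hnorm (H i) (x i (f i)))\<^sup>2 \<le> (B * hnorm (H i) (f i))\<^sup>2"
      using pre_hilbert.hnorm_nonneg[OF pre_hilbert_at[OF i] x[OF i S_in[OF f i]]] B(2)[OF i S_in[OF f i]]
      by (intro power_mono)
    then show ?thesis using diag_apply[OF f i] by (simp add: power_mult_distrib)
  qed
  have sm: "(\<lambda>i. B\<^sup>2 * (hnorm (H i) (f i))\<^sup>2) summable_on I"
    using S_summable[OF f] by (intro summable_on_cmult_right)
  show c: "diag x f \<in> hcarrier S"
  proof (rule S_memI[OF diag_extensional(2)[OF f] _ sm le])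
    show "diag x f i \<in> hcarrier (H i)" if "i \<in> I" for i
      using x[OF that S_in[OF f that]] diag_apply[OF f that, of x] by simp
  qed
  have "(hnorm S (diag x f))\<^sup>2 \<le> (\<Sum>\<^sub>\<infinity>i\<in>I. B\<^sup>2 * (hnorm (H i) (f i))\<^sup>2)"
    unfolding S_norm[OF c] by (rule infsum_mono[OF S_summable[OF c] sm le])
  also have "\<dots> = (B * hnorm S f)\<^sup>2" by (simp add: infsum_cmult_right' S_norm[OF f] power_mult_distrib)
  finally show "hnorm S (diag x f) \<le> B * hnorm S f"
    by (rule power2_le_imp_le) (use B(1) S.hnorm_nonneg[OF f] in simp)
qed

lemma diag_in: "\<lbrakk>x \<in> bops; f \<in> hcarrier S\<rbrakk> \<Longrightarrow> diag x f \<in> hcarrier S"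
  using bounded_family_bound[of x "\<lambda>i. bounded_op (H i)"] diag_bounded(1)[of x _ f] bops_in[of x]
  by (metis less_eq_real_def)

lemma diag_bop:
  assumes x: "x \<in> bops" shows "diag x \<in> bounded_op S"
proof -
  obtain B where B: "B > 0" "\<And>i v. \<lbrakk>i \<in> I; v \<in> hcarrier (H i)\<rbrakk> \<Longrightarrow> hnorm (H i) (x i v) \<le> B * hnorm (H i) v"
    using bounded_family_bound[OF x] by metis
  show ?thesis
  proof (rule bopI[where B=B])
    fix f h a assume f: "f \<in> hcarrier S"
    show "diag x f \<in> hcarrier S" using diag_in[OF x f] .
    show "hnorm S (diag x f) \<le> B * hnorm S f"
      using diag_bounded(2)[OF bops_in[OF x] _ B(2) f] B(1) by simp
    show "diag x (hscale S a f) = hscale S a (diag x f)"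
      using f diag_in[OF x] bop_scale[OF bounded_family_in[OF x]] S_in[OF f]
      by (intro S_ext) (simp_all add: diag_apply S_apply)
    assume h: "h \<in> hcarrier S"
    show "diag x (hadd S f h) = hadd S (diag x f) (diag x h)"
      using f h diag_in[OF x] bop_add[OF bounded_family_in[OF x]] S_in[OF f] S_in[OF h]
      by (intro S_ext) (simp_all add: diag_apply S_apply)
  qed (rule diag_extensional)
qed

lemma diag_emb:
  assumes x: "x \<in> bops" and i: "i \<in> I" and v: "v \<in> hcarrier (H i)"
  shows "diag x (emb i v) = emb i (x i v)"
proof (rule S_ext[OF diag_in[OF x emb_in[OF i v]] emb_in[OF i bops_in[OF x i v]]])
  fix j assume j: "j \<in> I"
  have "x j (hzero (H j)) = hzero (H j)" by (rule pre_hilbert.bop_zero[OF pre_hilbert_at[OF j] bounded_family_in[OF x j]])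
  then show "diag x (emb i v) j = emb i (x i v) j"
    using diag_apply[OF emb_in[OF i v] j, of x] j by (simp add: emb_def)
qed

lemma diag_inj:
  assumes x: "x \<in> bops" and y: "y \<in> bops" and eq: "diag x = diag y"
  shows "x = y"
proof (rule PiE_ext)
  show "x \<in> (\<Pi>\<^sub>E i\<in>I. bounded_op (H i))" "y \<in> (\<Pi>\<^sub>E i\<in>I. bounded_op (H i))"
    using x y by (auto simp: bounded_family_def)
  fix i assume i: "i \<in> I"
  show "x i = y i"
  proof (rule bop_ext[OF bounded_family_in[OF x i] bounded_family_in[OF y i]])
    fix v assume v: "v \<in> hcarrier (H i)"
    have "diag x (emb i v) i = diag y (emb i v) i" using eq by simp
    then show "x i v = y i v" using diag_emb[OF x i v] diag_emb[OF y i v] i by simp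
  qed
qed

text \<open>For \<open>y\<close> the unit of the \<open>i\<close>-th summand,
  \<open>diag (single i y)\<close> is the central projection of the sum onto that summand.\<close>

definition single where "single i y = (\<lambda>j\<in>I. if j = i then y else op_zero (H j))"

lemma single_bounded_family:
  assumes M: "\<And>j. j \<in> I \<Longrightarrow> M j \<subseteq> bounded_op (H j)" "\<And>j. j \<in> I \<Longrightarrow> op_zero (H j) \<in> M j"
    and i: "i \<in> I" and y: "y \<in> M i"
  shows "single i y \<in> bounded_family M"
proof -
  have "y \<in> bounded_op (H i)" using M i y by blast
  then obtain B where B: "B > 0" "\<And>v. v \<in> hcarrier (H i) \<Longrightarrow> hnorm (H i) (y v) \<le> B * hnorm (H i) v"
    using pre_hilbert.bop_bound[OF pre_hilbert_at[OF i]] by metis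
  show ?thesis
  proof (rule bounded_familyI[where B=B])
    show "single i y j \<in> M j" if "j \<in> I" for j using M(2) that y by (simp add: single_def)
    show "hnorm (H j) (single i y j v) \<le> B * hnorm (H j) v" if "j \<in> I" "v \<in> hcarrier (H j)" for j v
      using that B pre_hilbert.hnorm_nonneg[OF pre_hilbert_at[OF that(1)] that(2)] pre_hilbert.hnorm_zero[OF pre_hilbert_at[OF that(1)]]
      by (auto simp: single_def)
  qed (simp add: single_def)
qed

lemma single_bops: "\<lbrakk>i \<in> I; y \<in> bounded_op (H i)\<rbrakk> \<Longrightarrow> single i y \<in> bops"
  by (rule single_bounded_family) (auto intro: pre_hilbert.op_zero_bop[OF pre_hilbert_at])

lemma diag_single: 
  assumes "i \<in> I" "y \<in> bounded_op (H i)" "f \<in> hcarrier S"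
  shows "diag (single i y) f = emb i (y (f i))"
  using assms S_in[OF assms(3)]
  by (intro S_ext diag_in single_bops emb_in) (auto simp: diag_apply single_def emb_def bop_in)

lemma vN_sum_bop:
  assumes "\<And>i. i \<in> I \<Longrightarrow> M i \<subseteq> bounded_op (H i)"
  shows "bounded_family M \<subseteq> bops" "vN_sum I H M \<subseteq> bounded_op S"
proof -
  show 1: "bounded_family M \<subseteq> bops" by (rule bounded_family_mono) (rule assms)
  show "vN_sum I H M \<subseteq> bounded_op S" using 1 diag_bop by (auto simp: vN_sum_eq)
qed

lemma diag_commutant:
  assumes M: "\<And>i. i \<in> I \<Longrightarrow> M i \<subseteq> bounded_op (H i)"
    and t: "t \<in> bounded_family (\<lambda>i. commutant (H i) (M i))"
  shows "diag t \<in> commutant S (vN_sum I H M)"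
proof -
  have VM: "vN_sum I H M \<subseteq> bounded_op S" by (rule vN_sum_bop(2)) (rule M)
  have tb: "t \<in> bops" using t vN_sum_bop(1)[of "\<lambda>i. commutant (H i) (M i)", OF pre_hilbert.commutant_bop[OF pre_hilbert_at]] by blast
  show ?thesis
    unfolding S.commutant_iff[OF VM]
  proof (intro conjI ballI diag_bop tb)
    fix Y f assume "Y \<in> vN_sum I H M" and f: "f \<in> hcarrier S"
    then obtain y where y: "y \<in> bounded_family M" "Y = diag y" by (auto simp: vN_sum_eq)
    have yb: "y \<in> bops" using y vN_sum_bop(1)[of M, OF M] by blast
    have "t i (y i (f i)) = y i (t i (f i))" if i: "i \<in> I" for i
      using bounded_family_in[OF t i] bounded_family_in[OF y(1) i] S_in[OF f i]
      unfolding pre_hilbert.commutant_iff[OF pre_hilbert_at[OF i] M[OF i]] by blast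
    then show "diag t (Y f) = Y (diag t f)"
      unfolding y(2) using f tb yb by (intro S_ext) (simp_all add: diag_in diag_apply)
  qed
qed

text \<open>An operator that commutes with the central projections \<open>single i 1\<close> is diagonal.\<close>

lemma commutant_vN_sum:
  assumes M: "\<And>i. i \<in> I \<Longrightarrow> M i \<subseteq> bounded_op (H i)"
    "\<And>i. i \<in> I \<Longrightarrow> op_zero (H i) \<in> M i" "\<And>i. i \<in> I \<Longrightarrow> op_one (H i) \<in> M i"
  shows "commutant S (vN_sum I H M) = vN_sum I H (\<lambda>i. commutant (H i) (M i))"
proof (intro equalityI subsetI)
  fix T assume T: "T \<in> commutant S (vN_sum I H M)"
  have VM: "vN_sum I H M \<subseteq> bounded_op S" by (rule vN_sum_bop(2)) (rule M)
  have Tb: "T \<in> bounded_op S" using T S.commutant_bop by blast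
  obtain B where B: "B > 0" "\<And>f. f \<in> hcarrier S \<Longrightarrow> hnorm S (T f) \<le> B * hnorm S f"
    using S.bop_bound[OF Tb] by metis
  define t where "t = (\<lambda>i\<in>I. \<lambda>v\<in>hcarrier (H i). T (emb i v) i)"
  have tv: "t i v = T (emb i v) i" if "i \<in> I" "v \<in> hcarrier (H i)" for i v
    using that by (simp add: t_def)
  have TS: "T f \<in> hcarrier S" if "f \<in> hcarrier S" for f using bop_in[OF Tb that] .
  \<comment> \<open>For \<open>y\<close> the unit, this says that coordinate \<open>i\<close> of
    \<open>T f\<close> depends only on \<open>f i\<close>, so \<open>T\<close> is diagonal with
    blocks \<open>t i\<close>. For \<open>f = emb i v\<close>, it says that \<open>t i\<close>
    commutes with \<open>y\<close>.\<close>
  have comm: "T (emb i (y (f i))) = emb i (y (T f i))"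
    if i: "i \<in> I" and y: "y \<in> M i" and f: "f \<in> hcarrier S" for i y f
  proof -
    have yb: "y \<in> bounded_op (H i)" using M i y by blast
    have "diag (single i y) \<in> vN_sum I H M" using single_bounded_family[OF M(1,2) i y] by (simp add: vN_sum_eq)
    then have "T (diag (single i y) f) = diag (single i y) (T f)"
      using T f unfolding S.commutant_iff[OF VM] by blast
    then show ?thesis using diag_single[OF i yb] f TS by simp
  qed
  have t_bound: "hnorm (H i) (t i v) \<le> B * hnorm (H i) v" if i: "i \<in> I" "v \<in> hcarrier (H i)" for i v
    using S_norm_coord[OF TS[OF emb_in[OF i]] i(1)] B(2)[OF emb_in[OF i]] tv[OF i] emb_norm[OF i] by simp
  have t_ext: "t \<in> extensional I" unfolding t_def by (rule restrict_extensional)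
  have t_bop: "t i \<in> bounded_op (H i)" if i: "i \<in> I" for i
  proof (rule bopI[where B=B])
    show "t i \<in> extensional (hcarrier (H i))" using i by (simp add: t_def)
  next
    interpret pre_hilbert "H i" by (rule pre_hilbert_at[OF i])
    fix v w a assume v: "v \<in> hcarrier (H i)"
    show "t i v \<in> hcarrier (H i)" using S_in[OF TS[OF emb_in[OF i v]] i] tv[OF i v] by simp
    show "t i (hscale (H i) a v) = hscale (H i) a (t i v)"
      using i v by (simp add: tv emb_scale bop_scale[OF Tb] emb_in S_apply)
    show "hnorm (H i) (t i v) \<le> B * hnorm (H i) v" by (rule t_bound[OF i v])
    assume w: "w \<in> hcarrier (H i)"
    show "t i (hadd (H i) v w) = hadd (H i) (t i v) (t i w)"
      using i v w by (simp add: tv emb_add bop_add[OF Tb] emb_in S_apply)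
  qed
  have "t \<in> bounded_family (\<lambda>i. commutant (H i) (M i))"
  proof (rule bounded_familyI[where B=B, OF t_ext _ t_bound])
    show "t i \<in> commutant (H i) (M i)" if i: "i \<in> I" for i
      unfolding pre_hilbert.commutant_iff[OF pre_hilbert_at[OF i] M(1)[OF i]]
    proof (intro conjI ballI t_bop[OF i])
      fix y v assume y: "y \<in> M i" and v: "v \<in> hcarrier (H i)"
      have yv: "y v \<in> hcarrier (H i)" using y v M(1)[OF i] bop_in by (metis subsetD)
      have "T (emb i (y v)) i = y (T (emb i v) i)"
        using comm[OF i y emb_in[OF i v]] i by simp
      then show "t i (y v) = y (t i v)" using tv i v yv by simp
    qed
  qed
  moreover have "T = diag t"
  proof (rule extensionalityI[OF bop_extensional[OF Tb] diag_extensional(1)])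
    fix f assume f: "f \<in> hcarrier S"
    have tb: "t \<in> bops" by (rule bounded_familyI[OF t_ext t_bop t_bound])
    show "T f = diag t f"
    proof (rule S_ext[OF TS[OF f] diag_in[OF tb f]])
      fix i assume i: "i \<in> I"
      have "T (emb i (f i)) = emb i (T f i)"
        using comm[OF i M(3)[OF i] f] S_in[OF f i] S_in[OF TS[OF f] i] by simp
      then show "T f i = diag t f i" using i f S_in[OF f i] by (simp add: diag_apply tv)
    qed
  qed
  ultimately show "T \<in> vN_sum I H (\<lambda>i. commutant (H i) (M i))" by (simp add: vN_sum_eq)
next
  fix T assume "T \<in> vN_sum I H (\<lambda>i. commutant (H i) (M i))"
  then obtain t where t: "t \<in> bounded_family (\<lambda>i. commutant (H i) (M i))" "T = diag t" by (auto simp: vN_sum_eq)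
  then show "T \<in> commutant S (vN_sum I H M)" using diag_commutant[OF M(1) t(1)] by simp
qed

lemma diag_adjoint:
  assumes x: "x \<in> bops" and y: "y \<in> bops" and adj: "\<And>i. i \<in> I \<Longrightarrow> is_adjoint (H i) (x i) (y i)"
  shows "is_adjoint S (diag x) (diag y)"
  unfolding is_adjoint_def
proof (intro conjI ballI diag_bop x y)
  fix f h assume f: "f \<in> hcarrier S" and h: "h \<in> hcarrier S"
  show "hinner S (diag x f) h = hinner S f (diag y h)"
    unfolding S_simps
  proof (rule infsum_cong)
    fix i assume i: "i \<in> I"
    show "hinner (H i) (diag x f i) (h i) = hinner (H i) (f i) (diag y h i)"
      using adjoint_inner[OF adj[OF i] S_in[OF f i] S_in[OF h i]] f h i by (simp add: diag_apply)
  qed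
qed

text \<open>The commutants again contain zero and one, so the commutant formula can be applied a
  second time and the bicommutant is computed coordinatewise. Adjoints chosen in each coordinate
  obey the bound of the given family and hence form a bounded family.\<close>

lemma von_neumann_vN_sum:
  assumes vn: "\<And>i. i \<in> I \<Longrightarrow> von_neumann_algebra (H i) (M i)"
  shows "von_neumann_algebra S (vN_sum I H M)"
  unfolding von_neumann_algebra_def
proof (intro conjI ballI)
  note vn_algebra_at = vn_algebraI[OF vn]
  note Mb = vn_algebra.M_bop[OF vn_algebra_at]
  show "hilbert_space S" by (rule hilbert_space_S)
  show "vN_sum I H M \<subseteq> bounded_op S" by (rule vN_sum_bop(2)[of M, OF Mb])
  have "commutant S (commutant S (vN_sum I H M)) = commutant S (vN_sum I H (\<lambda>i. commutant (H i) (M i)))"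
    using Mb vn_algebra.M_closed(1,2)[OF vn_algebra_at] by (subst commutant_vN_sum) auto
  also have "\<dots> = vN_sum I H (\<lambda>i. commutant (H i) (commutant (H i) (M i)))"
    using pre_hilbert.commutant_closed(1,2)[OF pre_hilbert_at Mb] pre_hilbert.commutant_bop[OF pre_hilbert_at]
    by (intro commutant_vN_sum) auto
  also have "\<dots> = vN_sum I H M"
    using vn_algebra.bicommutant[OF vn_algebra_at] by (simp add: vN_sum_def cong: PiE_cong)
  finally show "commutant S (commutant S (vN_sum I H M)) = vN_sum I H M" .
  fix T assume "T \<in> vN_sum I H M"
  then obtain x where x: "x \<in> bounded_family M" "T = diag x" by (auto simp: vN_sum_eq)
  obtain B where B: "B > 0" "\<And>i v. \<lbrakk>i \<in> I; v \<in> hcarrier (H i)\<rbrakk> \<Longrightarrow> hnorm (H i) (x i v) \<le> B * hnorm (H i) v"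
    using bounded_family_bound[OF x(1)] by metis
  have "\<exists>z. z \<in> M i \<and> is_adjoint (H i) (x i) z" if "i \<in> I" for i
    using vn_algebra.adjoint_ex[OF vn_algebra_at[OF that] bounded_family_in[OF x(1) that]] by blast
  then obtain z where z: "\<And>i. i \<in> I \<Longrightarrow> z i \<in> M i" "\<And>i. i \<in> I \<Longrightarrow> is_adjoint (H i) (x i) (z i)" by metis
  have zb: "restrict z I \<in> bounded_family M"
  proof (rule bounded_familyI[where B=B])
    fix i v assume i: "i \<in> I" and v: "v \<in> hcarrier (H i)"
    show "hnorm (H i) (restrict z I i v) \<le> B * hnorm (H i) v"
      using pre_hilbert.adjoint_bound[OF pre_hilbert_at[OF i] z(2)[OF i] B(2)[OF i] v] i by simp
  qed (use z in auto)
  have "is_adjoint S (diag x) (diag (restrict z I))"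
    using x(1) zb vN_sum_bop(1)[of M, OF Mb] z(2) by (intro diag_adjoint) auto
  then show "\<exists>Y\<in>vN_sum I H M. is_adjoint S T Y" using x(2) zb by (auto simp: vN_sum_eq)
qed

end

section \<open>Direct sums of standard forms\<close>

locale std_family = hilbert_family I K for I :: "'i set" and K :: "'i \<Rightarrow> 'k hilb" +
  fixes N :: "'i \<Rightarrow> ('k \<Rightarrow> 'k) set" and J :: "'i \<Rightarrow> 'k \<Rightarrow> 'k" and P :: "'i \<Rightarrow> 'k set"
  assumes sf: "i \<in> I \<Longrightarrow> standard_form (K i) (N i) (J i) (P i)"
begin

lemma std_form_at: "i \<in> I \<Longrightarrow> std_form (K i) (N i) (J i) (P i)"
  by (rule std_formI[OF sf])

lemma vn_algebra_at: "i \<in> I \<Longrightarrow> vn_algebra (K i) (N i)"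
  by (rule vn_algebraI[OF standard_form_vn[OF sf]])

lemmas N_bop = vn_algebra.M_bop[OF vn_algebra_at]

lemma N_bops: "bounded_family N \<subseteq> bops"
  by (rule vN_sum_bop(1)[of N, OF N_bop])

definition PS where "PS = {f \<in> hcarrier S. \<forall>i\<in>I. f i \<in> P i}"

lemma J_fam: 
  "\<lbrakk>i \<in> I; v \<in> hcarrier (K i)\<rbrakk> \<Longrightarrow> J i v \<in> hcarrier (K i)"
  "\<lbrakk>i \<in> I; v \<in> hcarrier (K i)\<rbrakk> \<Longrightarrow> hnorm (K i) (J i v) = hnorm (K i) v"
  "\<lbrakk>i \<in> I; v \<in> hcarrier (K i)\<rbrakk> \<Longrightarrow> J i (J i v) = v"
  by (simp_all add: std_form.J_in[OF std_form_at] std_form.J_norm[OF std_form_at] std_form.J_J[OF std_form_at])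

lemma JS_in: "f \<in> hcarrier S \<Longrightarrow> diag J f \<in> hcarrier S"
  by (rule diag_bounded(1)[where B=1]) (simp_all add: J_fam)

lemma emb_P: "\<lbrakk>i \<in> I; v \<in> P i\<rbrakk> \<Longrightarrow> emb i v \<in> PS"
proof -
  assume i: "i \<in> I" and v: "v \<in> P i"
  have "v \<in> hcarrier (K i)" using std_form.P_sub[OF std_form_at[OF i]] v by blast
  then show ?thesis using i v emb_in std_form.hzero_P[OF std_form_at] by (auto simp: PS_def emb_def)
qed

text \<open>Pairings of vectors with coordinates in the cones are sums of nonnegative numbers. In
  the other direction, pairing with \<open>emb i v\<close> for \<open>v\<close> in
  \<open>P i\<close> isolates the \<open>i\<close>-th coordinate and places it in \<open>P i\<close>
  by self-duality there.\<close>

lemma cone_PS: "self_dual_cone S PS"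
  unfolding S.self_dual_cone_iff
proof (intro equalityI subsetI)
  fix f assume f: "f \<in> PS"
  have "hinner S f h \<in> \<real>\<^sub>\<ge>\<^sub>0" if h: "h \<in> PS" for h
  proof -
    have fS: "f \<in> hcarrier S" and hS: "h \<in> hcarrier S" using f h by (auto simp: PS_def)
    have nn: "Re (hinner (K i) (f i) (h i)) \<ge> 0" "Im (hinner (K i) (f i) (h i)) = 0" if i: "i \<in> I" for i
    proof -
      have "hinner (K i) (f i) (h i) \<in> \<real>\<^sub>\<ge>\<^sub>0"
        using std_form.P_iff[OF std_form_at[OF i], of "f i"] f h i by (auto simp: PS_def)
      then show "Re (hinner (K i) (f i) (h i)) \<ge> 0" "Im (hinner (K i) (f i) (h i)) = 0"
        by (auto simp: complex_nonneg_Reals_iff)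
    qed
    have "Re (hinner S f h) \<ge> 0"
      unfolding S_simps infsum_Re[OF S_inner_summable[OF fS hS], symmetric]
      by (intro infsum_nonneg nn)
    moreover have "Im (hinner S f h) = 0"
      unfolding S_simps infsum_Im[OF S_inner_summable[OF fS hS], symmetric]
      by (intro infsum_0 nn)
    ultimately show ?thesis by (simp add: complex_nonneg_Reals_iff)
  qed
  then show "f \<in> {\<xi> \<in> hcarrier S. \<forall>\<eta>\<in>PS. hinner S \<xi> \<eta> \<in> \<real>\<^sub>\<ge>\<^sub>0}" using f by (simp add: PS_def)
next
  fix f assume f: "f \<in> {\<xi> \<in> hcarrier S. \<forall>\<eta>\<in>PS. hinner S \<xi> \<eta> \<in> \<real>\<^sub>\<ge>\<^sub>0}"
  then have fS: "f \<in> hcarrier S" by simp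
  have "f i \<in> P i" if i: "i \<in> I" for i
  proof -
    interpret Ki: std_form "K i" "N i" "J i" "P i" by (rule std_form_at[OF i])
    have "hinner (K i) (f i) v \<in> \<real>\<^sub>\<ge>\<^sub>0" if v: "v \<in> P i" for v
    proof -
      have vK: "v \<in> hcarrier (K i)" using v Ki.P_sub by blast
      have "hinner S f (emb i v) \<in> \<real>\<^sub>\<ge>\<^sub>0" using f emb_P[OF i v] by blast
      moreover have "hinner S f (emb i v) = hinner (K i) (f i) v"
        using S.inner_cnj[OF fS emb_in[OF i vK]] emb_inner[OF i vK fS] Ki.inner_cnj[OF S_in[OF fS i] vK] by simp
      ultimately show ?thesis by simp
    qed
    then show ?thesis using Ki.P_iff[of "f i"] S_in[OF fS i] by simp
  qed
  then show "f \<in> PS" using fS by (simp add: PS_def)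
qed

lemma J_conj_diag:
  assumes x: "x \<in> bounded_family N"
  shows "J_conj S (diag J) (diag x) = diag (\<lambda>i\<in>I. J_conj (K i) (J i) (x i))"
proof (rule extensionalityI[OF _ diag_extensional(1)])
  show "J_conj S (diag J) (diag x) \<in> extensional (hcarrier S)" by (simp add: J_conj_def op_extensional)
  fix f assume f: "f \<in> hcarrier S"
  have 1: "diag x (diag J f) \<in> hcarrier S" by (rule diag_in[OF subsetD[OF N_bops x] JS_in[OF f]])
  have "J_conj S (diag J) (diag x) f = diag J (diag x (diag J f))" using f by (simp add: J_conj_def)
  also have "\<dots> = diag (\<lambda>i\<in>I. J_conj (K i) (J i) (x i)) f"
    using f 1 JS_in[OF f] S_in[OF f]
    by (intro extensionalityI[of _ I]) (simp_all add: diag_extensional diag_apply J_conj_def)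
  finally show "J_conj S (diag J) (diag x) f = diag (\<lambda>i\<in>I. J_conj (K i) (J i) (x i)) f" .
qed

lemma J_conj_bounded_family:
  assumes x: "x \<in> bounded_family N"
  shows "(\<lambda>i\<in>I. J_conj (K i) (J i) (x i)) \<in> bounded_family (\<lambda>i. commutant (K i) (N i))"
proof -
  obtain B where B: "B > 0" "\<And>i v. \<lbrakk>i \<in> I; v \<in> hcarrier (K i)\<rbrakk> \<Longrightarrow> hnorm (K i) (x i v) \<le> B * hnorm (K i) v"
    using bounded_family_bound[OF x] by metis
  show ?thesis
  proof (rule bounded_familyI[where B=B])
    fix i assume i: "i \<in> I"
    have "J_conj (K i) (J i) (x i) \<in> commutant (K i) (N i)"
      unfolding std_form.J_image[OF std_form_at[OF i], symmetric] by (rule imageI[OF bounded_family_in[OF x i]])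
    then show "(\<lambda>i\<in>I. J_conj (K i) (J i) (x i)) i \<in> commutant (K i) (N i)" using i by simp
    fix v assume v: "v \<in> hcarrier (K i)"
    have "x i (J i v) \<in> hcarrier (K i)" by (rule bops_in[OF subsetD[OF N_bops x] i J_fam(1)[OF i v]])
    then show "hnorm (K i) ((\<lambda>i\<in>I. J_conj (K i) (J i) (x i)) i v) \<le> B * hnorm (K i) v"
      using B(2)[OF i J_fam(1)[OF i v]] i v by (simp add: J_conj_def J_fam)
  qed simp
qed

lemma commutant_S: "commutant S (vN_sum I K N) = vN_sum I K (\<lambda>i. commutant (K i) (N i))"
  by (rule commutant_vN_sum[OF N_bop vn_algebra.M_closed(2,1)[OF vn_algebra_at]])

lemma J_conj_J_conj:
  assumes i: "i \<in> I" and S: "T \<in> commutant (K i) (N i)"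
  shows "J_conj (K i) (J i) (J_conj (K i) (J i) T) = T"
proof -
  interpret Ki: std_form "K i" "N i" "J i" "P i" by (rule std_form_at[OF i])
  have Sb: "T \<in> bounded_op (K i)" using S Ki.commutant_bop by blast
  show ?thesis
    using bop_in[OF Sb]
    by (intro extensionalityI[OF _ bop_extensional[OF Sb]]) (simp_all add: J_conj_def op_extensional)
qed

text \<open>Everything is checked coordinatewise. For \<open>JMJ = M'\<close> the uniform bounds
  have to be kept, which works because each \<open>J i\<close> is isometric, and the preimage of a
  family in the commutants is its own conjugate because \<open>J i\<close> is an involution.\<close>

lemma standard_form_S: "standard_form S (vN_sum I K N) (diag J) PS"
  unfolding standard_form_def
proof (intro conjI ballI cone_PS)
  show "von_neumann_algebra S (vN_sum I K N)"
    by (rule von_neumann_vN_sum[OF standard_form_vn[OF sf]])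
  show "conj_linear_involution S (diag J)"
    unfolding conj_linear_involution_def
  proof (intro conjI ballI allI)
    show "diag J \<in> hcarrier S \<rightarrow>\<^sub>E hcarrier S" using JS_in by (simp add: PiE_def diag_extensional)
    fix f h a assume f: "f \<in> hcarrier S"
    show "diag J (hscale S a f) = hscale S (cnj a) (diag J f)"
      using f std_form.J_scale[OF std_form_at S_in[OF f]] by (intro S_ext) (simp_all add: JS_in diag_apply S_apply)
    show "diag J (diag J f) = f"
      using f S_in[OF f] by (intro S_ext) (simp_all add: JS_in diag_apply J_fam)
    have "(hnorm S (diag J f))\<^sup>2 = (hnorm S f)\<^sup>2"
      unfolding S_norm[OF f] S_norm[OF JS_in[OF f]]
      using S_in[OF f] f by (intro infsum_cong) (simp add: diag_apply J_fam)
    then show "hnorm S (diag J f) = hnorm S f" using f JS_in by (simp add: power2_eq_iff_nonneg)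
    assume h: "h \<in> hcarrier S"
    show "diag J (hadd S f h) = hadd S (diag J f) (diag J h)"
      using f h std_form.J_add[OF std_form_at S_in[OF f] S_in[OF h]]
      by (intro S_ext) (simp_all add: JS_in diag_apply S_apply)
  qed
  show "J_conj S (diag J) ` vN_sum I K N = commutant S (vN_sum I K N)"
    unfolding commutant_S
  proof (intro equalityI subsetI)
    fix T assume "T \<in> J_conj S (diag J) ` vN_sum I K N"
    then obtain x where "x \<in> bounded_family N" "T = J_conj S (diag J) (diag x)" by (auto simp: vN_sum_eq)
    then show "T \<in> vN_sum I K (\<lambda>i. commutant (K i) (N i))"
      using J_conj_bounded_family J_conj_diag by (auto simp: vN_sum_eq)
  next
    fix T assume "T \<in> vN_sum I K (\<lambda>i. commutant (K i) (N i))"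
    then obtain t where t: "t \<in> bounded_family (\<lambda>i. commutant (K i) (N i))" "T = diag t" by (auto simp: vN_sum_eq)
    obtain B where B: "B > 0" "\<And>i v. \<lbrakk>i \<in> I; v \<in> hcarrier (K i)\<rbrakk> \<Longrightarrow> hnorm (K i) (t i v) \<le> B * hnorm (K i) v"
      using bounded_family_bound[OF t(1)] by metis
    have tb: "t \<in> bops" using t(1) vN_sum_bop(1)[of "\<lambda>i. commutant (K i) (N i)", OF pre_hilbert.commutant_bop[OF pre_hilbert_at]] by blast
    define x where "x = (\<lambda>i\<in>I. J_conj (K i) (J i) (t i))"
    have x: "x \<in> bounded_family N"
    proof (rule bounded_familyI[where B=B])
      fix i assume i: "i \<in> I"
      show "x i \<in> N i"
        using std_form.J_conj_commutant[OF std_form_at[OF i] bounded_family_in[OF t(1) i]] i by (simp add: x_def)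
      fix v assume v: "v \<in> hcarrier (K i)"
      show "hnorm (K i) (x i v) \<le> B * hnorm (K i) v"
        using B(2)[OF i J_fam(1)[OF i v]] bops_in[OF tb i J_fam(1)[OF i v]] i v
        by (simp add: x_def J_conj_def J_fam)
    qed (simp add: x_def)
    have "(\<lambda>i\<in>I. J_conj (K i) (J i) (x i)) = t"
    proof (rule extensionalityI)
      show "t \<in> extensional I" using tb by (auto simp: bounded_family_def PiE_def)
      show "(\<lambda>i\<in>I. J_conj (K i) (J i) (x i)) i = t i" if "i \<in> I" for i
        using J_conj_J_conj[OF that bounded_family_in[OF t(1) that]] that by (simp add: x_def)
    qed simp
    then have "T = J_conj S (diag J) (diag x)" using J_conj_diag[OF x] t(2) by simp
    then show "T \<in> J_conj S (diag J) ` vN_sum I K N" using x by (auto simp: vN_sum_eq)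
  qed
  show "diag J f = f" if f: "f \<in> PS" for f
  proof (rule S_ext)
    show "f \<in> hcarrier S" "diag J f \<in> hcarrier S" using f JS_in by (auto simp: PS_def)
    show "diag J f i = f i" if "i \<in> I" for i
      using f that std_form.J_P[OF std_form_at[OF that]] by (simp add: PS_def diag_apply)
  qed
  show "T (diag J (T (diag J f))) \<in> PS" if T: "T \<in> vN_sum I K N" and f: "f \<in> PS" for T f
  proof -
    obtain x where x: "x \<in> bounded_family N" "T = diag x" using T by (auto simp: vN_sum_eq)
    have xb: "x \<in> bops" using x N_bops by blast
    have fS: "f \<in> hcarrier S" using f by (simp add: PS_def)
    have "x i (J i (x i (J i (f i)))) \<in> P i" if i: "i \<in> I" for i
      using std_form.xJxJ_P[OF std_form_at[OF i] bounded_family_in[OF x(1) i]] f i by (simp add: PS_def)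
    then show ?thesis
      using fS diag_in[OF xb] JS_in x(2) by (simp add: PS_def diag_apply)
  qed
  show "is_adjoint S c (J_conj S (diag J) c)" if c: "c \<in> vN_sum I K N \<inter> commutant S (vN_sum I K N)" for c
  proof -
    obtain x where x: "x \<in> bounded_family N" "c = diag x" using c by (auto simp: vN_sum_eq)
    obtain t where t: "t \<in> bounded_family (\<lambda>i. commutant (K i) (N i))" "c = diag t"
      using c commutant_S by (auto simp: vN_sum_eq)
    have cb: "bounded_family (\<lambda>i. commutant (K i) (N i)) \<subseteq> bops"
      by (rule vN_sum_bop(1)[of "\<lambda>i. commutant (K i) (N i)", OF pre_hilbert.commutant_bop[OF pre_hilbert_at]])
    have xb: "x \<in> bops" "t \<in> bops" using x N_bops t cb by auto
    \<comment> \<open>The central operator is represented by a family in the algebras and by a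
      family in the commutants. Diagonal operators determine their families, so the two coincide and
      each coordinate is central.\<close>
    have "x = t" using diag_inj[OF xb] x t by simp
    then have "is_adjoint (K i) (x i) (J_conj (K i) (J i) (x i))" if i: "i \<in> I" for i
      using std_form.J_central[OF std_form_at[OF i] bounded_family_in[OF x(1) i]] bounded_family_in[OF t(1) i] by simp
    then show ?thesis
      unfolding x(2) J_conj_diag[OF x(1)]
      using J_conj_bounded_family[OF x(1)] cb xb(1) by (intro diag_adjoint) auto
  qed
qed

end

section \<open>Star isomorphisms are isometric\<close>

text \<open>\<open>D = l - a\<close> is bounded below by \<open>l - c\<close>, hence injective, and
  it is onto by the Banach fixed point theorem. Whatever commutes with \<open>a\<close> commutes
  with the inverse \<open>r\<close> too, so \<open>r\<close> lies in the bicommutant. The left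
  inverse is what is exported, as an identity in \<open>M\<close> that homomorphisms
  preserve.\<close>

lemma (in vn_algebra) resolvent:
  assumes a: "a \<in> M" and c: "\<And>v. v \<in> hcarrier H \<Longrightarrow> hnorm H (a v) \<le> c * hnorm H v" "0 \<le> c" "c < l"
  obtains r where "r \<in> M"
    "\<And>v. v \<in> hcarrier H \<Longrightarrow> r (hsub H (hscale H (complex_of_real l) v) (a v)) = v"
proof -
  have l: "l > 0" using c by simp
  have ab: "a \<in> bounded_op H" using a M_bop by blast
  note aH [simp] = M_in[OF a]
  define D where "D = (\<lambda>v. hsub H (hscale H (complex_of_real l) v) (a v))"
  have DH [simp]: "D v \<in> hcarrier H" if "v \<in> hcarrier H" for v using that by (simp add: D_def)
  have Dadd: "D (hadd H v w) = hadd H (D v) (D w)" if "v \<in> hcarrier H" "w \<in> hcarrier H" for v w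
    unfolding D_def using that by (intro inner_ext) (auto simp: bop_add[OF ab] algebra_simps)
  have Dscale: "D (hscale H b v) = hscale H b (D v)" if "v \<in> hcarrier H" for v b
    unfolding D_def using that by (intro inner_ext) (auto simp: bop_scale[OF ab] algebra_simps)
  have below: "(l - c) * hnorm H v \<le> hnorm H (D v)" if v: "v \<in> hcarrier H" for v
  proof -
    have "hscale H (complex_of_real l) v = hadd H (D v) (a v)"
      unfolding D_def using v by (intro inner_ext) auto
    then have "hnorm H (hscale H (complex_of_real l) v) \<le> hnorm H (D v) + hnorm H (a v)"
      using hnorm_triangle[of "D v" "a v"] v by simp
    then show ?thesis using v c(1)[OF v] l by (simp add: algebra_simps)
  qed
  have uniq: "v = w" if v: "v \<in> hcarrier H" and w: "w \<in> hcarrier H" and eq: "D v = D w" for v w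
  proof -
    have "D (hsub H v w) = hsub H (D v) (D w)" using v w by (simp add: Dadd Dscale)
    then have "hnorm H (D (hsub H v w)) = 0" using eq w by (simp add: add_neg)
    then have "(l - c) * hnorm H (hsub H v w) \<le> 0" using below[of "hsub H v w"] v w by simp
    moreover have "l - c > 0" using c by simp
    ultimately have "hnorm H (hsub H v w) \<le> 0" by (simp add: mult_le_0_iff)
    then have "hnorm H (hsub H v w) = 0" by (rule antisym[OF _ hnorm_nonneg[OF add_in[OF v scale_in[OF w]]]])
    then have "hdist H v w = 0" using v w by (simp add: hdist_eq)
    then show ?thesis using v w zero by blast
  qed
  have ex: "\<exists>v. v \<in> hcarrier H \<and> D v = u" if u: "u \<in> hcarrier H" for u
  proof -
    \<comment> \<open>Its fixed points are the solutions \<open>v\<close> of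
      \<open>l v - a v = u\<close>, and it contracts distances by the factor
      \<open>c / l < 1\<close>.\<close>
    define G where "G = (\<lambda>v. hscale H (complex_of_real (1/l)) (hadd H u (a v)))"
    have "G \<in> hcarrier H \<rightarrow> hcarrier H" using u by (auto simp: G_def)
    moreover have "hdist H (G v) (G w) \<le> c / l * hdist H v w" if "v \<in> hcarrier H" "w \<in> hcarrier H" for v w
    proof -
      have "hdist H (G v) (G w) = 1 / l * hdist H (hadd H u (a v)) (hadd H u (a w))"
        unfolding G_def using u that l by (subst hdist_scale) (auto simp: norm_divide)
      also have "\<dots> \<le> 1 / l * (hdist H u u + hdist H (a v) (a w))"
        using l u that by (intro mult_left_mono hdist_add) auto
      also have "\<dots> \<le> 1 / l * (c * hdist H v w)"
        using l u hdist_bop[OF ab c(1) that] by (intro mult_left_mono) auto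
      finally show ?thesis by simp
    qed
    moreover have "c / l < 1" using c l by simp
    moreover have "hcarrier H \<noteq> {}" using zero_in by blast
    ultimately obtain v where v: "v \<in> hcarrier H" "G v = v"
      using Banach_fixedpoint_thm[OF complete, of G "c / l"] by metis
    have "hscale H (complex_of_real l) (G v) = hadd H u (a v)"
      unfolding G_def using u v l by (simp add: scale_mult scale_1)
    then have "D v = hsub H (hadd H u (a v)) (a v)" using v by (simp add: D_def)
    also have "\<dots> = u" using u v by (intro inner_ext) auto
    finally show ?thesis using v by blast
  qed
  define r where "r = (\<lambda>u\<in>hcarrier H. SOME v. v \<in> hcarrier H \<and> D v = u)"
  have r: "r u \<in> hcarrier H" "D (r u) = u" if "u \<in> hcarrier H" for u
    using someI_ex[OF ex[OF that]] that by (auto simp: r_def)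
  have rI: "r u = v" if "v \<in> hcarrier H" "D v = u" for u v
    using uniq[OF r(1) that(1)] r(2) that by auto
  have rb: "r \<in> bounded_op H"
  proof (rule bopI[where B="1 / (l - c)"])
    fix u w b assume u: "u \<in> hcarrier H"
    show "r u \<in> hcarrier H" by (rule r(1)[OF u])
    show "r (hscale H b u) = hscale H b (r u)" using r[OF u] by (intro rI) (auto simp: Dscale)
    show "hnorm H (r u) \<le> 1 / (l - c) * hnorm H u"
      using below[OF r(1)[OF u]] r(2)[OF u] c(3) by (simp add: field_simps)
    assume w: "w \<in> hcarrier H"
    show "r (hadd H u w) = hadd H (r u) (r w)" using r[OF u] r[OF w] by (intro rI) (auto simp: Dadd)
  qed (simp add: r_def)
  have "r \<in> M"
  proof (rule M_memI[OF rb])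
    fix S u assume S: "S \<in> commutant H M" and u: "u \<in> hcarrier H"
    have Sb: "S \<in> bounded_op H" using S commutant_bop by blast
    have "D (S (r u)) = S (D (r u))"
      unfolding D_def using r(1)[OF u] bop_in[OF Sb] commutantD[OF S a]
      by (simp add: bop_add[OF Sb] bop_scale[OF Sb])
    then show "r (S u) = S (r u)" using r[OF u] bop_in[OF Sb] by (intro rI) auto
  qed
  moreover have "r (D v) = v" if "v \<in> hcarrier H" for v using rI[OF that] by simp
  ultimately show thesis using that unfolding D_def by blast
qed

section \<open>Norm bounds along star isomorphisms\<close>

locale star_iso = A: vn_algebra H M + B: vn_algebra K N for H :: "'h hilb" and M and K :: "'k hilb" and N +
  fixes \<phi> assumes iso: "star_isomorphism H M K N \<phi>"
begin

lemma bij: "bij_betw \<phi> M N"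
  using iso by (simp add: star_isomorphism_def)

lemma phi_in: "x \<in> M \<Longrightarrow> \<phi> x \<in> N"
  using bij bij_betwE by blast

lemma phi_hom:
  "\<lbrakk>x \<in> M; y \<in> M\<rbrakk> \<Longrightarrow> \<phi> (op_add H x y) = op_add K (\<phi> x) (\<phi> y)"
  "x \<in> M \<Longrightarrow> \<phi> (op_scale H a x) = op_scale K a (\<phi> x)"
  "\<lbrakk>x \<in> M; y \<in> M\<rbrakk> \<Longrightarrow> \<phi> (op_mult H x y) = op_mult K (\<phi> x) (\<phi> y)"
  "\<lbrakk>x \<in> M; y \<in> M; is_adjoint H x y\<rbrakk> \<Longrightarrow> is_adjoint K (\<phi> x) (\<phi> y)"
  using iso by (auto simp: star_isomorphism_def)

text \<open>By surjectivity the unit of \<open>N\<close> is \<open>\<phi> u\<close> for some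
  \<open>u\<close>; then \<open>\<phi> 1 = \<phi> 1 \<phi> u = \<phi> u\<close>.\<close>

lemma phi_one: "\<phi> (op_one H) = op_one K"
proof -
  obtain u where u: "u \<in> M" "\<phi> u = op_one K"
    using bij B.M_closed(1) unfolding bij_betw_def by (metis imageE)
  have ext: "u \<in> extensional (hcarrier H)" "\<phi> (op_one H) \<in> extensional (hcarrier K)"
    using bop_extensional A.M_bop B.M_bop u(1) phi_in[OF A.M_closed(1)] by blast+
  have "op_mult H (op_one H) u = u"
    using A.M_in[OF u(1)] by (intro extensionalityI[OF op_extensional(1) ext(1)]) simp
  then have "op_mult K (\<phi> (op_one H)) (op_one K) = op_one K"
    using phi_hom(3)[OF A.M_closed(1) u(1)] u(2) by simp
  moreover have "op_mult K (\<phi> (op_one H)) (op_one K) = \<phi> (op_one H)"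
    by (intro extensionalityI[OF op_extensional(1) ext(2)]) simp
  ultimately show ?thesis by simp
qed

text \<open>With \<open>y = \<phi> x\<close>, let \<open>m\<close> be the least number above \<open>B\<^sup>2\<close> with \<open>y* y \<le> m\<close>. If \<open>m > B\<^sup>2\<close>, then
  \<open>m - x* x\<close> is invertible in \<open>M\<close>, so \<open>m - y* y\<close> is bounded below, and \<open>m\<close> could be decreased.\<close>

lemma contractive:
  assumes x: "x \<in> M" and B: "B \<ge> 0" "\<And>v. v \<in> hcarrier H \<Longrightarrow> hnorm H (x v) \<le> B * hnorm H v"
    and w: "w \<in> hcarrier K"
  shows "hnorm K (\<phi> x w) \<le> B * hnorm K w"
proof -
  obtain z where z: "z \<in> M" "is_adjoint H x z" using A.adjoint_ex[OF x] by blast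
  define y where "y = \<phi> x"
  have yN: "y \<in> N" and zN: "\<phi> z \<in> N" and adj: "is_adjoint K y (\<phi> z)"
    unfolding y_def using phi_in x z phi_hom(4)[OF x z] by auto
  note yK [simp] = B.M_in[OF yN]
  note zK [simp] = B.M_in[OF zN]
  \<comment> \<open>The upper bounds of \<open>y* y\<close>, truncated below at \<open>B^2\<close>.
    The truncation gives the infimum a lower bound, and the goal becomes that the infimum equals
    \<open>B^2\<close>.\<close>
  define A where "A = {m. B\<^sup>2 \<le> m \<and> (\<forall>w\<in>hcarrier K. (hnorm K (y w))\<^sup>2 \<le> m * (hnorm K w)\<^sup>2)}"
  have bdd: "bdd_below A" by (rule bdd_belowI[of _ "B\<^sup>2"]) (simp add: A_def)
  have ne: "A \<noteq> {}"
  proof -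
    obtain C where C: "C > 0" "\<And>w. w \<in> hcarrier K \<Longrightarrow> hnorm K (y w) \<le> C * hnorm K w"
      using B.bop_bound[of y] yN B.M_bop by (metis subsetD)
    have "(hnorm K (y w))\<^sup>2 \<le> max (B\<^sup>2) (C\<^sup>2) * (hnorm K w)\<^sup>2" if "w \<in> hcarrier K" for w
    proof -
      have "(hnorm K (y w))\<^sup>2 \<le> (C * hnorm K w)\<^sup>2" using C(2)[OF that] that by (intro power_mono) auto
      also have "\<dots> = C\<^sup>2 * (hnorm K w)\<^sup>2" by (rule power_mult_distrib)
      also have "\<dots> \<le> max (B\<^sup>2) (C\<^sup>2) * (hnorm K w)\<^sup>2" by (intro mult_right_mono) auto
      finally show ?thesis .
    qed
    then have "max (B\<^sup>2) (C\<^sup>2) \<in> A" by (simp add: A_def)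
    then show ?thesis by blast
  qed
  define m where "m = Inf A"
  have mB: "B\<^sup>2 \<le> m" unfolding m_def by (rule cInf_greatest[OF ne]) (simp add: A_def)
  have my: "(hnorm K (y w))\<^sup>2 \<le> m * (hnorm K w)\<^sup>2" if w: "w \<in> hcarrier K" for w
  proof (cases "hnorm K w = 0")
    case True
    then show ?thesis using ne w by (auto simp: A_def)
  next
    case False
    have "(hnorm K (y w))\<^sup>2 / (hnorm K w)\<^sup>2 \<le> m"
      unfolding m_def using w False by (intro cInf_greatest[OF ne]) (simp add: A_def pos_divide_le_eq)
    then show ?thesis using False by (simp add: pos_divide_le_eq)
  qed
  have "m = B\<^sup>2"
  proof (rule ccontr)
    assume "m \<noteq> B\<^sup>2"
    then have mB': "B\<^sup>2 < m" using mB by simp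
    have m: "m > 0" using mB' zero_le_power2[of B] by linarith
    have zx: "op_mult H z x \<in> M" using A.M_closed(5) z x by blast
    have bound: "hnorm H (op_mult H z x v) \<le> B\<^sup>2 * hnorm H v" if v: "v \<in> hcarrier H" for v
    proof -
      have "hnorm H (z (x v)) \<le> B * hnorm H (x v)"
        by (rule A.adjoint_bound[OF z(2) B(2) A.M_in[OF x v]])
      also have "\<dots> \<le> B * (B * hnorm H v)" by (rule mult_left_mono[OF B(2)[OF v] B(1)])
      finally show ?thesis using v by (simp add: power2_eq_square mult.assoc)
    qed
    obtain r where r: "r \<in> M" "\<And>v. v \<in> hcarrier H \<Longrightarrow>
        r (hsub H (hscale H (complex_of_real m) v) (op_mult H z x v)) = v"
      using A.resolvent[OF zx bound _ mB'] by auto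
    define D where "D = op_add H (op_scale H (complex_of_real m) (op_one H)) (op_scale H (-1) (op_mult H z x))"
    have D: "D \<in> M" unfolding D_def using zx A.M_closed by blast
    \<comment> \<open>Invertibility is an algebraic identity in \<open>M\<close>, so it is carried
      to \<open>K\<close> by \<open>\<phi>\<close>. A bound for \<open>\<phi> r\<close> then bounds
      \<open>\<phi> D = m - y* y\<close> from below.\<close>
    have "op_mult H r D = op_one H"
      using r(2) by (intro extensionalityI[OF op_extensional(1) op_extensional(4)]) (simp add: D_def)
    then have "op_mult K (\<phi> r) (\<phi> D) = op_one K"
      using phi_hom(3)[OF r(1) D] phi_one by simp
    then have rD: "\<phi> r (\<phi> D w) = w" if "w \<in> hcarrier K" for w
      using that by (metis op_apply(1,4))
    have \<phi>D: "\<phi> D w = hsub K (hscale K (complex_of_real m) w) (\<phi> z (y w))" if "w \<in> hcarrier K" for w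
      unfolding D_def using that zx z x A.M_closed(1,4) phi_hom(1-3) phi_one by (simp add: y_def)
    obtain C where C: "C > 0" "\<And>w. w \<in> hcarrier K \<Longrightarrow> hnorm K (\<phi> r w) \<le> C * hnorm K w"
      using B.bop_bound[of "\<phi> r"] phi_in[OF r(1)] B.M_bop by (metis subsetD)
    \<comment> \<open>This comes from \<open>|w|^2 \<le> C^2 |(m - y* y) w|^2 \<le> C^2 m (m |w|^2 -
      |y w|^2)\<close>, where the second inequality uses \<open>y* y \<le> m\<close>. Solving for
      \<open>|y w|^2\<close> shows that \<open>m - d\<close> is also an upper bound.\<close>
    define d where "d = 1 / (C\<^sup>2 * m)"
    have d: "d > 0" using C(1) m by (simp add: d_def)
    have "(hnorm K (y w))\<^sup>2 \<le> (m - d) * (hnorm K w)\<^sup>2" if w: "w \<in> hcarrier K" for w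
    proof -
      have sq: "hnorm K (y u) \<le> sqrt m * hnorm K u" if "u \<in> hcarrier K" for u
        using my[OF that] m that by (intro power2_le_imp_le[of "hnorm K (y u)"]) (simp_all add: power_mult_distrib)
      have "hnorm K (\<phi> z (y w)) \<le> sqrt m * hnorm K (y w)"
        using w by (intro B.adjoint_bound[OF adj sq]) auto
      then have "(hnorm K (\<phi> z (y w)))\<^sup>2 \<le> (sqrt m * hnorm K (y w))\<^sup>2" using w by (intro power_mono) auto
      then have zy: "(hnorm K (\<phi> z (y w)))\<^sup>2 \<le> m * (hnorm K (y w))\<^sup>2"
        using m by (simp add: power_mult_distrib)
      have "hinner K w (\<phi> z (y w)) = complex_of_real ((hnorm K (y w))\<^sup>2)"
        using adjoint_inner[OF adj w, of "y w"] w by (simp add: B.inner_self)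
      then have "(hnorm K (\<phi> D w))\<^sup>2 = m\<^sup>2 * (hnorm K w)\<^sup>2 - 2 * m * (hnorm K (y w))\<^sup>2 + (hnorm K (\<phi> z (y w)))\<^sup>2"
        using w by (simp add: \<phi>D B.hnorm_add_sq power_mult_distrib)
      also have "\<dots> \<le> m * (m * (hnorm K w)\<^sup>2 - (hnorm K (y w))\<^sup>2)"
        using zy by (simp add: algebra_simps power2_eq_square)
      finally have 1: "(hnorm K (\<phi> D w))\<^sup>2 \<le> m * (m * (hnorm K w)\<^sup>2 - (hnorm K (y w))\<^sup>2)" .
      have DwK: "\<phi> D w \<in> hcarrier K" using B.M_in[OF phi_in[OF D] w] .
      have "hnorm K w \<le> C * hnorm K (\<phi> D w)" using C(2)[OF DwK] rD[OF w] by simp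
      then have "(hnorm K w)\<^sup>2 \<le> (C * hnorm K (\<phi> D w))\<^sup>2" using w by (intro power_mono) auto
      also have "\<dots> \<le> C\<^sup>2 * (m * (m * (hnorm K w)\<^sup>2 - (hnorm K (y w))\<^sup>2))"
        unfolding power_mult_distrib by (rule mult_left_mono[OF 1]) simp
      finally have "d * (hnorm K w)\<^sup>2 \<le> m * (hnorm K w)\<^sup>2 - (hnorm K (y w))\<^sup>2"
        using C(1) m by (simp add: d_def field_simps)
      then show ?thesis by (simp add: algebra_simps)
    qed
    then have "(hnorm K (y w))\<^sup>2 \<le> max (B\<^sup>2) (m - d) * (hnorm K w)\<^sup>2" if "w \<in> hcarrier K" for w
      using that mult_right_mono[of "m - d" "max (B\<^sup>2) (m - d)" "(hnorm K w)\<^sup>2"] by fastforce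
    then have "max (B\<^sup>2) (m - d) \<in> A" by (simp add: A_def)
    then have "m \<le> max (B\<^sup>2) (m - d)" unfolding m_def using bdd by (rule cInf_lower)
    then show False using mB' d by simp
  qed
  then have "(hnorm K (y w))\<^sup>2 \<le> (B * hnorm K w)\<^sup>2" using my[OF w] by (simp add: power_mult_distrib)
  then show ?thesis unfolding y_def[symmetric] by (rule power2_le_imp_le) (use B(1) w in simp)
qed

text \<open>Makes the norm estimate available in both directions. For the adjoint clause, the
  adjoint \<open>z\<close> of the preimage of \<open>x\<close> exists in \<open>M\<close>; its image
  is an adjoint of \<open>x\<close>, hence equal to \<open>y\<close> by uniqueness.\<close>

lemma star_iso_inv: "star_iso K N H M (inv_into M \<phi>)"
proof unfold_locales
  define \<psi> where "\<psi> = inv_into M \<phi>"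
  have \<psi>M: "\<psi> y \<in> M" and \<phi>\<psi>: "\<phi> (\<psi> y) = y" if "y \<in> N" for y
    using that bij unfolding \<psi>_def bij_betw_def by (auto simp: inv_into_into f_inv_into_f)
  have \<psi>\<phi>: "\<psi> (\<phi> x) = x" if "x \<in> M" for x
    using that bij unfolding \<psi>_def bij_betw_def by (simp add: inv_into_f_f)
  show "star_isomorphism K N H M (inv_into M \<phi>)"
    unfolding star_isomorphism_def \<psi>_def[symmetric]
  proof (intro conjI allI ballI impI)
    show "bij_betw \<psi> N M" unfolding \<psi>_def by (rule bij_betw_inv_into[OF bij])
    fix x y a assume x: "x \<in> N"
    note mx = \<psi>M[OF x]
    show "\<psi> (op_scale K a x) = op_scale H a (\<psi> x)"
      using \<psi>\<phi>[OF A.M_closed(4)[OF mx]] phi_hom(2)[OF mx] \<phi>\<psi>[OF x] by simp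
    assume y: "y \<in> N"
    note my = \<psi>M[OF y]
    show "\<psi> (op_add K x y) = op_add H (\<psi> x) (\<psi> y)"
      using \<psi>\<phi>[OF A.M_closed(3)[OF mx my]] phi_hom(1)[OF mx my] \<phi>\<psi>[OF x] \<phi>\<psi>[OF y] by simp
    show "\<psi> (op_mult K x y) = op_mult H (\<psi> x) (\<psi> y)"
      using \<psi>\<phi>[OF A.M_closed(5)[OF mx my]] phi_hom(3)[OF mx my] \<phi>\<psi>[OF x] \<phi>\<psi>[OF y] by simp
    assume adj: "is_adjoint K x y"
    obtain z where z: "z \<in> M" "is_adjoint H (\<psi> x) z" using A.adjoint_ex[OF mx] by blast
    have "is_adjoint K x (\<phi> z)" using phi_hom(4)[OF mx z] \<phi>\<psi>[OF x] by simp
    then have "y = \<phi> z" using B.adjoint_unique[OF adj] by blast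
    then show "is_adjoint H (\<psi> x) (\<psi> y)" using \<psi>\<phi>[OF z(1)] z(2) by simp
  qed
qed

end

section \<open>Approximation in direct sums\<close>

text \<open>Justifies the tolerance \<open>e / (2 * (card F + 1))\<close> per coordinate: the
  squared errors over \<open>F\<close> add up to at most \<open>(e/2)^2\<close>. The added one
  avoids a division by zero for empty \<open>F\<close>.\<close>

lemma card_mult_le:
  fixes e :: real
  shows "real c * (e / (2 * (real c + 1)))\<^sup>2 \<le> (e / 2)\<^sup>2"
proof -
  have "real c * (e / (2 * (real c + 1)))\<^sup>2 \<le> (real c + 1)\<^sup>2 * (e / (2 * (real c + 1)))\<^sup>2"
    by (intro mult_right_mono) (simp_all add: power2_eq_square algebra_simps)
  also have "\<dots> = ((real c + 1) * (e / (2 * (real c + 1))))\<^sup>2" by (rule power_mult_distrib[symmetric])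
  also have "(real c + 1) * (e / (2 * (real c + 1))) = e / 2" by (simp add: field_simps)
  finally show ?thesis .
qed

text \<open>Needed for the coordinates outside the finite set of summands, where the approximant is
  the zero operator.\<close>

lemma (in std_form) zero_matrix_cone: "(\<lambda>i j. hzero H) \<in> matrix_cone H M J P n"
proof -
  have J0: "J (hzero H) = hzero H" using J_scale[of "hzero H" 0] by (simp add: scale_zero scale_0)
  have x0: "x (hzero H) = hzero H" if "x \<in> M" for x using bop_zero that M_bop by blast
  have h0: "hsum H (\<lambda>i. hzero H) m = hzero H" for m by (induction m) (simp_all add: add_0)
  have "hsum H (\<lambda>i. hsum H (\<lambda>j. x i (J (x j (J (hzero H))))) n) n = hzero H" if x: "\<forall>i<n. x i \<in> M" for x
  proof -
    have xk: "x k (hzero H) = hzero H" if "k < n" for k using x0[of "x k"] x that by simp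
    have "hsum H (\<lambda>j. x i (J (x j (J (hzero H))))) n = hsum H (\<lambda>j. hzero H) n" if "i < n" for i
      using that xk J0 by (intro hsum_cong) simp
    then have "hsum H (\<lambda>i. hsum H (\<lambda>j. x i (J (x j (J (hzero H))))) n) n = hsum H (\<lambda>i. hzero H) n"
      using h0 by (intro hsum_cong) simp
    then show ?thesis using h0 by simp
  qed
  then show ?thesis using hzero_P by (simp add: matrix_cone_def)
qed

context std_family
begin

lemma S_hsum: "i \<in> I \<Longrightarrow> hsum S f n i = hsum (K i) (\<lambda>k. f k i) n"
  by (induction n) (simp_all add: S_apply)

text \<open>The algebra and the involution act coordinatewise, so positivity in the sum is
  positivity in every coordinate. To test a single coordinate, arbitrary elements of
  \<open>N i\<close> are extended by zero to bounded families with \<open>single\<close>.\<close>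

lemma matrix_cone_S:
  "\<xi> \<in> matrix_cone S (vN_sum I K N) (diag J) PS n \<longleftrightarrow>
    (\<forall>k<n. \<forall>l<n. \<xi> k l \<in> hcarrier S) \<and>
    (\<forall>i\<in>I. (\<lambda>k l. \<xi> k l i) \<in> matrix_cone (K i) (N i) (J i) (P i) n)"
proof (cases "\<forall>k<n. \<forall>l<n. \<xi> k l \<in> hcarrier S")
  case True
  have coord: "diag x (diag J (diag y (diag J f))) i = x i (J i (y i (J i (f i))))"
    "diag x (diag J (diag y (diag J f))) \<in> hcarrier S"
    if "x \<in> bounded_family N" "y \<in> bounded_family N" "f \<in> hcarrier S" "i \<in> I" for x y f i
    using that N_bops by (simp_all add: subset_iff diag_apply diag_in JS_in)
  have sumS: "hsum S (\<lambda>k. hsum S (\<lambda>l. diag (x k) (diag J (diag (x l) (diag J (\<xi> k l))))) n) n \<in> hcarrier S"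
    if "\<forall>k<n. x k \<in> bounded_family N" for x
    using that True N_bops by (intro S.hsum_in diag_in JS_in) (auto simp: subset_iff)
  have sumi: "hsum S (\<lambda>k. hsum S (\<lambda>l. diag (x k) (diag J (diag (x l) (diag J (\<xi> k l))))) n) n i
      = hsum (K i) (\<lambda>k. hsum (K i) (\<lambda>l. x k i (J i (x l i (J i (\<xi> k l i))))) n) n"
    if x: "\<forall>k<n. x k \<in> bounded_family N" and i: "i \<in> I" for x i
    unfolding S_hsum[OF i] using x True i coord(1) by (intro hsum_cong) simp
  have "(\<forall>x. (\<forall>k<n. x k \<in> vN_sum I K N) \<longrightarrow>
       hsum S (\<lambda>k. hsum S (\<lambda>l. x k (diag J (x l (diag J (\<xi> k l))))) n) n \<in> PS)
     \<longleftrightarrow> (\<forall>i\<in>I. \<forall>x. (\<forall>k<n. x k \<in> N i) \<longrightarrow>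
       hsum (K i) (\<lambda>k. hsum (K i) (\<lambda>l. x k (J i (x l (J i (\<xi> k l i))))) n) n \<in> P i)" (is "?A \<longleftrightarrow> ?B")
  proof
    assume A: ?A
    show ?B
    proof (intro ballI allI impI)
      fix i x assume i: "i \<in> I" and x: "\<forall>k<n. x k \<in> N i"
      define X where "X = (\<lambda>k. single i (x k))"
      have X: "\<forall>k<n. X k \<in> bounded_family N"
        unfolding X_def using x i N_bop vn_algebra.M_closed(2)[OF vn_algebra_at] by (auto intro!: single_bounded_family)
      then have "\<forall>k<n. diag (X k) \<in> vN_sum I K N" by (simp add: vN_sum_eq)
      then have "hsum S (\<lambda>k. hsum S (\<lambda>l. diag (X k) (diag J (diag (X l) (diag J (\<xi> k l))))) n) n \<in> PS"
        using A[rule_format, of "\<lambda>k. diag (X k)"] by simp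
      then have "hsum (K i) (\<lambda>k. hsum (K i) (\<lambda>l. X k i (J i (X l i (J i (\<xi> k l i))))) n) n \<in> P i"
        using sumi[OF X i] i by (auto simp: PS_def)
      then show "hsum (K i) (\<lambda>k. hsum (K i) (\<lambda>l. x k (J i (x l (J i (\<xi> k l i))))) n) n \<in> P i"
        using i by (simp add: X_def single_def)
    qed
  next
    assume B: ?B
    show ?A
    proof (intro allI impI)
      fix X assume "\<forall>k<n. X k \<in> vN_sum I K N"
      then have "\<forall>k. \<exists>x. k < n \<longrightarrow> x \<in> bounded_family N \<and> X k = diag x" by (auto simp: vN_sum_eq)
      then obtain x where x: "\<forall>k<n. x k \<in> bounded_family N" "\<And>k. k < n \<Longrightarrow> X k = diag (x k)" by metis
      have "hsum S (\<lambda>k. hsum S (\<lambda>l. X k (diag J (X l (diag J (\<xi> k l))))) n) n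
          = hsum S (\<lambda>k. hsum S (\<lambda>l. diag (x k) (diag J (diag (x l) (diag J (\<xi> k l))))) n) n"
        using x(2) by (intro hsum_cong) simp
      moreover have "hsum S (\<lambda>k. hsum S (\<lambda>l. diag (x k) (diag J (diag (x l) (diag J (\<xi> k l))))) n) n i \<in> P i"
        if i: "i \<in> I" for i
        unfolding sumi[OF x(1) i] using B[rule_format, of i "\<lambda>k. x k i"] x(1) i bounded_family_in by blast
      ultimately show "hsum S (\<lambda>k. hsum S (\<lambda>l. X k (diag J (X l (diag J (\<xi> k l))))) n) n \<in> PS"
        using sumS[OF x(1)] by (simp add: PS_def)
    qed
  qed
  then show ?thesis using True S_in by (auto simp: matrix_cone_def)
qed (auto simp: matrix_cone_def)

section \<open>Finite direct sums of approximants\<close>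

lemma finite_support_S:
  assumes "finite F" "f \<in> extensional I" "\<And>i. i \<in> I \<Longrightarrow> f i \<in> hcarrier (K i)"
    "\<And>i. \<lbrakk>i \<in> I; i \<notin> F\<rbrakk> \<Longrightarrow> f i = hzero (K i)"
  shows "f \<in> hcarrier S"
proof (rule S_memI[OF assms(2,3)])
  show "(\<lambda>i. (hnorm (K i) (f i))\<^sup>2) summable_on I"
    using assms(1,4) pre_hilbert.hnorm_zero[OF pre_hilbert_at]
    by (intro finite_nonzero_values_imp_summable_on finite_subset[OF _ assms(1)]) force
qed simp_all

text \<open>Zero outside \<open>F\<close>: an infinite diagonal of compact contractions need not be
  compact, so only finitely many approximants are used at a time.\<close>

definition partial_diag where "partial_diag F T = (\<lambda>i\<in>I. if i \<in> F then T i else op_zero (K i))"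

lemma partial_diag_bops:
  assumes F: "F \<subseteq> I" and T: "\<And>i. i \<in> F \<Longrightarrow> ccp (K i) (N i) (J i) (P i) (T i)"
  shows "partial_diag F T \<in> bops" "\<And>f. f \<in> hcarrier S \<Longrightarrow> hnorm S (diag (partial_diag F T) f) \<le> hnorm S f"
proof -
  have Tb: "T i \<in> bounded_op (K i)" if "i \<in> F" for i
    using T[OF that] by (simp add: ccp_def completely_positive_def)
  have t: "partial_diag F T i \<in> bounded_op (K i)" if "i \<in> I" for i
    using that Tb pre_hilbert.op_zero_bop[OF pre_hilbert_at] by (simp add: partial_diag_def)
  have b: "hnorm (K i) (partial_diag F T i v) \<le> 1 * hnorm (K i) v" if "i \<in> I" "v \<in> hcarrier (K i)" for i v
    using that T pre_hilbert.hnorm_zero[OF pre_hilbert_at] pre_hilbert.hnorm_nonneg[OF pre_hilbert_at] by (auto simp: partial_diag_def ccp_def)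
  have "partial_diag F T \<in> extensional I" unfolding partial_diag_def by (rule restrict_extensional)
  then show 1: "partial_diag F T \<in> bops" by (rule bounded_familyI[OF _ t b])
  show "hnorm S (diag (partial_diag F T) f) \<le> hnorm S f" if "f \<in> hcarrier S" for f
    using diag_bounded(2)[OF bops_in[OF 1] _ b that] by simp
qed

lemma partial_diag_ccp:
  assumes F: "F \<subseteq> I" and T: "\<And>i. i \<in> F \<Longrightarrow> ccp (K i) (N i) (J i) (P i) (T i)"
  shows "ccp S (vN_sum I K N) (diag J) PS (diag (partial_diag F T))"
  unfolding ccp_def completely_positive_def
proof (intro conjI allI impI ballI)
  note b = partial_diag_bops[OF F T]
  show "diag (partial_diag F T) \<in> bounded_op S" by (rule diag_bop[OF b(1)])
  show "hnorm S (diag (partial_diag F T) f) \<le> hnorm S f" if "f \<in> hcarrier S" for f by (rule b(2)[OF _ that])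
  fix n :: nat and \<xi> assume n: "1 \<le> n" and "\<xi> \<in> matrix_cone S (vN_sum I K N) (diag J) PS n"
  then have \<xi>: "\<And>k l. \<lbrakk>k < n; l < n\<rbrakk> \<Longrightarrow> \<xi> k l \<in> hcarrier S"
    "\<And>i. i \<in> I \<Longrightarrow> (\<lambda>k l. \<xi> k l i) \<in> matrix_cone (K i) (N i) (J i) (P i) n"
    unfolding matrix_cone_S by blast+
  show "(\<lambda>k l. diag (partial_diag F T) (\<xi> k l)) \<in> matrix_cone S (vN_sum I K N) (diag J) PS n"
    unfolding matrix_cone_S
  proof (intro conjI allI impI ballI)
    show "diag (partial_diag F T) (\<xi> k l) \<in> hcarrier S" if "k < n" "l < n" for k l
      using diag_in[OF b(1) \<xi>(1)[OF that]] .
    fix i assume i: "i \<in> I"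
    have "(\<lambda>k l. partial_diag F T i (\<xi> k l i)) \<in> matrix_cone (K i) (N i) (J i) (P i) n"
    proof (cases "i \<in> F")
      case True
      then show ?thesis
        using T[OF True] \<xi>(2)[OF i] n i by (simp add: partial_diag_def ccp_def completely_positive_def)
    next
      case False
      have "partial_diag F T i (\<xi> k l i) = hzero (K i)" if "k < n" "l < n" for k l
        using False i S_in[OF \<xi>(1)[OF that] i] by (simp add: partial_diag_def)
      then show ?thesis
        using std_form.zero_matrix_cone[OF std_form_at[OF i], of n] unfolding matrix_cone_def
        by (simp cong: hsum_cong)
    qed
    then show "(\<lambda>k l. diag (partial_diag F T) (\<xi> k l) i) \<in> matrix_cone (K i) (N i) (J i) (P i) n"
      unfolding matrix_cone_def using \<xi>(1) i by (simp add: diag_apply cong: hsum_cong)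
  qed
qed

text \<open>Coordinates of vectors in the unit ball lie in the unit balls of the summands. The
  product of finitely many finite nets, one for each index in \<open>F\<close>, padded with zeros,
  is a finite net for the image in the sum.\<close>

lemma partial_diag_compact:
  assumes fin: "finite F" and F: "F \<subseteq> I" and T: "\<And>i. i \<in> F \<Longrightarrow> ccp (K i) (N i) (J i) (P i) (T i)"
    and comp: "\<And>i. i \<in> F \<Longrightarrow> compact_op (K i) (T i)"
  shows "compact_op S (diag (partial_diag F T))"
  unfolding S.compact_op_iff
proof (intro conjI allI impI)
  note b = partial_diag_bops[OF F T]
  show "diag (partial_diag F T) \<in> bounded_op S" by (rule diag_bop[OF b(1)])
  fix e :: real assume e: "e > 0"
  define \<delta> where "\<delta> = e / (2 * (real (card F) + 1))"
  have \<delta>: "\<delta> > 0" using e by (simp add: \<delta>_def)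
  have card\<delta>: "real (card F) * \<delta>\<^sup>2 \<le> (e / 2)\<^sup>2"
    unfolding \<delta>_def by (rule card_mult_le)
  have "\<exists>C. finite C \<and> C \<subseteq> hcarrier (K i) \<and>
      (\<forall>v\<in>hcarrier (K i). hnorm (K i) v \<le> 1 \<longrightarrow> (\<exists>y\<in>C. hdist (K i) (T i v) y < \<delta>))" if "i \<in> F" for i
  proof -
    have "i \<in> I" using that F by blast
    then show ?thesis
      using comp[OF that] \<delta> unfolding hilbert_space.compact_op_iff[OF hilbert_at[OF \<open>i \<in> I\<close>]] by blast
  qed
  then obtain C where C: "\<And>i. i \<in> F \<Longrightarrow> finite (C i)" "\<And>i. i \<in> F \<Longrightarrow> C i \<subseteq> hcarrier (K i)"
    "\<And>i v. \<lbrakk>i \<in> F; v \<in> hcarrier (K i); hnorm (K i) v \<le> 1\<rbrakk> \<Longrightarrow> \<exists>y\<in>C i. hdist (K i) (T i v) y < \<delta>"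
    by metis
  define h where "h = (\<lambda>g. \<lambda>i\<in>I. if i \<in> F then g i else hzero (K i))"
  have hS: "h g \<in> hcarrier S" if g: "g \<in> PiE F C" for g
  proof (rule finite_support_S[OF fin])
    show "h g \<in> extensional I" unfolding h_def by (rule restrict_extensional)
    fix i assume i: "i \<in> I"
    show "h g i = hzero (K i)" if "i \<notin> F" using i that by (simp add: h_def)
    show "h g i \<in> hcarrier (K i)"
      using i PiE_mem[OF g] C(2) pre_hilbert.zero_in[OF pre_hilbert_at[OF i]] by (auto simp: h_def)
  qed
  show "\<exists>G. finite G \<and> G \<subseteq> hcarrier S \<and>
      (\<forall>f\<in>hcarrier S. hnorm S f \<le> 1 \<longrightarrow> (\<exists>y\<in>G. hdist S (diag (partial_diag F T) f) y < e))"
  proof (intro exI[of _ "h ` PiE F C"] conjI ballI impI)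
    show "finite (h ` PiE F C)" using fin C(1) by (intro finite_imageI finite_PiE) auto
    show "h ` PiE F C \<subseteq> hcarrier S" using hS by blast
    fix f assume f: "f \<in> hcarrier S" and f1: "hnorm S f \<le> 1"
    have "\<exists>y\<in>C i. hdist (K i) (T i (f i)) y < \<delta>" if "i \<in> F" for i
      using C(3)[OF that S_in[OF f]] S_norm_coord[OF f, of i] f1 that F by auto
    then obtain g0 where g0: "\<And>i. i \<in> F \<Longrightarrow> g0 i \<in> C i" "\<And>i. i \<in> F \<Longrightarrow> hdist (K i) (T i (f i)) (g0 i) < \<delta>"
      by metis
    define g where "g = restrict g0 F"
    have g: "g \<in> PiE F C" using g0(1) by (simp add: g_def)
    have "hdist S (diag (partial_diag F T) f) (h g) \<le> e / 2"
    proof (rule S_dist_le[OF diag_in[OF b(1) f] hS[OF g]])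
      show "0 \<le> e / 2" using e by simp
      fix G assume G: "finite G" "G \<subseteq> I"
      have "(\<Sum>i\<in>G. (hdist (K i) (diag (partial_diag F T) f i) (h g i))\<^sup>2) \<le> (\<Sum>i\<in>G. if i \<in> F then \<delta>\<^sup>2 else 0)"
      proof (rule sum_mono)
        fix i assume "i \<in> G"
        then have i: "i \<in> I" using G by blast
        interpret Ki: pre_hilbert "K i" by (rule pre_hilbert_at[OF i])
        show "(hdist (K i) (diag (partial_diag F T) f i) (h g i))\<^sup>2 \<le> (if i \<in> F then \<delta>\<^sup>2 else 0)"
        proof (cases "i \<in> F")
          case True
          then have "(hdist (K i) (T i (f i)) (g0 i))\<^sup>2 \<le> \<delta>\<^sup>2"
            using g0(2)[OF True] Ki.hdist_nonneg by (intro power_mono) auto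
          then show ?thesis using True i f by (simp add: diag_apply partial_diag_def h_def g_def)
        next
          case False
          then show ?thesis using i f S_in[OF f i] by (simp add: diag_apply partial_diag_def h_def)
        qed
      qed
      also have "\<dots> = (\<Sum>i\<in>G \<inter> F. \<delta>\<^sup>2)" by (rule sum.inter_restrict[OF G(1), symmetric])
      also have "\<dots> \<le> real (card F) * \<delta>\<^sup>2"
        using card_mono[OF fin, of "G \<inter> F"] by (simp add: mult_right_mono)
      also have "\<dots> \<le> (e / 2)\<^sup>2" by (rule card\<delta>)
      finally show "(\<Sum>i\<in>G. (hdist (K i) (diag (partial_diag F T) f i) (h g i))\<^sup>2) \<le> (e / 2)\<^sup>2" .
    qed
    then show "\<exists>y\<in>h ` PiE F C. hdist S (diag (partial_diag F T) f) y < e" using g e by force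
  qed
qed

text \<open>For finitely many vectors one finite \<open>F\<close> makes all the tails small. On
  \<open>F\<close> the error is controlled by the approximants of the summands; outside
  \<open>F\<close> the operator is zero, so the error there is exactly the tail.\<close>

lemma approximable_S:
  assumes ap: "\<And>i. i \<in> I \<Longrightarrow> approximable (K i) (N i) (J i) (P i)"
  shows "approximable S (vN_sum I K N) (diag J) PS"
  unfolding approximable_def
proof (intro allI impI)
  fix X and e :: real assume "finite X \<and> X \<subseteq> hcarrier S \<and> 0 < e"
  then have X: "finite X" "X \<subseteq> hcarrier S" and e: "0 < e" by auto
  have "\<exists>F. finite F \<and> F \<subseteq> I \<and> (hnorm S f)\<^sup>2 - (\<Sum>i\<in>F. (hnorm (K i) (f i))\<^sup>2) \<le> e\<^sup>2 / 4" if "f \<in> X" for f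
  proof -
    have f: "f \<in> hcarrier S" using that X by blast
    obtain F where F: "finite F" "F \<subseteq> I"
      "dist (\<Sum>i\<in>F. (hnorm (K i) (f i))\<^sup>2) (\<Sum>\<^sub>\<infinity>i\<in>I. (hnorm (K i) (f i))\<^sup>2) \<le> e\<^sup>2 / 4"
      using infsum_finite_approximation[OF S_summable[OF f], of "e\<^sup>2 / 4"] e by auto
    have "(hnorm S f)\<^sup>2 - (\<Sum>i\<in>F. (hnorm (K i) (f i))\<^sup>2) \<le> e\<^sup>2 / 4"
      using F(3) unfolding dist_real_def S_norm[OF f] by linarith
    then show ?thesis using F(1,2) by blast
  qed
  then have "\<forall>f\<in>X. \<exists>F. finite F \<and> F \<subseteq> I \<and> (hnorm S f)\<^sup>2 - (\<Sum>i\<in>F. (hnorm (K i) (f i))\<^sup>2) \<le> e\<^sup>2 / 4"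
    by (rule ballI)
  then obtain F0 where "\<forall>f\<in>X. finite (F0 f) \<and> F0 f \<subseteq> I \<and>
      (hnorm S f)\<^sup>2 - (\<Sum>i\<in>F0 f. (hnorm (K i) (f i))\<^sup>2) \<le> e\<^sup>2 / 4"
    by (rule bchoice[THEN exE])
  then have F0: "\<And>f. f \<in> X \<Longrightarrow> finite (F0 f)" "\<And>f. f \<in> X \<Longrightarrow> F0 f \<subseteq> I"
    "\<And>f. f \<in> X \<Longrightarrow> (hnorm S f)\<^sup>2 - (\<Sum>i\<in>F0 f. (hnorm (K i) (f i))\<^sup>2) \<le> e\<^sup>2 / 4" by simp_all
  define F where "F = \<Union>(F0 ` X)"
  have fin: "finite F" unfolding F_def using X(1) F0(1) by (rule finite_UN_I)
  have F: "F \<subseteq> I" unfolding F_def using F0(2) by (rule UN_least)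
  have tail: "(\<Sum>i\<in>G - F. (hnorm (K i) (f i))\<^sup>2) \<le> e\<^sup>2 / 4" if f: "f \<in> X" and G: "finite G" "G \<subseteq> I" for f G
  proof -
    have fS: "f \<in> hcarrier S" using f X by blast
    have "(\<Sum>i\<in>F0 f. (hnorm (K i) (f i))\<^sup>2) \<le> (\<Sum>i\<in>F. (hnorm (K i) (f i))\<^sup>2)"
      using fin f by (intro sum_mono2) (auto simp: F_def)
    moreover have "(\<Sum>i\<in>G - F. (hnorm (K i) (f i))\<^sup>2) + (\<Sum>i\<in>F. (hnorm (K i) (f i))\<^sup>2)
        = (\<Sum>i\<in>(G - F) \<union> F. (hnorm (K i) (f i))\<^sup>2)"
      using G fin by (intro sum.union_disjoint[symmetric]) auto
    moreover have "\<dots> \<le> (hnorm S f)\<^sup>2" using G F fin by (intro S_sum_le[OF fS]) auto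
    ultimately show ?thesis using F0(3)[OF f] by linarith
  qed
  define \<delta> where "\<delta> = e / (2 * (real (card F) + 1))"
  have \<delta>: "\<delta> > 0" using e by (simp add: \<delta>_def)
  have card\<delta>: "real (card F) * \<delta>\<^sup>2 \<le> e\<^sup>2 / 4"
    unfolding \<delta>_def using card_mult_le[of "card F" e] by (simp add: power_divide)
  have "\<exists>T. ccp (K i) (N i) (J i) (P i) T \<and> compact_op (K i) T \<and> (\<forall>f\<in>X. hdist (K i) (T (f i)) (f i) < \<delta>)"
    if "i \<in> F" for i
  proof -
    have i: "i \<in> I" using that F by blast
    have "finite ((\<lambda>f. f i) ` X) \<and> (\<lambda>f. f i) ` X \<subseteq> hcarrier (K i) \<and> 0 < \<delta>"
      using X S_in i \<delta> by auto
    then obtain T where "ccp (K i) (N i) (J i) (P i) T" "compact_op (K i) T"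
      "\<forall>v\<in>(\<lambda>f. f i) ` X. hdist (K i) (T v) v < \<delta>"
      using ap[OF i] unfolding approximable_def by meson
    then show ?thesis by auto
  qed
  then obtain T where T: "\<And>i. i \<in> F \<Longrightarrow> ccp (K i) (N i) (J i) (P i) (T i)"
    "\<And>i. i \<in> F \<Longrightarrow> compact_op (K i) (T i)"
    "\<And>i f. \<lbrakk>i \<in> F; f \<in> X\<rbrakk> \<Longrightarrow> hdist (K i) (T i (f i)) (f i) < \<delta>" by metis
  have b: "partial_diag F T \<in> bops" by (rule partial_diag_bops(1)[OF F T(1)])
  have "hdist S (diag (partial_diag F T) f) f < e" if fX: "f \<in> X" for f
  proof -
    have f: "f \<in> hcarrier S" using fX X by blast
    \<comment> \<open>The coordinates in \<open>F\<close> and the tail each contribute at most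
      \<open>e^2 / 4\<close> to the square, and \<open>e^2 / 2 \<le> (3 / 4 * e)^2\<close>. A factor
      below one is required because \<open>S_dist_le\<close> gives a weak inequality.\<close>
    have "hdist S (diag (partial_diag F T) f) f \<le> 3 / 4 * e"
    proof (rule S_dist_le[OF diag_in[OF b f] f])
      show "0 \<le> 3 / 4 * e" using e by simp
      fix G assume G: "finite G" "G \<subseteq> I"
      have "(\<Sum>i\<in>G. (hdist (K i) (diag (partial_diag F T) f i) (f i))\<^sup>2)
          = (\<Sum>i\<in>G \<inter> F. (hdist (K i) (diag (partial_diag F T) f i) (f i))\<^sup>2)
            + (\<Sum>i\<in>G - F. (hdist (K i) (diag (partial_diag F T) f i) (f i))\<^sup>2)"
        by (rule sum.Int_Diff[OF G(1)])
      also have "(\<Sum>i\<in>G \<inter> F. (hdist (K i) (diag (partial_diag F T) f i) (f i))\<^sup>2) \<le> (\<Sum>i\<in>G \<inter> F. \<delta>\<^sup>2)"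
      proof (rule sum_mono)
        fix i assume "i \<in> G \<inter> F"
        then have i: "i \<in> I" "i \<in> F" using G by auto
        interpret Ki: pre_hilbert "K i" by (rule pre_hilbert_at[OF i(1)])
        have "(hdist (K i) (T i (f i)) (f i))\<^sup>2 \<le> \<delta>\<^sup>2"
          using T(3)[OF i(2) fX] Ki.hdist_nonneg by (intro power_mono) auto
        then show "(hdist (K i) (diag (partial_diag F T) f i) (f i))\<^sup>2 \<le> \<delta>\<^sup>2" using i f by (simp add: diag_apply partial_diag_def)
      qed
      also have "(\<Sum>i\<in>G \<inter> F. \<delta>\<^sup>2) \<le> real (card F) * \<delta>\<^sup>2"
        using card_mono[OF fin, of "G \<inter> F"] by (simp add: mult_right_mono)
      also have "(\<Sum>i\<in>G - F. (hdist (K i) (diag (partial_diag F T) f i) (f i))\<^sup>2) = (\<Sum>i\<in>G - F. (hnorm (K i) (f i))\<^sup>2)"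
      proof (rule sum.cong[OF refl])
        fix i assume "i \<in> G - F"
        then have i: "i \<in> I" "i \<notin> F" using G by auto
        interpret Ki: pre_hilbert "K i" by (rule pre_hilbert_at[OF i(1)])
        have "hdist (K i) (hzero (K i)) (f i) = hnorm (K i) (f i)"
          using S_in[OF f i(1)] by (simp add: Ki.hdist_eq Ki.zero_add)
        then show "(hdist (K i) (diag (partial_diag F T) f i) (f i))\<^sup>2 = (hnorm (K i) (f i))\<^sup>2"
          using i f S_in[OF f i(1)] by (simp add: diag_apply partial_diag_def)
      qed
      finally have "(\<Sum>i\<in>G. (hdist (K i) (diag (partial_diag F T) f i) (f i))\<^sup>2) \<le> e\<^sup>2 / 4 + e\<^sup>2 / 4"
        using card\<delta> tail[OF fX G] by linarith
      also have "\<dots> \<le> (3 / 4 * e)\<^sup>2" by (simp add: power2_eq_square)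
      finally show "(\<Sum>i\<in>G. (hdist (K i) (diag (partial_diag F T) f i) (f i))\<^sup>2) \<le> (3 / 4 * e)\<^sup>2" .
    qed
    then show ?thesis using e by linarith
  qed
  then show "\<exists>T. ccp S (vN_sum I K N) (diag J) PS T \<and> compact_op S T \<and> (\<forall>\<xi>\<in>X. hdist S (T \<xi>) \<xi> < e)"
    using partial_diag_ccp[OF F T(1)] partial_diag_compact[OF fin F T(1,2)] by blast
qed

end

section \<open>The approximation property of sums and summands\<close>

context hilbert_family
begin

lemma diag_coord: "\<lbrakk>i \<in> I; v \<in> hcarrier (H i); x \<in> bops\<rbrakk> \<Longrightarrow> diag x (emb i v) i = x i v"
  by (simp add: diag_apply emb_in)

text \<open>The converse of \<open>diag_adjoint\<close>: testing on vectors supported at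
  \<open>i\<close> isolates the \<open>i\<close>-th coordinate.\<close>

lemma adjoint_diag:
  assumes x: "x \<in> bops" and y: "y \<in> bops" and adj: "is_adjoint S (diag x) (diag y)" and i: "i \<in> I"
  shows "is_adjoint (H i) (x i) (y i)"
  unfolding is_adjoint_def
proof (intro conjI ballI)
  show "x i \<in> bounded_op (H i)" "y i \<in> bounded_op (H i)" using bounded_family_in x y i by blast+
  fix v w assume v: "v \<in> hcarrier (H i)" and w: "w \<in> hcarrier (H i)"
  have xv: "x i v \<in> hcarrier (H i)" and yw: "y i w \<in> hcarrier (H i)" using bops_in x y i v w by auto
  have "hinner S (emb i (x i v)) (emb i w) = hinner S (emb i v) (emb i (y i w))"
    using adjoint_inner[OF adj emb_in[OF i v] emb_in[OF i w]] diag_emb[OF x i v] diag_emb[OF y i w] by simp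
  then show "hinner (H i) (x i v) w = hinner (H i) v (y i w)"
    using emb_inner[OF i xv emb_in[OF i w]] emb_inner[OF i v emb_in[OF i yw]] i by simp
qed

end

lemma vn_hilbert: "von_neumann_algebra H M \<Longrightarrow> hilbert_space H"
  by (simp only: von_neumann_algebra_def)

text \<open>The \<open>\<phi> i\<close> are unrelated to each other, so the family map
  \<open>\<Phi>\<close> must be shown to respect uniform bounds: \<open>contractive\<close> for
  \<open>\<phi> i\<close> keeps the constant \<open>C\<close>, and \<open>contractive\<close> for
  the inverse makes \<open>\<Phi>\<close> onto the bounded families of \<open>N\<close>.\<close>

lemma haagerup_sum:
  fixes I :: "'i set" and H :: "'i \<Rightarrow> 'h hilb" and M :: "'i \<Rightarrow> ('h \<Rightarrow> 'h) set"
  assumes vn: "\<And>i. i \<in> I \<Longrightarrow> von_neumann_algebra (H i) (M i)"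
    and hap: "\<And>i. i \<in> I \<Longrightarrow> haagerup_approximation_property (H i) (M i)"
  shows "haagerup_approximation_property (hilbert_sum I H) (vN_sum I H M)"
proof -
  have "\<forall>i. \<exists>(K :: 'h sf_univ hilb) N J P \<phi>. i \<in> I \<longrightarrow>
      standard_form K N J P \<and> star_isomorphism (H i) (M i) K N \<phi> \<and> approximable K N J P"
    using hap unfolding haagerup_iff_approximable by meson
  then obtain K :: "'i \<Rightarrow> 'h sf_univ hilb" and N J P \<phi> where std: "\<And>i. i \<in> I \<Longrightarrow> standard_form (K i) (N i) (J i) (P i)"
    and iso: "\<And>i. i \<in> I \<Longrightarrow> star_isomorphism (H i) (M i) (K i) (N i) (\<phi> i)"
    and ap: "\<And>i. i \<in> I \<Longrightarrow> approximable (K i) (N i) (J i) (P i)"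
    by metis
  interpret A: hilbert_family I H
    by (rule hilbert_family.intro) (rule vn_hilbert[OF vn])
  interpret B: std_family I K N J P
    by (intro std_family.intro hilbert_family.intro std_family_axioms.intro)
      (blast intro: vn_hilbert standard_form_vn std)+
  have si: "star_iso (H i) (M i) (K i) (N i) (\<phi> i)" if "i \<in> I" for i
    by (intro star_iso.intro star_iso_axioms.intro vn_algebraI[OF vn] B.vn_algebra_at iso that)
  note Mb = vn_algebra.M_bop[OF vn_algebraI[OF vn]]
  have Mbops: "A.bounded_family M \<subseteq> A.bops" by (rule A.vN_sum_bop(1)) (rule Mb)
  define \<Phi> where "\<Phi> = (\<lambda>x. \<lambda>i\<in>I. \<phi> i (x i))"
  have \<Phi>: "\<Phi> x \<in> B.bounded_family N" if x: "x \<in> A.bounded_family M" for x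
  proof -
    obtain C where C: "C > 0" "\<And>i v. \<lbrakk>i \<in> I; v \<in> hcarrier (H i)\<rbrakk> \<Longrightarrow> hnorm (H i) (x i v) \<le> C * hnorm (H i) v"
      using A.bounded_family_bound[OF x] by metis
    show ?thesis
    proof (rule B.bounded_familyI[where B=C])
      show "\<Phi> x \<in> extensional I" unfolding \<Phi>_def by (rule restrict_extensional)
      fix i assume i: "i \<in> I"
      show "\<Phi> x i \<in> N i" using star_iso.phi_in[OF si[OF i] A.bounded_family_in[OF x i]] i by (simp add: \<Phi>_def)
      fix v assume v: "v \<in> hcarrier (K i)"
      show "hnorm (K i) (\<Phi> x i v) \<le> C * hnorm (K i) v"
        using star_iso.contractive[OF si[OF i] A.bounded_family_in[OF x i] _ C(2)[OF i] v] C(1) i by (simp add: \<Phi>_def)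
    qed
  qed
  have \<Phi>_inj: "inj_on \<Phi> (A.bounded_family M)"
  proof (rule inj_onI)
    fix x y assume x: "x \<in> A.bounded_family M" and y: "y \<in> A.bounded_family M" and eq: "\<Phi> x = \<Phi> y"
    have "x i = y i" if i: "i \<in> I" for i
    proof -
      have "\<phi> i (x i) = \<phi> i (y i)" using fun_cong[OF eq, of i] i by (simp add: \<Phi>_def)
      then show ?thesis
        using star_iso.bij[OF si[OF i]] A.bounded_family_in[OF x i] A.bounded_family_in[OF y i]
        unfolding bij_betw_def inj_on_def by blast
    qed
    moreover have "x \<in> extensional I" "y \<in> extensional I" using x y by (auto simp: A.bounded_family_def PiE_def)
    ultimately show "x = y" by (meson extensionalityI)
  qed
  have \<Phi>_surj: "\<exists>x\<in>A.bounded_family M. \<Phi> x = y" if y: "y \<in> B.bounded_family N" for y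
  proof -
    obtain C where C: "C > 0" "\<And>i v. \<lbrakk>i \<in> I; v \<in> hcarrier (K i)\<rbrakk> \<Longrightarrow> hnorm (K i) (y i v) \<le> C * hnorm (K i) v"
      using B.bounded_family_bound[OF y] by metis
    define x where "x = (\<lambda>i\<in>I. inv_into (M i) (\<phi> i) (y i))"
    have "x \<in> A.bounded_family M"
    proof (rule A.bounded_familyI[where B=C])
      show "x \<in> extensional I" unfolding x_def by (rule restrict_extensional)
      fix i assume i: "i \<in> I"
      note inv = star_iso.star_iso_inv[OF si[OF i]]
      show "x i \<in> M i" using star_iso.phi_in[OF inv B.bounded_family_in[OF y i]] i by (simp add: x_def)
      fix v assume v: "v \<in> hcarrier (H i)"
      show "hnorm (H i) (x i v) \<le> C * hnorm (H i) v"
        using star_iso.contractive[OF inv B.bounded_family_in[OF y i] _ C(2)[OF i] v] C(1) i by (simp add: x_def)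
    qed
    moreover have "\<Phi> x = y"
    proof (rule extensionalityI)
      show "\<Phi> x \<in> extensional I" unfolding \<Phi>_def by (rule restrict_extensional)
      show "y \<in> extensional I" using y by (auto simp: B.bounded_family_def PiE_def)
      fix i assume i: "i \<in> I"
      have "y i \<in> \<phi> i ` M i"
        using star_iso.bij[OF si[OF i]] B.bounded_family_in[OF y i] unfolding bij_betw_def by blast
      then show "\<Phi> x i = y i" using i by (simp add: \<Phi>_def x_def f_inv_into_f)
    qed
    ultimately show ?thesis by blast
  qed
  \<comment> \<open>Passes from a diagonal operator to its family, which is unique by
    \<open>diag_inj\<close>, applies \<open>\<Phi>\<close> and returns to a diagonal
    operator.\<close>
  define \<psi> where "\<psi> = (\<lambda>T. B.diag (\<Phi> (inv_into (A.bounded_family M) A.diag T)))"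
  have diag_inj: "inj_on A.diag (A.bounded_family M)" using A.diag_inj Mbops by (meson inj_onI subsetD)
  have \<psi>: "\<psi> (A.diag x) = B.diag (\<Phi> x)" if "x \<in> A.bounded_family M" for x
    using inv_into_f_f[OF diag_inj that] by (simp add: \<psi>_def)
  note \<Phi>b = subsetD[OF B.N_bops \<Phi>]
  have bij: "bij_betw \<psi> (vN_sum I H M) (vN_sum I K N)"
    unfolding bij_betw_def
  proof
    show "inj_on \<psi> (vN_sum I H M)"
    proof (rule inj_onI)
      fix S T assume "S \<in> vN_sum I H M" "T \<in> vN_sum I H M" and eq: "\<psi> S = \<psi> T"
      then obtain x y where x: "x \<in> A.bounded_family M" "S = A.diag x" and y: "y \<in> A.bounded_family M" "T = A.diag y"
        by (auto simp: A.vN_sum_eq)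
      have "\<Phi> x = \<Phi> y" using eq x y \<psi> by (intro B.diag_inj \<Phi>b) simp_all
      then show "S = T" using \<Phi>_inj x y by (auto dest: inj_onD)
    qed
    show "\<psi> ` vN_sum I H M = vN_sum I K N"
    proof (intro equalityI subsetI)
      fix T assume "T \<in> \<psi> ` vN_sum I H M"
      then obtain x where "x \<in> A.bounded_family M" "T = \<psi> (A.diag x)" by (auto simp: A.vN_sum_eq)
      then show "T \<in> vN_sum I K N" using \<psi> \<Phi> by (simp add: B.vN_sum_eq)
    next
      fix T assume "T \<in> vN_sum I K N"
      then obtain y where y: "y \<in> B.bounded_family N" "T = B.diag y" by (auto simp: B.vN_sum_eq)
      then obtain x where x: "x \<in> A.bounded_family M" "\<Phi> x = y" using \<Phi>_surj by blast
      then have "T = \<psi> (A.diag x)" using \<psi> y by simp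
      then show "T \<in> \<psi> ` vN_sum I H M" using x(1) by (simp add: A.vN_sum_eq)
    qed
  qed
  have vnA: "vn_algebra A.S (vN_sum I H M)"
    by (rule vn_algebraI, rule A.von_neumann_vN_sum) (rule vn)
  interpret SA: vn_algebra A.S "vN_sum I H M" by (rule vnA)
  interpret SB: std_form B.S "vN_sum I K N" "B.diag J" B.PS by (rule std_formI[OF B.standard_form_S])
  \<comment> \<open>Operators of the sums are determined by the coordinates of their values on
    \<open>emb i v\<close>. The algebraic laws for \<open>\<psi>\<close> follow by giving in each
    coordinate one \<open>t\<close> that describes the operator and whose image describes its
    counterpart.\<close>
  have lift: "\<psi> T = T'" if T: "T \<in> vN_sum I H M" and T': "T' \<in> vN_sum I K N"
    and eq: "\<And>i. i \<in> I \<Longrightarrow> \<exists>t\<in>M i. (\<forall>v\<in>hcarrier (H i). T (A.emb i v) i = t v) \<and>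
        (\<forall>v\<in>hcarrier (K i). T' (B.emb i v) i = \<phi> i t v)" for T T'
  proof -
    obtain w where w: "w \<in> A.bounded_family M" "T = A.diag w" using T by (auto simp: A.vN_sum_eq)
    obtain w' where w': "w' \<in> B.bounded_family N" "T' = B.diag w'" using T' by (auto simp: B.vN_sum_eq)
    have "\<Phi> w = w'"
    proof (rule extensionalityI)
      show "\<Phi> w \<in> extensional I" unfolding \<Phi>_def by (rule restrict_extensional)
      show "w' \<in> extensional I" using w' by (auto simp: B.bounded_family_def PiE_def)
      fix i assume i: "i \<in> I"
      obtain t where t: "t \<in> M i" "\<And>v. v \<in> hcarrier (H i) \<Longrightarrow> T (A.emb i v) i = t v"
        "\<And>v. v \<in> hcarrier (K i) \<Longrightarrow> T' (B.emb i v) i = \<phi> i t v" using eq[OF i] by blast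
      have "w i = t"
      proof (rule bop_ext)
        show "w i \<in> bounded_op (H i)" "t \<in> bounded_op (H i)" using Mb[OF i] A.bounded_family_in[OF w(1) i] t(1) by auto
        show "w i v = t v" if "v \<in> hcarrier (H i)" for v
          using t(2)[OF that] A.diag_coord[OF i that subsetD[OF Mbops w(1)]] w(2) by simp
      qed
      moreover have "w' i = \<phi> i t"
      proof (rule bop_ext)
        show "w' i \<in> bounded_op (K i)" "\<phi> i t \<in> bounded_op (K i)"
          using B.N_bop[OF i] B.bounded_family_in[OF w'(1) i] star_iso.phi_in[OF si[OF i] t(1)] by auto
        show "w' i v = \<phi> i t v" if "v \<in> hcarrier (K i)" for v
          using t(3)[OF that] B.diag_coord[OF i that subsetD[OF B.N_bops w'(1)]] w'(2) by simp
      qed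
      ultimately show "\<Phi> w i = w' i" using i by (simp add: \<Phi>_def)
    qed
    then show ?thesis using \<psi>[OF w(1)] w w' by simp
  qed
  have \<psi>in: "\<psi> T \<in> vN_sum I K N" if "T \<in> vN_sum I H M" for T using bij that bij_betwE by blast
  have star: "star_isomorphism A.S (vN_sum I H M) B.S (vN_sum I K N) \<psi>"
    unfolding star_isomorphism_def
  proof (intro conjI allI ballI impI bij)
    fix T a assume T: "T \<in> vN_sum I H M"
    then obtain x where x: "x \<in> A.bounded_family M" "T = A.diag x" by (auto simp: A.vN_sum_eq)
    note xM = A.bounded_family_in[OF x(1)]
    note xb = subsetD[OF Mbops x(1)]
    have \<Phi>x: "\<Phi> x i = \<phi> i (x i)" if "i \<in> I" for i using that by (simp add: \<Phi>_def)
    have x1: "T (A.emb i v) = A.emb i (x i v)" if "i \<in> I" "v \<in> hcarrier (H i)" for i v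
      using A.diag_emb[OF xb that] x(2) by simp
    have x2: "\<psi> T (B.emb i v) = B.emb i (\<phi> i (x i) v)" if "i \<in> I" "v \<in> hcarrier (K i)" for i v
      using B.diag_emb[OF \<Phi>b[OF x(1)] that] \<psi>[OF x(1)] x(2) \<Phi>x that(1) by simp
    show "\<psi> (op_scale A.S a T) = op_scale B.S a (\<psi> T)"
    proof (rule lift[OF SA.M_closed(4)[OF T] SB.M_closed(4)[OF \<psi>in[OF T]]])
      fix i assume i: "i \<in> I"
      interpret si: star_iso "H i" "M i" "K i" "N i" "\<phi> i" by (rule si[OF i])
      show "\<exists>t\<in>M i. (\<forall>v\<in>hcarrier (H i). op_scale A.S a T (A.emb i v) i = t v) \<and>
          (\<forall>v\<in>hcarrier (K i). op_scale B.S a (\<psi> T) (B.emb i v) i = \<phi> i t v)"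
        using i si.A.M_closed(4)[OF xM[OF i], of a] si.phi_hom(2)[OF xM[OF i]]
        by (intro bexI[of _ "op_scale (H i) a (x i)"])
          (simp_all add: A.emb_in B.emb_in x1 x2 A.S_apply B.S_apply)
    qed
    fix U assume U: "U \<in> vN_sum I H M"
    then obtain y where y: "y \<in> A.bounded_family M" "U = A.diag y" by (auto simp: A.vN_sum_eq)
    note yM = A.bounded_family_in[OF y(1)]
    note yb = subsetD[OF Mbops y(1)]
    have \<Phi>y: "\<Phi> y i = \<phi> i (y i)" if "i \<in> I" for i using that by (simp add: \<Phi>_def)
    have y1: "U (A.emb i v) = A.emb i (y i v)" if "i \<in> I" "v \<in> hcarrier (H i)" for i v
      using A.diag_emb[OF yb that] y(2) by simp
    have y2: "\<psi> U (B.emb i v) = B.emb i (\<phi> i (y i) v)" if "i \<in> I" "v \<in> hcarrier (K i)" for i v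
      using B.diag_emb[OF \<Phi>b[OF y(1)] that] \<psi>[OF y(1)] y(2) \<Phi>y that(1) by simp
    show "\<psi> (op_add A.S T U) = op_add B.S (\<psi> T) (\<psi> U)"
    proof (rule lift[OF SA.M_closed(3)[OF T U] SB.M_closed(3)[OF \<psi>in[OF T] \<psi>in[OF U]]])
      fix i assume i: "i \<in> I"
      interpret si: star_iso "H i" "M i" "K i" "N i" "\<phi> i" by (rule si[OF i])
      show "\<exists>t\<in>M i. (\<forall>v\<in>hcarrier (H i). op_add A.S T U (A.emb i v) i = t v) \<and>
          (\<forall>v\<in>hcarrier (K i). op_add B.S (\<psi> T) (\<psi> U) (B.emb i v) i = \<phi> i t v)"
        using i si.A.M_closed(3)[OF xM[OF i] yM[OF i]] si.phi_hom(1)[OF xM[OF i] yM[OF i]]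
        by (intro bexI[of _ "op_add (H i) (x i) (y i)"])
          (simp_all add: A.emb_in B.emb_in x1 x2 y1 y2 A.S_apply B.S_apply)
    qed
    show "\<psi> (op_mult A.S T U) = op_mult B.S (\<psi> T) (\<psi> U)"
    proof (rule lift[OF SA.M_closed(5)[OF T U] SB.M_closed(5)[OF \<psi>in[OF T] \<psi>in[OF U]]])
      fix i assume i: "i \<in> I"
      interpret si: star_iso "H i" "M i" "K i" "N i" "\<phi> i" by (rule si[OF i])
      show "\<exists>t\<in>M i. (\<forall>v\<in>hcarrier (H i). op_mult A.S T U (A.emb i v) i = t v) \<and>
          (\<forall>v\<in>hcarrier (K i). op_mult B.S (\<psi> T) (\<psi> U) (B.emb i v) i = \<phi> i t v)"
        using i si.A.M_closed(5)[OF xM[OF i] yM[OF i]] si.phi_hom(3)[OF xM[OF i] yM[OF i]]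
          si.A.M_in[OF yM[OF i]] si.B.M_in[OF si.phi_in[OF yM[OF i]]]
        by (intro bexI[of _ "op_mult (H i) (x i) (y i)"])
          (simp_all add: A.emb_in B.emb_in x1 x2 y1 y2)
    qed
    assume adj: "is_adjoint A.S T U"
    have "is_adjoint (K i) (\<Phi> x i) (\<Phi> y i)" if i: "i \<in> I" for i
    proof -
      have "is_adjoint (H i) (x i) (y i)"
        using A.adjoint_diag[OF xb yb _ i] adj x(2) y(2) by simp
      then show ?thesis using star_iso.phi_hom(4)[OF si[OF i] xM[OF i] yM[OF i]] \<Phi>x \<Phi>y i by simp
    qed
    then show "is_adjoint B.S (\<psi> T) (\<psi> U)"
      using B.diag_adjoint[OF \<Phi>b[OF x(1)] \<Phi>b[OF y(1)]] \<psi> x y by simp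
  qed
  have one: "op_mult B.S (op_one B.S) T = T" if "T \<in> vN_sum I K N" for T
  proof (rule extensionalityI[OF op_extensional(1)])
    show "T \<in> extensional (hcarrier B.S)" using that SB.M_bop bop_extensional by blast
    show "op_mult B.S (op_one B.S) T f = T f" if "f \<in> hcarrier B.S" for f
      using that SB.M_in[OF \<open>T \<in> vN_sum I K N\<close>] by simp
  qed
  \<comment> \<open>Cutting by the unit leaves the algebra as it is. The gain is the change of type:
    the sum of the standard forms lives in functions from \<open>'i\<close> to
    \<open>'h sf_univ\<close>, and the goal requires \<open>('i => 'h) sf_univ\<close>.\<close>
  interpret C: corner B.S "vN_sum I K N" "B.diag J" B.PS "op_one B.S"
    by unfold_locales
      (simp_all add: SB.M_closed B.S.commutant_closed(1)[OF SB.M_bop] one B.S.op_one_adjoint)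
  have "{T \<in> vN_sum I K N. op_mult B.S (op_one B.S) T = T} = vN_sum I K N" using one by blast
  then show ?thesis
    using C.haagerup_corner[OF B.approximable_S[OF ap]] star by simp
qed

text \<open>\<open>M i\<close> is embedded into the sum by \<open>\<iota>\<close> with zeros
  elsewhere, and its image is the part cut out by \<open>z\<close>. Under \<open>\<phi>\<close> this
  becomes \<open>q N\<close> with \<open>q = \<phi> z\<close>, so \<open>haagerup_corner\<close>
  applies to \<open>\<phi>\<close> composed with \<open>\<iota>\<close>.\<close>

lemma haagerup_summand:
  fixes I :: "'i set" and H :: "'i \<Rightarrow> 'h hilb" and M :: "'i \<Rightarrow> ('h \<Rightarrow> 'h) set"
  assumes vn: "\<And>i. i \<in> I \<Longrightarrow> von_neumann_algebra (H i) (M i)"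
    and hap: "haagerup_approximation_property (hilbert_sum I H) (vN_sum I H M)"
    and i: "i \<in> I"
  shows "haagerup_approximation_property (H i) (M i)"
proof -
  obtain K :: "('i \<Rightarrow> 'h) sf_univ hilb" and N J P \<phi> where std: "standard_form K N J P"
    and iso: "star_isomorphism (hilbert_sum I H) (vN_sum I H M) K N \<phi>" and ap: "approximable K N J P"
    using hap unfolding haagerup_iff_approximable by blast
  interpret A: hilbert_family I H
    by (rule hilbert_family.intro) (rule vn_hilbert[OF vn])
  interpret B: std_form K N J P by (rule std_formI[OF std])
  have vnA: "vn_algebra A.S (vN_sum I H M)"
    by (rule vn_algebraI, rule A.von_neumann_vN_sum) (rule vn)
  interpret SI: star_iso A.S "vN_sum I H M" K N \<phi>
    by (intro star_iso.intro star_iso_axioms.intro vnA B.vn_algebra_axioms iso)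
  interpret Mi: vn_algebra "H i" "M i" by (rule vn_algebraI[OF vn[OF i]])
  note vn_algebra_at = vn_algebraI[OF vn]
  note Mb = vn_algebra.M_bop[OF vn_algebra_at]
  have Mbops: "A.bounded_family M \<subseteq> A.bops" by (rule A.vN_sum_bop(1)) (rule Mb)
  define \<iota> where "\<iota> = (\<lambda>y. A.diag (A.single i y))"
  have sM: "A.single i y \<in> A.bounded_family M" if "y \<in> M i" for y
    using Mb vn_algebra.M_closed(2)[OF vn_algebra_at] i that by (rule A.single_bounded_family)
  have \<iota>M: "\<iota> y \<in> vN_sum I H M" if "y \<in> M i" for y using sM[OF that] by (simp add: \<iota>_def A.vN_sum_eq)
  have \<iota>: "\<iota> y f = A.emb i (y (f i))" if "y \<in> M i" "f \<in> hcarrier A.S" for y f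
    unfolding \<iota>_def using A.diag_single[OF i _ that(2)] that(1) Mi.M_bop by blast
  have ext: "T \<in> extensional (hcarrier A.S)" if "T \<in> vN_sum I H M" for T
    using bop_extensional SI.A.M_bop that by blast
  have eqI: "S = T" if "S \<in> vN_sum I H M" "T \<in> vN_sum I H M"
    "\<And>f. f \<in> hcarrier A.S \<Longrightarrow> S f = T f" for S T
    using that by (intro extensionalityI[OF ext ext])
  have fi: "f i \<in> hcarrier (H i)" if "f \<in> hcarrier A.S" for f by (rule A.S_in[OF that i])
  have emb: "A.emb i v \<in> hcarrier A.S" if "v \<in> hcarrier (H i)" for v by (rule A.emb_in[OF i that])
  define z where "z = \<iota> (op_one (H i))"
  have zM: "z \<in> vN_sum I H M" unfolding z_def by (rule \<iota>M[OF Mi.M_closed(1)])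
  have z: "z f = A.emb i (f i)" if "f \<in> hcarrier A.S" for f
    using \<iota>[OF Mi.M_closed(1) that] fi[OF that] by (simp add: z_def)
  \<comment> \<open>Multiplication by \<open>z\<close> on either side keeps coordinate
    \<open>i\<close> and kills the others. Agreement of the two sides yields centrality of
    \<open>q\<close>; the common value yields surjectivity of \<open>\<psi>\<close> onto
    \<open>q N\<close>.\<close>
  have zT: "op_mult A.S z (A.diag x) = \<iota> (x i)" "op_mult A.S (A.diag x) z = \<iota> (x i)" if x: "x \<in> A.bounded_family M" for x
  proof -
    have xb: "x \<in> A.bops" using x Mbops by blast
    have xM: "x i \<in> M i" by (rule A.bounded_family_in[OF x i])
    have xN: "A.diag x \<in> vN_sum I H M" using x by (simp add: A.vN_sum_eq)
    show "op_mult A.S z (A.diag x) = \<iota> (x i)"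
      using \<iota>[OF xM] A.diag_in[OF xb] z A.diag_apply[OF _ i, of _ x]
      by (intro eqI SI.A.M_closed(5) zM xN \<iota>M xM) simp
    show "op_mult A.S (A.diag x) z = \<iota> (x i)"
      using \<iota>[OF xM] z A.diag_emb[OF xb i fi]
      by (intro eqI SI.A.M_closed(5) zM xN \<iota>M xM) simp
  qed
  define q where "q = \<phi> z"
  define \<psi> where "\<psi> = (\<lambda>y. \<phi> (\<iota> y))"
  have qN: "q \<in> N" unfolding q_def by (rule SI.phi_in[OF zM])
  have z\<iota>: "op_mult A.S z (\<iota> y) = \<iota> y" if "y \<in> M i" for y
    using zT(1)[OF sM[OF that]] i by (simp add: \<iota>_def A.single_def)
  have zadj: "is_adjoint A.S z z"
    unfolding z_def \<iota>_def
  proof (rule A.diag_adjoint)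
    show "A.single i (op_one (H i)) \<in> A.bops" "A.single i (op_one (H i)) \<in> A.bops"
      using sM[OF Mi.M_closed(1)] Mbops by blast+
    fix j assume j: "j \<in> I"
    show "is_adjoint (H j) (A.single i (op_one (H i)) j) (A.single i (op_one (H i)) j)"
      using j pre_hilbert.op_one_adjoint[OF A.pre_hilbert_at[OF j]] pre_hilbert.op_zero_adjoint[OF A.pre_hilbert_at[OF j]]
      by (auto simp: A.single_def)
  qed
  have surj: "\<exists>x\<in>A.bounded_family M. y = \<phi> (A.diag x)" if "y \<in> N" for y
    using SI.bij that unfolding bij_betw_def A.vN_sum_eq by blast
  interpret C: corner K N J P q
  proof unfold_locales
    show "q \<in> N" by (rule qN)
    show "q \<in> commutant K N"
    proof (rule B.commutantI)
      show "q \<in> bounded_op K" using qN B.M_bop by blast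
      fix y v assume y: "y \<in> N" and v: "v \<in> hcarrier K"
      obtain x where x: "x \<in> A.bounded_family M" "y = \<phi> (A.diag x)" using surj[OF y] by blast
      have xN: "A.diag x \<in> vN_sum I H M" using x by (simp add: A.vN_sum_eq)
      have "op_mult K q y = op_mult K y q"
        unfolding q_def x(2) using SI.phi_hom(3)[OF zM xN] SI.phi_hom(3)[OF xN zM] zT[OF x(1)] by simp
      then have "op_mult K q y v = op_mult K y q v" by simp
      then show "q (y v) = y (q v)" using v by simp
    qed
    show "op_mult K q q = q"
      unfolding q_def using SI.phi_hom(3)[OF zM zM] z\<iota>[OF Mi.M_closed(1)] by (simp add: z_def)
    show "is_adjoint K q q" unfolding q_def by (rule SI.phi_hom(4)[OF zM zM zadj])
  qed
  have "star_isomorphism (H i) (M i) K {y \<in> N. op_mult K q y = y} \<psi>"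
    unfolding star_isomorphism_def
  proof (intro conjI allI ballI impI)
    show "bij_betw \<psi> (M i) {y \<in> N. op_mult K q y = y}"
      unfolding bij_betw_def
    proof (intro conjI equalityI subsetI)
      show "inj_on \<psi> (M i)"
      proof (rule inj_onI)
        fix x y assume x: "x \<in> M i" and y: "y \<in> M i" and "\<psi> x = \<psi> y"
        then have "\<iota> x = \<iota> y"
          using SI.bij \<iota>M[OF x] \<iota>M[OF y] unfolding \<psi>_def bij_betw_def inj_on_def by blast
        then have "A.single i x = A.single i y"
          unfolding \<iota>_def using sM[OF x] sM[OF y] Mbops by (intro A.diag_inj) auto
        then have "A.single i x i = A.single i y i" by simp
        then show "x = y" using i by (simp add: A.single_def)
      qed
    next
      fix y assume "y \<in> \<psi> ` M i"
      then obtain x where x: "x \<in> M i" "y = \<phi> (\<iota> x)" by (auto simp: \<psi>_def)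
      show "y \<in> {y \<in> N. op_mult K q y = y}"
        using SI.phi_in[OF \<iota>M[OF x(1)]] SI.phi_hom(3)[OF zM \<iota>M[OF x(1)]] z\<iota>[OF x(1)] x(2)
        by (simp add: q_def)
    next
      fix y assume y: "y \<in> {y \<in> N. op_mult K q y = y}"
      then obtain x where x: "x \<in> A.bounded_family M" "y = \<phi> (A.diag x)" using surj by blast
      have xN: "A.diag x \<in> vN_sum I H M" using x by (simp add: A.vN_sum_eq)
      have "op_mult K q y = \<psi> (x i)"
        unfolding q_def x(2) \<psi>_def using SI.phi_hom(3)[OF zM xN] zT(1)[OF x(1)] by simp
      then show "y \<in> \<psi> ` M i" using y A.bounded_family_in[OF x(1) i] by auto
    qed
    fix x y a assume x: "x \<in> M i"
    have "\<iota> (op_scale (H i) a x) = op_scale A.S a (\<iota> x)"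
      using \<iota>[OF x] \<iota>[OF Mi.M_closed(4)[OF x]] fi Mi.M_in[OF x] A.emb_scale[OF i]
      by (intro eqI \<iota>M SI.A.M_closed(4) Mi.M_closed(4) x) simp
    then show "\<psi> (op_scale (H i) a x) = op_scale K a (\<psi> x)"
      using SI.phi_hom(2)[OF \<iota>M[OF x]] by (simp add: \<psi>_def)
    assume y: "y \<in> M i"
    have "\<iota> (op_add (H i) x y) = op_add A.S (\<iota> x) (\<iota> y)"
      using \<iota>[OF x] \<iota>[OF y] \<iota>[OF Mi.M_closed(3)[OF x y]] fi Mi.M_in[OF x] Mi.M_in[OF y] A.emb_add[OF i]
      by (intro eqI \<iota>M SI.A.M_closed(3) Mi.M_closed(3) x y) simp
    then show "\<psi> (op_add (H i) x y) = op_add K (\<psi> x) (\<psi> y)"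
      using SI.phi_hom(1)[OF \<iota>M[OF x] \<iota>M[OF y]] by (simp add: \<psi>_def)
    have "\<iota> (op_mult (H i) x y) = op_mult A.S (\<iota> x) (\<iota> y)"
      using \<iota>[OF x] \<iota>[OF y] \<iota>[OF Mi.M_closed(5)[OF x y]] fi emb[OF Mi.M_in[OF y fi]] i
      by (intro eqI \<iota>M SI.A.M_closed(5) Mi.M_closed(5) x y) simp
    then show "\<psi> (op_mult (H i) x y) = op_mult K (\<psi> x) (\<psi> y)"
      using SI.phi_hom(3)[OF \<iota>M[OF x] \<iota>M[OF y]] by (simp add: \<psi>_def)
    assume adj: "is_adjoint (H i) x y"
    have "is_adjoint A.S (\<iota> x) (\<iota> y)"
      unfolding \<iota>_def
    proof (rule A.diag_adjoint)
      show "A.single i x \<in> A.bops" "A.single i y \<in> A.bops" using sM x y Mbops by blast+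
      show "is_adjoint (H j) (A.single i x j) (A.single i y j)" if "j \<in> I" for j
        using that adj pre_hilbert.op_zero_adjoint[OF A.pre_hilbert_at] by (simp add: A.single_def)
    qed
    then show "is_adjoint K (\<psi> x) (\<psi> y)"
      unfolding \<psi>_def by (rule SI.phi_hom(4)[OF \<iota>M[OF x] \<iota>M[OF y]])
  qed
  then show ?thesis by (rule C.haagerup_corner[OF ap])
qed

theorem theorem3p14:
  fixes I :: "'i set" and H :: "'i \<Rightarrow> 'h hilb" and M :: "'i \<Rightarrow> ('h \<Rightarrow> 'h) set"
  assumes "\<And>i. i \<in> I \<Longrightarrow> von_neumann_algebra (H i) (M i)"
  shows "haagerup_approximation_property (hilbert_sum I H) (vN_sum I H M) \<longleftrightarrow>
         (\<forall>i\<in>I. haagerup_approximation_property (H i) (M i))"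
  using haagerup_sum[of I H M] haagerup_summand[of I H M] assms by blast

end
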